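(* The following hold: (i) For all $\mu,\nu\in\mathcal P_2(E)$, $d_G(\mu,\nu)\ge0$ and $d_G(\mu,\nu)=d_G(\nu,\mu)$. (ii) For all $\mu^0,\mu^1,\mu^2\in\mathcal P_2(E)$, $d_G(\mu^0,\mu^1)+d_G(\mu^1,\mu^2)\ge d_G(\mu^0,\mu^2)$. (iii) For all $\mu,\nu\in\mathcal P_2(E)$, $d_G(\mu,\nu)=\inf_{T>0}\mathcal E_G^T(\mu,\nu)$. In general, $d_G$ is a pseudo-distance on $\mathcal P_2(E)$.
   Context: $E\subseteq\mathbb R^d$; $\mathcal P_2(E)$ is the set of probability measures on $E$ with finite second moment, with the Wasserstein-2 metric $\mathcal W_2$. $\mathcal A_0(\mu)$ is the set of pairs $(\boldsymbol\mu,\alpha)$ where $\boldsymbol\mu=(\mu_t)_{t\ge0}$ is a continuous curve in $\mathcal P_2(E)$ with $\mu_0=\mu$, $\alpha:[0,\infty)\times E\to\mathbb R^d$ is Borel with $\int_0^\infty e^{-t}\|\alpha_t\|^2_{L^2(\mu_t)}\mathrm dt<\infty$, and $\partial_t\mu_t+\nabla\cdot(\alpha_t\mu_t)=0$ in the sense of distributions. With a running cost $\ell:\mathcal P_2(E)\to\mathbb R$, continuous and bounded from below, $v_0(\mu)=\inf_{(\boldsymbol\mu,\alpha)\in\mathcal A_0(\mu)}\int_0^\infty e^{-t}\big(\frac12\int_E\|\alpha_t\|^2\mathrm d\mu_t+\ell(\mu_t)\big)\mathrm dt$. $G(\mu):=\sqrt{2(\ell(\mu)-v_0(\mu))}\ge0$;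 it is a standing assumption of this setting that $G$ is well defined and is a strong upper gradient of $v_0$, i.e. for every absolutely continuous curve $\boldsymbol\mu$, $G\circ\boldsymbol\mu$ is Borel and $|v_0(\mu_t)-v_0(\mu_s)|\le\int_s^tG(\mu_r)|\mu'|(r)\mathrm dr$ for $s\le t$. $AC^2(I;\mathcal P_2(E))$: curves with $\mathcal W_2(\mu_s,\mu_t)\le\int_s^tm_u\mathrm du$ for some $m\in L^2(I)$. Metric derivative: $|\mu'|(t)=\lim_{s\to t}\mathcal W_2(\mu_s,\mu_t)/|s-t|$. $$d_G(\mu,\nu)=\inf\Big\{\int_0^1|\mu'|(t)\,G(\mu_t)\,\mathrm dt:\ \boldsymbol\mu\in AC^2([0,1];\mathcal P_2(E)),\ \mu_0=\mu,\ \mu_1=\nu\Big\},$$ $$\mathcal E_G^T(\mu,\nu)=\inf\Big\{\int_0^T\big(\tfrac12|\eta'|^2(t)+\tfrac12G(\eta_t)^2\big)\mathrm dt:\ \eta\in AC^2([0,T];\mathcal P_2(E)),\ \eta_0=\mu,\ \eta_T=\nu\Big\}.$$ A pseudo-distance is a nonnegative, symmetric function vanishing on the diagonal and satisfying the triangle inequality. *)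

theory Defs
  imports "HOL-Probability.Probability"
begin

text \<open>
  The ambient space \<open>\<real>\<^sup>d\<close> is a type \<open>'a\<close> of class \<open>euclidean_space\<close>. A probability measure on
  \<open>E\<close> is a measure on the Borel sets of the subspace \<open>E\<close>; for such measures
  \<open>\<integral>\<dots>d\<mu>\<close> is an integral over \<open>E\<close>.
\<close>

definition P2 :: "'a::euclidean_space set \<Rightarrow> 'a measure set" where
  "P2 E = {\<mu>. prob_space \<mu> \<and> sets \<mu> = sets (restrict_space borel E) \<and>
              integrable \<mu> (\<lambda>x. (norm x)\<^sup>2)}"

definition couplings :: "'a measure \<Rightarrow> 'a measure \<Rightarrow> ('a \<times> 'a) measure set" where
  "couplings \<mu> \<nu> = {\<pi>. sets \<pi> = sets (\<mu> \<Otimes>\<^sub>M \<nu>) \<and> distr \<pi> \<mu> fst = \<mu> \<and> distr \<pi> \<nu> snd = \<nu>}"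

text \<open>The infimum is finite for \<open>\<mu>, \<nu> \<in> P2 E\<close>, so nothing is lost by passing to real values.\<close>

definition W2 :: "'a::euclidean_space measure \<Rightarrow> 'a measure \<Rightarrow> real" where
  "W2 \<mu> \<nu> = sqrt (enn2real (INF \<pi>\<in>couplings \<mu> \<nu>. \<integral>\<^sup>+(x, y). ennreal ((norm (x - y))\<^sup>2) \<partial>\<pi>))"

abbreviation P2_topology :: "'a::euclidean_space set \<Rightarrow> 'a measure topology" where
  "P2_topology E \<equiv> Metric_space.mtopology (P2 E) W2"

text \<open>
  Integral of an extended-real function whose negative part has a finite integral, as the
  difference of the integrals of its positive and negative parts (\<open>e2ennreal\<close> sends negative
  numbers to \<open>0\<close>). The value \<open>\<infinity>\<close> is allowed.
\<close>

definition ext_integral :: "'b measure \<Rightarrow> ('b \<Rightarrow> ereal) \<Rightarrow> ereal" where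
  "ext_integral M f =
     enn2ereal (\<integral>\<^sup>+x. e2ennreal (f x) \<partial>M) - enn2ereal (\<integral>\<^sup>+x. e2ennreal (- f x) \<partial>M)"

text \<open>\<open>AC p E I \<gamma>\<close> is \<open>\<gamma> \<in> AC\<^sup>p(I; P2 E)\<close>; absolute continuity is the case \<open>p = 1\<close>.\<close>

definition AC :: "nat \<Rightarrow> 'a::euclidean_space set \<Rightarrow> real set \<Rightarrow> (real \<Rightarrow> 'a measure) \<Rightarrow> bool" where
  "AC p E I \<gamma> \<longleftrightarrow>
     (\<forall>t\<in>I. \<gamma> t \<in> P2 E) \<and>
     (\<exists>m. set_borel_measurable lborel I m \<and>
          set_integrable lborel I (\<lambda>t. \<bar>m t\<bar> ^ p) \<and>
          (\<forall>s\<in>I. \<forall>t\<in>I. s \<le> t \<longrightarrow> W2 (\<gamma> s) (\<gamma> t) \<le> (LBINT u:{s..t}. m u)))"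

text \<open>
  For absolutely continuous curves the limit exists at almost every \<open>t \<in> I\<close>; the value \<open>0\<close> at
  the remaining \<open>t\<close> does not affect any integral.
\<close>

definition metric_derivative :: "real set \<Rightarrow> (real \<Rightarrow> 'a::euclidean_space measure) \<Rightarrow> real \<Rightarrow> real" where
  "metric_derivative I \<gamma> t =
     (let q = (\<lambda>s. W2 (\<gamma> s) (\<gamma> t) / \<bar>s - t\<bar>)
      in if \<exists>L. (q \<longlongrightarrow> L) (at t within I) then Lim (at t within I) q else 0)"

text \<open>\<open>Ck k \<phi>\<close>: \<open>\<phi>\<close> is \<open>k\<close> times continuously differentiable, by recursion on partial derivatives.\<close>

fun Ck :: "nat \<Rightarrow> ('b::euclidean_space \<Rightarrow> real) \<Rightarrow> bool" where
  "Ck 0 \<phi> \<longleftrightarrow> continuous_on UNIV \<phi>"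
| "Ck (Suc k) \<phi> \<longleftrightarrow> \<phi> differentiable_on UNIV \<and>
     (\<forall>b\<in>Basis. Ck k (\<lambda>z. frechet_derivative \<phi> (at z) b))"

definition test_functions :: "(real \<times> 'a::euclidean_space \<Rightarrow> real) set" where
  "test_functions = {\<phi>. (\<forall>k. Ck k \<phi>) \<and> compact (closure {z. \<phi> z \<noteq> 0}) \<and>
                        closure {z. \<phi> z \<noteq> 0} \<subseteq> {0<..} \<times> UNIV}"

text \<open>
  \<open>\<partial>\<^sub>t\<mu>\<^sub>t + \<nabla>\<cdot>(\<alpha>\<^sub>t\<mu>\<^sub>t) = 0\<close> in the sense of distributions on \<open>(0,\<infinity>) \<times> \<real>\<^sup>d\<close>, each \<open>\<mu>\<^sub>t\<close> being regarded as
  a measure on \<open>\<real>\<^sup>d\<close> that is concentrated on \<open>E\<close>. The two summands are \<open>\<partial>\<^sub>t\<phi>(t,x)\<close> and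
  \<open>\<nabla>\<phi>(t,x) \<bullet> \<alpha>\<^sub>t(x)\<close>.
\<close>

definition continuity_equation ::
    "(real \<Rightarrow> 'a::euclidean_space measure) \<Rightarrow> (real \<Rightarrow> 'a \<Rightarrow> 'a) \<Rightarrow> bool" where
  "continuity_equation \<gamma> \<alpha> \<longleftrightarrow>
     (\<forall>\<phi>\<in>test_functions.
        (LBINT t:{0..}. (LINT x|\<gamma> t. frechet_derivative \<phi> (at (t, x)) (1, 0) +
                                      frechet_derivative \<phi> (at (t, x)) (0, \<alpha> t x))) = 0)"

definition A0 :: "'a::euclidean_space set \<Rightarrow> 'a measure
    \<Rightarrow> ((real \<Rightarrow> 'a measure) \<times> (real \<Rightarrow> 'a \<Rightarrow> 'a)) set" where
  "A0 E \<mu> = {(\<gamma>, \<alpha>).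
     continuous_map (top_of_set {0..}) (P2_topology E) \<gamma> \<and> \<gamma> 0 = \<mu> \<and>
     (\<lambda>(t, x). \<alpha> t x) \<in> borel_measurable (restrict_space borel ({0..} \<times> E)) \<and>
     (\<integral>\<^sup>+t\<in>{0..}. ennreal (exp (- t)) * (\<integral>\<^sup>+x. ennreal ((norm (\<alpha> t x))\<^sup>2) \<partial>\<gamma> t) \<partial>lborel) < \<infinity> \<and>
     continuity_equation \<gamma> \<alpha>}"

definition v0 :: "'a::euclidean_space set \<Rightarrow> ('a measure \<Rightarrow> real) \<Rightarrow> 'a measure \<Rightarrow> ereal" where
  "v0 E l \<mu> = (INF (\<gamma>, \<alpha>)\<in>A0 E \<mu>. ext_integral (restrict_space lborel {0..})
     (\<lambda>t. ereal (exp (- t)) *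
        (ereal (1 / 2) * enn2ereal (\<integral>\<^sup>+x. ennreal ((norm (\<alpha> t x))\<^sup>2) \<partial>\<gamma> t) + ereal (l (\<gamma> t)))))"

definition G_well_defined :: "'a::euclidean_space set \<Rightarrow> ('a measure \<Rightarrow> real) \<Rightarrow> bool" where
  "G_well_defined E l \<longleftrightarrow> (\<forall>\<mu>\<in>P2 E. \<bar>v0 E l \<mu>\<bar> \<noteq> \<infinity> \<and> v0 E l \<mu> \<le> ereal (l \<mu>))"

definition G :: "'a::euclidean_space set \<Rightarrow> ('a measure \<Rightarrow> real) \<Rightarrow> 'a measure \<Rightarrow> real" where
  "G E l \<mu> = sqrt (2 * (l \<mu> - real_of_ereal (v0 E l \<mu>)))"

definition strong_upper_gradient ::
    "'a::euclidean_space set \<Rightarrow> ('a measure \<Rightarrow> real) \<Rightarrow> ('a measure \<Rightarrow> real) \<Rightarrow> bool" where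
  "strong_upper_gradient E f g \<longleftrightarrow>
     (\<forall>I \<gamma>. is_interval I \<and> AC 1 E I \<gamma> \<longrightarrow>
        (\<lambda>t. g (\<gamma> t)) \<in> borel_measurable (restrict_space borel I) \<and>
        (\<forall>s\<in>I. \<forall>t\<in>I. s \<le> t \<longrightarrow>
           ereal \<bar>f (\<gamma> t) - f (\<gamma> s)\<bar> \<le>
             ext_integral (restrict_space lborel {s..t})
               (\<lambda>r. ereal (g (\<gamma> r) * metric_derivative I \<gamma> r))))"

text \<open>
  Both infima below are over possibly empty sets of curves and of possibly infinite integrals;
  they are extended-real valued, and the infimum of the empty set is \<open>\<infinity>\<close>.
\<close>

definition d_G :: "'a::euclidean_space set \<Rightarrow> ('a measure \<Rightarrow> real) \<Rightarrow> 'a measure \<Rightarrow> 'a measure \<Rightarrow> ereal" where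
  "d_G E l \<mu> \<nu> = (INF \<gamma>\<in>{\<gamma>. AC 2 E {0..1} \<gamma> \<and> \<gamma> 0 = \<mu> \<and> \<gamma> 1 = \<nu>}.
     ext_integral (restrict_space lborel {0..1})
       (\<lambda>t. ereal (metric_derivative {0..1} \<gamma> t * G E l (\<gamma> t))))"

definition energy_G :: "'a::euclidean_space set \<Rightarrow> ('a measure \<Rightarrow> real) \<Rightarrow> real
    \<Rightarrow> 'a measure \<Rightarrow> 'a measure \<Rightarrow> ereal" where
  "energy_G E l T \<mu> \<nu> = (INF \<eta>\<in>{\<eta>. AC 2 E {0..T} \<eta> \<and> \<eta> 0 = \<mu> \<and> \<eta> T = \<nu>}.
     ext_integral (restrict_space lborel {0..T})
       (\<lambda>t. ereal (1 / 2 * (metric_derivative {0..T} \<eta> t)\<^sup>2 + 1 / 2 * (G E l (\<eta> t))\<^sup>2)))"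

definition pseudo_distance_on :: "'b set \<Rightarrow> ('b \<Rightarrow> 'b \<Rightarrow> ereal) \<Rightarrow> bool" where
  "pseudo_distance_on X d \<longleftrightarrow>
     (\<forall>x\<in>X. \<forall>y\<in>X. 0 \<le> d x y) \<and>
     (\<forall>x\<in>X. \<forall>y\<in>X. d x y = d y x) \<and>
     (\<forall>x\<in>X. d x x = 0) \<and>
     (\<forall>x\<in>X. \<forall>y\<in>X. \<forall>z\<in>X. d x z \<le> d x y + d y z)"

end

theory Submission
  imports Defs
begin

text \<open>
  Symmetry of \<open>d\<^sub>G\<close> is reversal of time, the triangle inequality is concatenation of two curves run at
  double speed, and \<open>d\<^sub>G\<close> vanishes on the diagonal because of the constant curve. The content is
  the identity \<open>d\<^sub>G = inf\<^sub>T E\<^sub>G\<^sup>T\<close>. Write \<open>p = |\<gamma>'|\<close> and \<open>k = G \<circ> \<gamma>\<close>. The weighted length \<open>\<integral>pk\<close> is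
  unchanged by a reparametrization, whereas the action \<open>\<integral>(p\<^sup>2 + k\<^sup>2) / 2\<close> is at least the weighted length and
  equals it when \<open>p = k\<close>. Hence \<open>d\<^sub>G \<le> E\<^sub>G\<^sup>T\<close> follows by rescaling \<open>[0,T]\<close> to \<open>[0,1]\<close>. Conversely, if
  time is run along \<open>\<gamma>\<close> at the rate \<open>\<theta>' = w\<close>, the reparametrized curve \<open>\<gamma> \<circ> \<theta>\<^sup>-\<^sup>1\<close> has action
  \<open>\<integral>(p\<^sup>2 / w + k\<^sup>2 w) / 2\<close>, and the choice \<open>w = p / k\<close> would turn this into \<open>\<integral>pk\<close>.

  In general, that choice of \<open>w\<close> is not bounded, not bounded away from \<open>0\<close> and not continuous. The lemma
  \<open>near_optimal_weight\<close> repairs this: truncating \<open>p\<close> and adding a small constant to numerator and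
  denominator costs little, since \<open>p\<close> is square integrable and \<open>k\<close> is bounded, and a bounded measurable weight is an
  almost everywhere limit of continuous ones. For a continuous weight bounded away from \<open>0\<close> the time change is
  a diffeomorphism of class \<open>C\<^sup>1\<close>, so metric derivatives transform by the chain rule at every point
  (\<open>speed_compose\<close>) and integrals by substitution.

  Two ingredients carry this. First, \<open>W\<^sub>2\<close> is a metric on \<open>P2 E\<close> (\<open>Metric_space_W2\<close>). The set \<open>E\<close> may be any subset of the
  space, where disintegration can fail; couplings are therefore glued approximately, along a
  partition of the middle space into countably many small cells (\<open>coupling_glue\<close>), and the triangle
  inequality appears in the limit. Second, the metric derivative, which is set to \<open>0\<close> where the limit
  does not exist, is a measurable function whose square integral is controlled by the bound \<open>m\<close> in
  the definition of \<open>AC\<^sup>2\<close> (\<open>speed_square_integral\<close>).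

  The hypotheses on \<open>\<ell>\<close> and \<open>v\<^sub>0\<close> enter through \<open>path_cost_G\<close>: along an \<open>AC\<^sup>2\<close> curve the function \<open>G\<close> is
  measurable, nonnegative and bounded, the last because \<open>\<ell>\<close> is continuous and \<open>v\<^sub>0\<close> inherits every lower bound
  of \<open>\<ell>\<close>. The rest of the argument holds for any cost with these three properties, and this is how it is
  organised.
\<close>

section \<open>Gluing of couplings along a countable partition\<close>

text \<open>
  The density \<open>w\<close> describes two points that are drawn so that their cells coincide and that are
  independent given the common cell. Integrating it over the second point with the first one fixed,
  or the other way round, gives \<open>1\<close>, which is why both marginals are preserved; cells of measure \<open>0\<close>, where
  the density is infinite, are almost surely not met.
\<close>

lemma countable_partition_density:
  fixes k1 :: "'b \<Rightarrow> nat" and k2 :: "'c \<Rightarrow> nat"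
  assumes P: "prob_space P" and Q: "prob_space Q"
    and k1 [measurable]: "k1 \<in> measurable P (count_space UNIV)"
    and k2 [measurable]: "k2 \<in> measurable Q (count_space UNIV)"
    and eq: "\<And>i. emeasure P {p\<in>space P. k1 p = i} = emeasure Q {q\<in>space Q. k2 q = i}"
  defines "w \<equiv> \<lambda>z. (if k1 (fst z) = k2 (snd z)
                       then 1 / emeasure P {p\<in>space P. k1 p = k1 (fst z)} else 0 :: ennreal)"
  shows "distr (density (P \<Otimes>\<^sub>M Q) w) P fst = P" "distr (density (P \<Otimes>\<^sub>M Q) w) Q snd = Q"
    "w \<in> borel_measurable (P \<Otimes>\<^sub>M Q)"
proof -
  interpret P: prob_space P by fact
  interpret Q: prob_space Q by fact
  interpret PQ: pair_sigma_finite P Q ..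
  define N where "N = (\<lambda>i. emeasure P {p\<in>space P. k1 p = i})"
  have [measurable]: "N \<in> measurable (count_space UNIV) borel" by simp
  have w: "w = (\<lambda>z. if k1 (fst z) = k2 (snd z) then 1 / N (k1 (fst z)) else 0)"
    unfolding w_def N_def ..
  have "Measurable.pred (P \<Otimes>\<^sub>M Q) (\<lambda>z. \<exists>i. k1 (fst z) = i \<and> k2 (snd z) = i)" by measurable
  then have [measurable]: "Measurable.pred (P \<Otimes>\<^sub>M Q) (\<lambda>z. k1 (fst z) = k2 (snd z))"
    by (simp add: eq_commute)
  show [measurable]: "w \<in> borel_measurable (P \<Otimes>\<^sub>M Q)" unfolding w by measurable
  have fin: "N i \<noteq> \<infinity>" for i by (simp add: N_def)
  have one: "N i * (1 / N i) = 1" if "N i \<noteq> 0" for i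
    using that fin[of i] by (simp add: ennreal_times_divide ennreal_divide_self top.not_eq_extremum)
  have "AE p in P. \<forall>i. k1 p = i \<longrightarrow> N i \<noteq> 0"
    unfolding AE_all_countable
  proof
    fix i show "AE p in P. k1 p = i \<longrightarrow> N i \<noteq> 0"
      by (cases "N i = 0") (auto simp: N_def AE_iff_null null_setsI)
  qed
  then have nzP: "AE p in P. N (k1 p) \<noteq> 0" by simp
  have N2: "N i = emeasure Q {q\<in>space Q. k2 q = i}" for i using eq by (simp add: N_def)
  have "AE q in Q. \<forall>i. k2 q = i \<longrightarrow> N i \<noteq> 0"
    unfolding AE_all_countable
  proof
    fix i show "AE q in Q. k2 q = i \<longrightarrow> N i \<noteq> 0"
      by (cases "N i = 0") (auto simp: N2 AE_iff_null null_setsI)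
  qed
  then have nzQ: "AE q in Q. N (k2 q) \<noteq> 0" by simp
  show "distr (density (P \<Otimes>\<^sub>M Q) w) P fst = P"
  proof (rule measure_eqI)
    fix A assume "A \<in> sets (distr (density (P \<Otimes>\<^sub>M Q) w) P fst)"
    then have A [measurable]: "A \<in> sets P" by simp
    have "emeasure (distr (density (P \<Otimes>\<^sub>M Q) w) P fst) A
        = (\<integral>\<^sup>+z. w z * indicator A (fst z) \<partial>(P \<Otimes>\<^sub>M Q))"
      by (subst emeasure_distr, simp, simp, subst emeasure_density, simp)
         (auto intro!: nn_integral_cong split: split_indicator)
    also have "\<dots> = (\<integral>\<^sup>+p. \<integral>\<^sup>+q. w (p, q) * indicator A p \<partial>Q \<partial>P)"
      by (subst Q.nn_integral_fst[symmetric]) auto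
    also have "\<dots> = (\<integral>\<^sup>+p. indicator A p \<partial>P)"
    proof (rule nn_integral_cong_AE)
      have "(\<integral>\<^sup>+q. w (p, q) * indicator A p \<partial>Q) = indicator A p"
        if p: "p \<in> space P" and nz: "N (k1 p) \<noteq> 0" for p
      proof -
        have "(\<integral>\<^sup>+q. w (p, q) * indicator A p \<partial>Q)
            = (\<integral>\<^sup>+q. (1 / N (k1 p) * indicator A p) * indicator {q\<in>space Q. k2 q = k1 p} q \<partial>Q)"
          by (intro nn_integral_cong) (auto simp: w split: split_indicator)
        also have "\<dots> = indicator A p * (N (k1 p) * (1 / N (k1 p)))"
          by (subst nn_integral_cmult_indicator) (auto simp: N2 ac_simps)
        also have "\<dots> = indicator A p" by (simp add: one[OF nz])
        finally show ?thesis .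
      qed
      then show "AE p in P. (\<integral>\<^sup>+q. w (p, q) * indicator A p \<partial>Q) = indicator A p"
        using nzP by auto
    qed
    finally show "emeasure (distr (density (P \<Otimes>\<^sub>M Q) w) P fst) A = emeasure P A" by simp
  qed simp
  show "distr (density (P \<Otimes>\<^sub>M Q) w) Q snd = Q"
  proof (rule measure_eqI)
    fix A assume "A \<in> sets (distr (density (P \<Otimes>\<^sub>M Q) w) Q snd)"
    then have A [measurable]: "A \<in> sets Q" by simp
    have "emeasure (distr (density (P \<Otimes>\<^sub>M Q) w) Q snd) A
        = (\<integral>\<^sup>+z. w z * indicator A (snd z) \<partial>(P \<Otimes>\<^sub>M Q))"
      by (subst emeasure_distr, simp, simp, subst emeasure_density, simp)
         (auto intro!: nn_integral_cong split: split_indicator)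
    also have "\<dots> = (\<integral>\<^sup>+q. \<integral>\<^sup>+p. w (p, q) * indicator A q \<partial>P \<partial>Q)"
      by (subst PQ.nn_integral_snd[symmetric]) (auto simp: case_prod_beta)
    also have "\<dots> = (\<integral>\<^sup>+q. indicator A q \<partial>Q)"
    proof (rule nn_integral_cong_AE)
      have "(\<integral>\<^sup>+p. w (p, q) * indicator A q \<partial>P) = indicator A q"
        if q: "q \<in> space Q" and nz: "N (k2 q) \<noteq> 0" for q
      proof -
        have "(\<integral>\<^sup>+p. w (p, q) * indicator A q \<partial>P)
            = (\<integral>\<^sup>+p. (1 / N (k2 q) * indicator A q) * indicator {p\<in>space P. k1 p = k2 q} p \<partial>P)"
          by (intro nn_integral_cong) (auto simp: w split: split_indicator)
        also have "\<dots> = indicator A q * (N (k2 q) * (1 / N (k2 q)))"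
          by (subst nn_integral_cmult_indicator) (auto simp: N_def ac_simps)
        also have "\<dots> = indicator A q" by (simp add: one[OF nz])
        finally show ?thesis .
      qed
      then show "AE q in Q. (\<integral>\<^sup>+p. w (p, q) * indicator A q \<partial>P) = indicator A q"
        using nzQ by auto
    qed
    finally show "emeasure (distr (density (P \<Otimes>\<^sub>M Q) w) Q snd) A = emeasure Q A" by simp
  qed simp
qed

text \<open>
  A point belongs to the cell of the first element of a dense sequence that is closer than \<open>\<epsilon> / 2\<close>.
\<close>

lemma small_cells:
  fixes \<epsilon> :: real
  assumes "\<epsilon> > 0"
  obtains k :: "'a::euclidean_space \<Rightarrow> nat"
  where "k \<in> measurable borel (count_space UNIV)" "\<And>x y. k x = k y \<Longrightarrow> norm (x - y) \<le> \<epsilon>"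
proof -
  obtain D :: "'a set" where D: "countable D" "\<And>X. open X \<Longrightarrow> X \<noteq> {} \<Longrightarrow> \<exists>d\<in>D. d \<in> X"
    using countable_dense_setE by blast
  define k where "k = (\<lambda>x. LEAST i. dist x (from_nat_into D i) < \<epsilon> / 2)"
  have "k \<in> measurable borel (count_space UNIV)" unfolding k_def by measurable
  moreover have near: "dist x (from_nat_into D (k x)) < \<epsilon> / 2" for x
  proof -
    obtain d where d: "d \<in> D" "dist x d < \<epsilon> / 2"
      using D(2)[of "ball x (\<epsilon> / 2)"] assms by auto
    then obtain i where "from_nat_into D i = d"
      using from_nat_into_surj[OF D(1)] by blast
    then show ?thesis
      unfolding k_def using d by (intro LeastI[where P="\<lambda>i. dist x (from_nat_into D i) < \<epsilon> / 2"]) auto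
  qed
  have "norm (x - y) \<le> \<epsilon>" if "k x = k y" for x y
  proof -
    have "dist x y \<le> dist x (from_nat_into D (k x)) + dist y (from_nat_into D (k x))"
      by (rule dist_triangle2)
    then show ?thesis using near[of x] near[of y] that by (simp add: dist_norm)
  qed
  ultimately show ?thesis by (rule that)
qed

abbreviation transport_cost :: "('a::euclidean_space \<times> 'a) measure \<Rightarrow> ennreal" where
  "transport_cost \<pi> \<equiv> \<integral>\<^sup>+(x, y). ennreal ((norm (x - y))\<^sup>2) \<partial>\<pi>"

lemma P2_prob: "\<mu> \<in> P2 E \<Longrightarrow> prob_space \<mu>"
  by (simp add: P2_def)

lemma measurable_P2:
  assumes "\<mu> \<in> P2 E" "f \<in> measurable borel N"
  shows "f \<in> measurable \<mu> N"
proof -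
  have "sets \<mu> = sets (restrict_space borel E)" using assms by (simp add: P2_def)
  then show ?thesis
    using measurable_restrict_space1[OF assms(2), of E] measurable_cong_sets by blast
qed

lemma coupling_marginals:
  assumes "\<pi> \<in> couplings \<mu> \<nu>"
  shows "sets \<pi> = sets (\<mu> \<Otimes>\<^sub>M \<nu>)" "fst \<in> measurable \<pi> \<mu>" "snd \<in> measurable \<pi> \<nu>"
    "distr \<pi> \<mu> fst = \<mu>" "distr \<pi> \<nu> snd = \<nu>"
  using assms measurable_cong_sets[of \<pi> "\<mu> \<Otimes>\<^sub>M \<nu>" _ _ , OF _ refl] by (auto simp: couplings_def)

lemma coupling_prob_space:
  assumes "\<pi> \<in> couplings \<mu> \<nu>" "prob_space \<mu>"
  shows "prob_space \<pi>"
proof -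
  interpret prob_space \<mu> by fact
  have "emeasure \<mu> (space \<mu>) = emeasure \<pi> (fst -` space \<mu> \<inter> space \<pi>)"
    by (subst coupling_marginals(4)[OF assms(1), symmetric],
        subst emeasure_distr) (auto simp: coupling_marginals[OF assms(1)])
  also have "fst -` space \<mu> \<inter> space \<pi> = space \<pi>"
    using measurable_space[OF coupling_marginals(2)[OF assms(1)]] by auto
  finally show ?thesis by (intro prob_spaceI) (simp add: emeasure_space_1)
qed

lemma measurable_dist_coupling:
  assumes "\<pi> \<in> couplings \<mu> \<nu>" "\<mu> \<in> P2 E" "\<nu> \<in> P2 E"
  shows "fst \<in> borel_measurable \<pi>" "snd \<in> borel_measurable \<pi>"
    "(\<lambda>z. norm (fst z - snd z)) \<in> borel_measurable \<pi>"
proof -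
  show 1: "fst \<in> borel_measurable \<pi>" "snd \<in> borel_measurable \<pi>"
    using measurable_compose[OF coupling_marginals(2)[OF assms(1)] measurable_P2[OF assms(2) measurable_ident]]
      measurable_compose[OF coupling_marginals(3)[OF assms(1)] measurable_P2[OF assms(3) measurable_ident]]
    by auto
  show "(\<lambda>z. norm (fst z - snd z)) \<in> borel_measurable \<pi>"
    using 1 by measurable
qed

text \<open>
  A plan from \<open>\<mu>\<close> to \<open>\<nu>\<close> and a plan from \<open>\<nu>\<close> to \<open>\<rho>\<close> are joined so that the end \<open>y\<close> of the first step and
  the beginning \<open>y'\<close> of the second one lie in the same cell of diameter at most \<open>\<epsilon>\<close>, instead of being equal. Then
  \<open>|x - z| \<le> |x - y| + \<epsilon> + |y' - z|\<close>, and the Minkowski inequality in \<open>L\<^sup>2\<close> gives the cost. On an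
  arbitrary subset \<open>E\<close> conditional distributions given \<open>y\<close> may fail to exist, but one can always condition on
  a cell of positive measure.
\<close>

lemma coupling_glue:
  fixes \<mu> \<nu> \<rho> :: "'a::euclidean_space measure"
  assumes P2: "\<mu> \<in> P2 E" "\<nu> \<in> P2 E" "\<rho> \<in> P2 E"
    and \<pi>: "\<pi> \<in> couplings \<mu> \<nu>" and \<sigma>: "\<sigma> \<in> couplings \<nu> \<rho>"
    and cost_\<pi>: "transport_cost \<pi> \<le> ennreal (\<alpha>\<^sup>2)" and cost_\<sigma>: "transport_cost \<sigma> \<le> ennreal (\<beta>\<^sup>2)"
    and pos: "\<alpha> > 0" "\<beta> > 0" "\<epsilon> > 0"
  shows "\<exists>\<tau>\<in>couplings \<mu> \<rho>. transport_cost \<tau> \<le> ennreal ((\<alpha> + \<beta> + \<epsilon>)\<^sup>2)"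
proof -
  obtain k :: "'a \<Rightarrow> nat" where k: "k \<in> measurable borel (count_space UNIV)"
    and near: "\<And>x y. k x = k y \<Longrightarrow> norm (x - y) \<le> \<epsilon>" using small_cells[OF \<open>\<epsilon> > 0\<close>] by blast
  note [measurable] = coupling_marginals(2,3)[OF \<pi>] coupling_marginals(2,3)[OF \<sigma>]
    measurable_P2[OF P2(1) k] measurable_P2[OF P2(2) k] measurable_P2[OF P2(3) k]
    measurable_dist_coupling[OF \<pi> P2(1,2)] measurable_dist_coupling[OF \<sigma> P2(2,3)]
  interpret \<pi>: prob_space \<pi> by (rule coupling_prob_space[OF \<pi> P2_prob[OF P2(1)]])
  interpret \<sigma>: prob_space \<sigma> by (rule coupling_prob_space[OF \<sigma> P2_prob[OF P2(2)]])
  have cell: "emeasure \<pi> {p\<in>space \<pi>. k (snd p) = i} = emeasure \<sigma> {q\<in>space \<sigma>. k (fst q) = i}" for i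
  proof -
    have "emeasure \<nu> {y\<in>space \<nu>. k y = i} = emeasure \<pi> {p\<in>space \<pi>. k (snd p) = i}"
      by (subst coupling_marginals(5)[OF \<pi>, symmetric], subst emeasure_distr)
         (auto intro!: arg_cong2[where f=emeasure] dest: measurable_space[OF coupling_marginals(3)[OF \<pi>]])
    moreover have "emeasure \<nu> {y\<in>space \<nu>. k y = i} = emeasure \<sigma> {q\<in>space \<sigma>. k (fst q) = i}"
      by (subst coupling_marginals(4)[OF \<sigma>, symmetric], subst emeasure_distr)
         (auto intro!: arg_cong2[where f=emeasure] dest: measurable_space[OF coupling_marginals(2)[OF \<sigma>]])
    ultimately show ?thesis by simp
  qed
  define w where "w = (\<lambda>z :: ('a \<times> 'a) \<times> ('a \<times> 'a). (if k (snd (fst z)) = k (fst (snd z))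
     then 1 / emeasure \<pi> {p\<in>space \<pi>. k (snd p) = k (snd (fst z))} else 0 :: ennreal))"
  define Q where "Q = density (\<pi> \<Otimes>\<^sub>M \<sigma>) w"
  have kk: "(\<lambda>p. k (snd p)) \<in> measurable \<pi> (count_space UNIV)"
    "(\<lambda>q. k (fst q)) \<in> measurable \<sigma> (count_space UNIV)" by measurable
  note dens = countable_partition_density[OF \<pi>.prob_space_axioms \<sigma>.prob_space_axioms kk cell]
  have Q1: "distr Q \<pi> fst = \<pi>" and Q2: "distr Q \<sigma> snd = \<sigma>"
    and w [measurable]: "w \<in> borel_measurable (\<pi> \<Otimes>\<^sub>M \<sigma>)"
    using dens by (simp_all add: Q_def w_def)
  have setsQ [measurable_cong]: "sets Q = sets (\<pi> \<Otimes>\<^sub>M \<sigma>)" by (simp add: Q_def)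
  define e where "e = (\<lambda>z::('a \<times> 'a) \<times> ('a \<times> 'a). (fst (fst z), snd (snd z)))"
  have e [measurable]: "e \<in> measurable Q (\<mu> \<Otimes>\<^sub>M \<rho>)" unfolding e_def by measurable
  define \<tau> where "\<tau> = distr Q (\<mu> \<Otimes>\<^sub>M \<rho>) e"
  have "\<tau> \<in> couplings \<mu> \<rho>"
  proof -
    have "distr \<tau> \<mu> fst = distr Q \<mu> (\<lambda>z. fst (fst z))"
      unfolding \<tau>_def by (subst distr_distr) (auto simp: e_def comp_def)
    also have "\<dots> = distr (distr Q \<pi> fst) \<mu> fst"
      by (subst distr_distr) (auto simp: comp_def)
    finally have 1: "distr \<tau> \<mu> fst = \<mu>" using coupling_marginals[OF \<pi>] by (simp add: Q1)
    have "distr \<tau> \<rho> snd = distr Q \<rho> (\<lambda>z. snd (snd z))"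
      unfolding \<tau>_def by (subst distr_distr) (auto simp: e_def comp_def)
    also have "\<dots> = distr (distr Q \<sigma> snd) \<rho> snd"
      by (subst distr_distr) (auto simp: comp_def)
    finally have 2: "distr \<tau> \<rho> snd = \<rho>" using coupling_marginals[OF \<sigma>] by (simp add: Q2)
    show ?thesis using 1 2 by (simp add: couplings_def \<tau>_def)
  qed
  moreover have "transport_cost \<tau> \<le> ennreal ((\<alpha> + \<beta> + \<epsilon>)\<^sup>2)"
  proof -
    define S where "S = \<alpha> + \<beta> + \<epsilon>"
    have S: "S > 0" using pos by (simp add: S_def)
    let ?c = "\<lambda>z::'a\<times>'a. (norm (fst z - snd z))\<^sup>2"
    have fin: "transport_cost \<pi> = (\<integral>\<^sup>+z. ennreal (?c (fst z)) \<partial>Q)"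
      "transport_cost \<sigma> = (\<integral>\<^sup>+z. ennreal (?c (snd z)) \<partial>Q)"
      by (subst Q1[symmetric], subst nn_integral_distr, auto simp: case_prod_beta)
         (subst Q2[symmetric], subst nn_integral_distr, auto simp: case_prod_beta)
    have tot: "emeasure Q (space Q) = 1"
    proof -
      have "emeasure \<pi> (space \<pi>) = emeasure Q (fst -` space \<pi> \<inter> space Q)"
        by (subst Q1[symmetric], subst emeasure_distr) auto
      also have "fst -` space \<pi> \<inter> space Q = space Q"
        by (auto simp: Q_def space_pair_measure)
      finally show ?thesis by (simp add: \<pi>.emeasure_space_1)
    qed
    \<comment> \<open>The Cauchy-Schwarz inequality with weights \<open>\<alpha>\<close>, \<open>\<beta>\<close>, \<open>\<epsilon>\<close>. Integrated, it becomes the Minkowski bound, because the integrals of \<open>a\<^sup>2\<close> and \<open>b\<^sup>2\<close> are at most \<open>\<alpha>\<^sup>2\<close> and \<open>\<beta>\<^sup>2\<close>.\<close>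
    have cs: "(a + b + c)\<^sup>2 \<le> S * (a\<^sup>2 / \<alpha> + b\<^sup>2 / \<beta> + c\<^sup>2 / \<epsilon>)" for a b c
    proof -
      have sq: "2 * x * y \<le> x\<^sup>2 * v / u + y\<^sup>2 * u / v" if "u > 0" "v > 0" for x y u v :: real
      proof -
        have "0 \<le> (x * v - y * u)\<^sup>2 / (u * v)" using that by simp
        also have "\<dots> = x\<^sup>2 * v / u + y\<^sup>2 * u / v - 2 * x * y"
          using that by (simp add: field_simps power2_eq_square)
        finally show ?thesis by simp
      qed
      have "S * (a\<^sup>2 / \<alpha> + b\<^sup>2 / \<beta> + c\<^sup>2 / \<epsilon>) = a\<^sup>2 + b\<^sup>2 + c\<^sup>2
          + (a\<^sup>2 * \<beta> / \<alpha> + b\<^sup>2 * \<alpha> / \<beta>) + (a\<^sup>2 * \<epsilon> / \<alpha> + c\<^sup>2 * \<alpha> / \<epsilon>) + (b\<^sup>2 * \<epsilon> / \<beta> + c\<^sup>2 * \<beta> / \<epsilon>)"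
        using pos by (simp add: S_def field_simps)
      then show ?thesis
        using sq[OF pos(1,2), of a b] sq[OF pos(1,3), of a c] sq[OF pos(2,3), of b c]
        by (simp add: power2_eq_square algebra_simps)
    qed
    have "transport_cost \<tau> = (\<integral>\<^sup>+z. ennreal ((norm (fst (fst z) - snd (snd z)))\<^sup>2) \<partial>Q)"
      unfolding \<tau>_def
    proof (subst nn_integral_distr)
      have "fst \<in> measurable (\<mu> \<Otimes>\<^sub>M \<rho>) borel" "snd \<in> measurable (\<mu> \<Otimes>\<^sub>M \<rho>) borel"
        using measurable_compose[OF measurable_fst measurable_P2[OF P2(1) measurable_ident]]
          measurable_compose[OF measurable_snd measurable_P2[OF P2(3) measurable_ident]]
        by auto
      then show "(\<lambda>(x, y). ennreal ((norm (x - y))\<^sup>2)) \<in> borel_measurable (distr Q (\<mu> \<Otimes>\<^sub>M \<rho>) e)"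
        by (simp add: case_prod_beta)
    qed (auto simp: e_def case_prod_beta)
    also have "\<dots> \<le> (\<integral>\<^sup>+z. ennreal (S / \<alpha>) * ennreal (?c (fst z)) + ennreal (S / \<beta>) * ennreal (?c (snd z))
                          + ennreal (S * \<epsilon>) \<partial>Q)"
    proof (rule nn_integral_mono_AE)
      have "AE z in Q. k (snd (fst z)) = k (fst (snd z))"
        unfolding Q_def by (subst AE_density[OF w]) (simp add: w_def)
      then show "AE z in Q. ennreal ((norm (fst (fst z) - snd (snd z)))\<^sup>2)
        \<le> ennreal (S / \<alpha>) * ennreal (?c (fst z)) + ennreal (S / \<beta>) * ennreal (?c (snd z)) + ennreal (S * \<epsilon>)"
      proof eventually_elim
        case (elim z)
        define x y y' u where xyz: "x = fst (fst z)" "y = snd (fst z)" "y' = fst (snd z)" "u = snd (snd z)"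
        have "norm (x - u) \<le> norm (x - y) + norm (y - y') + norm (y' - u)"
          by (smt (verit) norm_triangle_ineq diff_add_cancel add_diff_eq)
        also have "\<dots> \<le> norm (x - y) + norm (y' - u) + \<epsilon>"
          using near[of y y'] elim by (simp add: xyz)
        finally have "(norm (x - u))\<^sup>2 \<le> (norm (x - y) + norm (y' - u) + \<epsilon>)\<^sup>2"
          by (intro power_mono) auto
        also have "\<dots> \<le> S * ((norm (x - y))\<^sup>2 / \<alpha> + (norm (y' - u))\<^sup>2 / \<beta> + \<epsilon>\<^sup>2 / \<epsilon>)" by (rule cs)
        also have "\<dots> = S / \<alpha> * (norm (x - y))\<^sup>2 + S / \<beta> * (norm (y' - u))\<^sup>2 + S * \<epsilon>"
          using pos by (simp add: power2_eq_square algebra_simps)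
        finally show ?case
          using S pos by (simp add: xyz ennreal_mult[symmetric] ennreal_plus[symmetric] del: ennreal_plus)
      qed
    qed
    also have "\<dots> = ennreal (S / \<alpha>) * transport_cost \<pi> + ennreal (S / \<beta>) * transport_cost \<sigma> + ennreal (S * \<epsilon>)"
      by (subst nn_integral_add, simp, simp)
         (subst nn_integral_add, simp_all add: nn_integral_cmult fin tot)
    also have "\<dots> \<le> ennreal (S / \<alpha>) * ennreal (\<alpha>\<^sup>2) + ennreal (S / \<beta>) * ennreal (\<beta>\<^sup>2) + ennreal (S * \<epsilon>)"
      by (intro add_mono mult_left_mono cost_\<pi> cost_\<sigma>) auto
    also have "\<dots> = ennreal (S / \<alpha> * \<alpha>\<^sup>2 + S / \<beta> * \<beta>\<^sup>2 + S * \<epsilon>)"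
      using S pos by (simp add: ennreal_mult[symmetric] ennreal_plus[symmetric] del: ennreal_plus)
    also have "S / \<alpha> * \<alpha>\<^sup>2 + S / \<beta> * \<beta>\<^sup>2 + S * \<epsilon> = S\<^sup>2"
      using pos by (simp add: S_def power2_eq_square field_simps)
    finally show ?thesis by (simp add: S_def)
  qed
  ultimately show ?thesis by blast
qed

section \<open>The Wasserstein metric\<close>

text \<open>
  The integral is the supremum over simple functions below \<open>f\<close>, and each of them can be composed with
  the map. The inequality is meant for exchanging the two marginals of a coupling of arbitrary measures, with respect to
  which the distance function can be non-measurable.
\<close>

lemma nn_integral_distr_le:
  assumes [measurable]: "T \<in> measurable M N"
  shows "(\<integral>\<^sup>+x. f x \<partial>(distr M N T)) \<le> (\<integral>\<^sup>+x. f (T x) \<partial>M)"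
  unfolding nn_integral_def[of "distr M N T"]
proof (rule SUP_least, clarify)
  fix g assume g: "simple_function (distr M N T) g" "g \<le> f"
  then have [measurable]: "g \<in> borel_measurable N"
    using borel_measurable_simple_function by fastforce
  have "integral\<^sup>S (distr M N T) g = (\<integral>\<^sup>+x. g (T x) \<partial>M)"
    by (simp add: nn_integral_eq_simple_integral[OF g(1), symmetric] nn_integral_distr)
  also have "\<dots> \<le> (\<integral>\<^sup>+x. f (T x) \<partial>M)"
    using g(2) by (intro nn_integral_mono) (auto simp: le_fun_def)
  finally show "integral\<^sup>S (distr M N T) g \<le> (\<integral>\<^sup>+x. f (T x) \<partial>M)" .
qed

lemma coupling_swap:
  fixes \<mu> \<nu> :: "'a::euclidean_space measure"
  assumes "\<pi> \<in> couplings \<mu> \<nu>"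
  shows "\<exists>\<tau>\<in>couplings \<nu> \<mu>. transport_cost \<tau> \<le> transport_cost \<pi>"
proof
  let ?s = "\<lambda>z. (snd z, fst z)"
  note [measurable] = coupling_marginals(2,3)[OF assms]
  define \<tau> where "\<tau> = distr \<pi> (\<nu> \<Otimes>\<^sub>M \<mu>) ?s"
  show "\<tau> \<in> couplings \<nu> \<mu>"
    using coupling_marginals(4,5)[OF assms]
    by (simp add: couplings_def \<tau>_def distr_distr comp_def)
  have "transport_cost \<tau> \<le> (\<integral>\<^sup>+z. (case ?s z of (x, y) \<Rightarrow> ennreal ((norm (x - y))\<^sup>2)) \<partial>\<pi>)"
    unfolding \<tau>_def by (rule nn_integral_distr_le) measurable
  also have "\<dots> = transport_cost \<pi>"
    by (intro nn_integral_cong) (auto simp: norm_minus_commute)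
  finally show "transport_cost \<tau> \<le> transport_cost \<pi>" .
qed

lemma coupling_product:
  fixes \<mu> \<nu> :: "'a::euclidean_space measure"
  assumes "\<mu> \<in> P2 E" "\<nu> \<in> P2 E"
  shows "\<exists>\<tau>\<in>couplings \<mu> \<nu>. transport_cost \<tau> < \<infinity>"
proof
  interpret \<mu>: prob_space \<mu> using assms(1) by (rule P2_prob)
  interpret \<nu>: prob_space \<nu> using assms(2) by (rule P2_prob)
  interpret pair_prob_space \<mu> \<nu> ..
  have fst: "distr (\<mu> \<Otimes>\<^sub>M \<nu>) \<mu> fst = \<mu>" and snd: "distr (\<mu> \<Otimes>\<^sub>M \<nu>) \<nu> snd = \<nu>"
  proof -
    show "distr (\<mu> \<Otimes>\<^sub>M \<nu>) \<mu> fst = \<mu>" by (rule \<nu>.distr_pair_fst)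
    have "distr (\<mu> \<Otimes>\<^sub>M \<nu>) \<nu> snd = distr (\<nu> \<Otimes>\<^sub>M \<mu>) \<nu> fst"
      by (subst distr_pair_swap, subst distr_distr) (auto simp: comp_def case_prod_beta)
    then show "distr (\<mu> \<Otimes>\<^sub>M \<nu>) \<nu> snd = \<nu>" by (simp add: \<mu>.distr_pair_fst)
  qed
  show c: "\<mu> \<Otimes>\<^sub>M \<nu> \<in> couplings \<mu> \<nu>" by (simp add: couplings_def fst snd)
  note [measurable] = measurable_dist_coupling[OF c assms]
    measurable_P2[OF assms(1) measurable_ident] measurable_P2[OF assms(2) measurable_ident]
  have fin: "(\<integral>\<^sup>+x. ennreal ((norm x)\<^sup>2) \<partial>\<kappa>) < \<infinity>" if "\<kappa> \<in> P2 E" for \<kappa>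
    using that by (auto simp: P2_def integrable_iff_bounded)
  have "transport_cost (\<mu> \<Otimes>\<^sub>M \<nu>)
      \<le> (\<integral>\<^sup>+z. 2 * ennreal ((norm (fst z))\<^sup>2) + 2 * ennreal ((norm (snd z))\<^sup>2) \<partial>(\<mu> \<Otimes>\<^sub>M \<nu>))"
  proof (rule nn_integral_mono, clarsimp)
    fix x y :: 'a
    have "(norm (x - y))\<^sup>2 \<le> (norm x + norm y)\<^sup>2" by (intro power_mono norm_triangle_ineq4) auto
    also have "\<dots> \<le> 2 * (norm x)\<^sup>2 + 2 * (norm y)\<^sup>2"
      using sum_squares_bound[of "norm x" "norm y"] by (simp add: power2_sum)
    finally have "ennreal ((norm (x - y))\<^sup>2) \<le> ennreal (2 * (norm x)\<^sup>2 + 2 * (norm y)\<^sup>2)"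
      by (rule ennreal_leI)
    then show "ennreal ((norm (x - y))\<^sup>2) \<le> 2 * ennreal ((norm x)\<^sup>2) + 2 * ennreal ((norm y)\<^sup>2)"
      by (simp add: ennreal_mult)
  qed
  also have "\<dots> = 2 * (\<integral>\<^sup>+z. ennreal ((norm (fst z))\<^sup>2) \<partial>(\<mu> \<Otimes>\<^sub>M \<nu>)) + 2 * (\<integral>\<^sup>+z. ennreal ((norm (snd z))\<^sup>2) \<partial>(\<mu> \<Otimes>\<^sub>M \<nu>))"
    by (subst nn_integral_add, simp, simp) (subst (1 2) nn_integral_cmult, simp_all)
  also have "(\<integral>\<^sup>+z. ennreal ((norm (fst z))\<^sup>2) \<partial>(\<mu> \<Otimes>\<^sub>M \<nu>)) = (\<integral>\<^sup>+x. ennreal ((norm x)\<^sup>2) \<partial>\<mu>)"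
    using nn_integral_distr[OF measurable_fst, of "\<lambda>x. ennreal ((norm x)\<^sup>2)" \<mu> "\<nu>"]
      measurable_P2[OF assms(1), of "\<lambda>x. ennreal ((norm x)\<^sup>2)" borel] by (simp add: fst)
  also have "(\<integral>\<^sup>+z. ennreal ((norm (snd z))\<^sup>2) \<partial>(\<mu> \<Otimes>\<^sub>M \<nu>)) = (\<integral>\<^sup>+x. ennreal ((norm x)\<^sup>2) \<partial>\<nu>)"
    using nn_integral_distr[OF measurable_snd, of "\<lambda>x. ennreal ((norm x)\<^sup>2)" \<mu> "\<nu>"]
      measurable_P2[OF assms(2), of "\<lambda>x. ennreal ((norm x)\<^sup>2)" borel] by (simp add: snd)
  also have "2 * (\<integral>\<^sup>+x. ennreal ((norm x)\<^sup>2) \<partial>\<mu>) + 2 * (\<integral>\<^sup>+x. ennreal ((norm x)\<^sup>2) \<partial>\<nu>) < \<infinity>"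
    using fin[OF assms(1)] fin[OF assms(2)] by (simp add: ennreal_mult_less_top)
  finally show "transport_cost (\<mu> \<Otimes>\<^sub>M \<nu>) < \<infinity>" .
qed

text \<open>
  This lemma and \<open>W2_less\<close> translate between \<open>W2\<close> and couplings of nearly optimal cost, so that
  the infimum does not have to be attained.
\<close>

lemma W2_le:
  assumes "\<pi> \<in> couplings \<mu> \<nu>" "transport_cost \<pi> \<le> ennreal (r\<^sup>2)" "0 \<le> r"
  shows "W2 \<mu> \<nu> \<le> r"
proof -
  have "(INF \<pi>\<in>couplings \<mu> \<nu>. transport_cost \<pi>) \<le> ennreal (r\<^sup>2)"
    using assms by (meson INF_lower2)
  then have "enn2real (INF \<pi>\<in>couplings \<mu> \<nu>. transport_cost \<pi>) \<le> r\<^sup>2"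
    by (rule enn2real_leI[OF zero_le_power2])
  then show ?thesis unfolding W2_def using assms(3) by (intro real_le_lsqrt) auto
qed

lemma W2_less:
  assumes "\<mu> \<in> P2 E" "\<nu> \<in> P2 E" "W2 \<mu> \<nu> < r"
  shows "\<exists>\<pi>\<in>couplings \<mu> \<nu>. transport_cost \<pi> \<le> ennreal (r\<^sup>2)"
proof -
  let ?I = "INF \<pi>\<in>couplings \<mu> \<nu>. transport_cost \<pi>"
  have r: "0 < r" using assms(3) by (rule le_less_trans[rotated]) (simp add: W2_def)
  have fin: "?I < \<infinity>" using coupling_product[OF assms(1,2)] by (meson INF_lower le_less_trans)
  have "enn2real ?I < r\<^sup>2"
    using assms(3) real_le_rsqrt[of r "enn2real ?I"] unfolding W2_def by linarith
  then have "ennreal (enn2real ?I) < ennreal (r\<^sup>2)" using r by (intro ennreal_lessI) auto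
  then have "?I < ennreal (r\<^sup>2)" using fin by simp
  then show ?thesis by (auto simp: INF_less_iff intro: less_imp_le)
qed

lemma W2_nonneg [simp]: "0 \<le> W2 \<mu> \<nu>"
  by (simp add: W2_def)

text \<open>
  Symmetry is stated for all measures, as the notion of a metric space on a carrier asks for it on the whole type.
\<close>

lemma W2_commute:
  fixes \<mu> \<nu> :: "'a::euclidean_space measure"
  shows "W2 \<mu> \<nu> = W2 \<nu> \<mu>"
proof -
  have "(INF \<pi>\<in>couplings \<nu> \<mu>. transport_cost \<pi>) \<le> (INF \<pi>\<in>couplings \<mu> \<nu>. transport_cost \<pi>)"
    for \<mu> \<nu> :: "'a measure"
    by (rule INF_mono) (rule coupling_swap)
  then have "(INF \<pi>\<in>couplings \<mu> \<nu>. transport_cost \<pi>) = (INF \<pi>\<in>couplings \<nu> \<mu>. transport_cost \<pi>)"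
    by (intro antisym)
  then show ?thesis by (simp only: W2_def)
qed

lemma W2_triangle:
  assumes "\<mu> \<in> P2 E" "\<nu> \<in> P2 E" "\<rho> \<in> P2 E"
  shows "W2 \<mu> \<rho> \<le> W2 \<mu> \<nu> + W2 \<nu> \<rho>"
proof (rule field_le_epsilon)
  fix e :: real assume "e > 0"
  define d where "d = e / 3"
  have d: "d > 0" using \<open>e > 0\<close> by (simp add: d_def)
  obtain \<pi> where \<pi>: "\<pi> \<in> couplings \<mu> \<nu>" "transport_cost \<pi> \<le> ennreal ((W2 \<mu> \<nu> + d)\<^sup>2)"
    using W2_less[OF assms(1,2), of "W2 \<mu> \<nu> + d"] d by auto
  obtain \<sigma> where \<sigma>: "\<sigma> \<in> couplings \<nu> \<rho>" "transport_cost \<sigma> \<le> ennreal ((W2 \<nu> \<rho> + d)\<^sup>2)"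
    using W2_less[OF assms(2,3), of "W2 \<nu> \<rho> + d"] d by auto
  have p: "W2 \<mu> \<nu> + d > 0" "W2 \<nu> \<rho> + d > 0" using d W2_nonneg add_nonneg_pos by metis+
  obtain \<tau> where "\<tau> \<in> couplings \<mu> \<rho>"
    "transport_cost \<tau> \<le> ennreal ((W2 \<mu> \<nu> + d + (W2 \<nu> \<rho> + d) + d)\<^sup>2)"
    using coupling_glue[OF assms \<pi>(1) \<sigma>(1) \<pi>(2) \<sigma>(2) p d] by blast
  then have "W2 \<mu> \<rho> \<le> W2 \<mu> \<nu> + d + (W2 \<nu> \<rho> + d) + d"
    by (rule W2_le) (use p d in auto)
  then show "W2 \<mu> \<rho> \<le> W2 \<mu> \<nu> + W2 \<nu> \<rho> + e" by (simp add: d_def)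
qed

lemma W2_self:
  fixes \<mu> :: "'a::euclidean_space measure"
  assumes "\<mu> \<in> P2 E"
  shows "W2 \<mu> \<mu> = 0"
proof -
  have "distr \<mu> (\<mu> \<Otimes>\<^sub>M \<mu>) (\<lambda>x. (x, x)) \<in> couplings \<mu> \<mu>"
    by (simp add: couplings_def distr_distr comp_def distr_id2)
  moreover have "fst \<in> measurable (\<mu> \<Otimes>\<^sub>M \<mu>) borel" "snd \<in> measurable (\<mu> \<Otimes>\<^sub>M \<mu>) borel"
    using measurable_compose[OF measurable_fst measurable_P2[OF assms measurable_ident]]
      measurable_compose[OF measurable_snd measurable_P2[OF assms measurable_ident]]
    by auto
  then have "transport_cost (distr \<mu> (\<mu> \<Otimes>\<^sub>M \<mu>) (\<lambda>x. (x, x))) = 0"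
    by (subst nn_integral_distr) (auto simp: case_prod_beta)
  ultimately show ?thesis
    using W2_le[of _ \<mu> \<mu> 0] by (intro antisym) auto
qed

text \<open>
  A point of \<open>C\<close> is moved out of the \<open>\<delta>\<close>-neighbourhood of \<open>C\<close> only if it moves by at least \<open>\<delta>\<close>, and by
  the Markov inequality this has probability at most \<open>\<delta>\<close> under a coupling of cost \<open>\<delta>\<^sup>4\<close>. As \<open>\<delta>\<close> tends to \<open>0\<close>,
  the neighbourhoods decrease to \<open>C\<close>. The image measures on the whole space are used because \<open>C\<close> is closed there.
\<close>

lemma W2_zero_closed_le:
  fixes \<mu> \<nu> :: "'a::euclidean_space measure"
  assumes "\<mu> \<in> P2 E" "\<nu> \<in> P2 E" and zero: "W2 \<mu> \<nu> = 0" and C: "closed C"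
  shows "emeasure (distr \<mu> borel (\<lambda>x. x)) C \<le> emeasure (distr \<nu> borel (\<lambda>x. x)) C"
proof (cases "C = {}")
  case False
  interpret \<mu>: prob_space \<mu> using assms(1) by (rule P2_prob)
  interpret \<nu>: prob_space \<nu> using assms(2) by (rule P2_prob)
  have id [measurable]: "(\<lambda>x. x) \<in> measurable \<mu> borel" "(\<lambda>x. x) \<in> measurable \<nu> borel"
    using measurable_P2[OF assms(1) measurable_ident] measurable_P2[OF assms(2) measurable_ident]
    by (auto simp: id_def)
  define \<nu>' where "\<nu>' = distr \<nu> borel (\<lambda>x. x)"
  interpret \<nu>': prob_space \<nu>' unfolding \<nu>'_def by (rule \<nu>.prob_space_distr) simp
  define \<delta> where "\<delta> = (\<lambda>n. 1 / real (Suc n))"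
  define U where "U = (\<lambda>n. {y. infdist y C < \<delta> n})"
  have [measurable]: "C \<in> sets borel" using C by simp
  have [measurable]: "U n \<in> sets borel" for n
    unfolding U_def by (intro borel_open open_Collect_less continuous_intros)
  have pos: "\<delta> n > 0" for n by (simp add: \<delta>_def)
  have bound: "emeasure (distr \<mu> borel (\<lambda>x. x)) C \<le> emeasure \<nu>' (U n) + ennreal (\<delta> n)" for n
  proof -
    obtain \<pi> where \<pi>: "\<pi> \<in> couplings \<mu> \<nu>" "transport_cost \<pi> \<le> ennreal ((\<delta> n * \<delta> n)\<^sup>2)"
      using W2_less[OF assms(1,2), of "\<delta> n * \<delta> n"] pos[of n] zero by auto
    note [measurable] = coupling_marginals(2,3)[OF \<pi>(1)] measurable_dist_coupling[OF \<pi>(1) assms(1,2)]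
    have far: "emeasure \<pi> {z\<in>space \<pi>. \<delta> n \<le> norm (fst z - snd z)} \<le> ennreal (\<delta> n)"
    proof -
      have "emeasure \<pi> {z\<in>space \<pi>. \<delta> n \<le> norm (fst z - snd z)}
          = (\<integral>\<^sup>+z. indicator {z\<in>space \<pi>. \<delta> n \<le> norm (fst z - snd z)} z \<partial>\<pi>)" by simp
      also have "\<dots> \<le> (\<integral>\<^sup>+z. ennreal (1 / (\<delta> n)\<^sup>2) * ennreal ((norm (fst z - snd z))\<^sup>2) \<partial>\<pi>)"
      proof (rule nn_integral_mono)
        fix z :: "'a \<times> 'a"
        have "1 \<le> 1 / (\<delta> n)\<^sup>2 * (norm (fst z - snd z))\<^sup>2" if "\<delta> n \<le> norm (fst z - snd z)"
          using power_mono[OF that, of 2] pos[of n] by (simp add: field_simps)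
        then have "1 \<le> ennreal (1 / (\<delta> n)\<^sup>2) * ennreal ((norm (fst z - snd z))\<^sup>2)"
          if "\<delta> n \<le> norm (fst z - snd z)"
          using that ennreal_leI[of 1] by (simp add: ennreal_mult[symmetric])
        then show "indicator {z\<in>space \<pi>. \<delta> n \<le> norm (fst z - snd z)} z
            \<le> ennreal (1 / (\<delta> n)\<^sup>2) * ennreal ((norm (fst z - snd z))\<^sup>2)"
          by (cases "z \<in> {z\<in>space \<pi>. \<delta> n \<le> norm (fst z - snd z)}") (auto simp del: ennreal_mult'')
      qed
      also have "\<dots> = ennreal (1 / (\<delta> n)\<^sup>2) * transport_cost \<pi>"
        by (subst nn_integral_cmult) (auto simp: case_prod_unfold)
      also have "\<dots> \<le> ennreal (1 / (\<delta> n)\<^sup>2) * ennreal ((\<delta> n * \<delta> n)\<^sup>2)"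
        by (intro mult_left_mono \<pi>(2)) auto
      also have "\<dots> = ennreal ((\<delta> n)\<^sup>2)"
        using pos[of n] by (subst ennreal_mult[symmetric]) (auto simp: power2_eq_square)
      also have "\<dots> \<le> ennreal (\<delta> n)"
      proof (rule ennreal_leI)
        have "\<delta> n \<le> 1" by (simp add: \<delta>_def)
        then show "(\<delta> n)\<^sup>2 \<le> \<delta> n"
          using pos[of n] by (simp add: power2_eq_square mult_left_le)
      qed
      finally show ?thesis .
    qed
    have "emeasure (distr \<mu> borel (\<lambda>x. x)) C = emeasure (distr (distr \<pi> \<mu> fst) borel (\<lambda>x. x)) C"
      by (simp add: coupling_marginals(4)[OF \<pi>(1)])
    also have "\<dots> = emeasure \<pi> {z\<in>space \<pi>. fst z \<in> C}"
      by (subst distr_distr, simp, simp, subst emeasure_distr)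
         (auto simp: comp_def intro!: arg_cong2[where f=emeasure])
    also have "\<dots> \<le> emeasure \<pi> ({z\<in>space \<pi>. snd z \<in> U n} \<union> {z\<in>space \<pi>. \<delta> n \<le> norm (fst z - snd z)})"
    proof (rule emeasure_mono)
      show "{z\<in>space \<pi>. fst z \<in> C} \<subseteq> {z\<in>space \<pi>. snd z \<in> U n} \<union> {z\<in>space \<pi>. \<delta> n \<le> norm (fst z - snd z)}"
      proof (clarsimp simp: U_def)
        fix x y assume "x \<in> C" "\<not> \<delta> n \<le> norm (x - y)"
        then show "infdist y C < \<delta> n"
          using infdist_le[of x C y] by (simp add: dist_norm norm_minus_commute)
      qed
    qed measurable
    also have "\<dots> \<le> emeasure \<pi> {z\<in>space \<pi>. snd z \<in> U n} + emeasure \<pi> {z\<in>space \<pi>. \<delta> n \<le> norm (fst z - snd z)}"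
      by (rule emeasure_subadditive) measurable
    also have "\<dots> \<le> emeasure \<pi> {z\<in>space \<pi>. snd z \<in> U n} + ennreal (\<delta> n)"
      by (intro add_left_mono far)
    also have "emeasure \<pi> {z\<in>space \<pi>. snd z \<in> U n} = emeasure (distr (distr \<pi> \<nu> snd) borel (\<lambda>x. x)) (U n)"
      by (subst distr_distr, simp, simp, subst emeasure_distr)
         (auto simp: comp_def intro!: arg_cong2[where f=emeasure])
    finally show ?thesis by (simp add: coupling_marginals(5)[OF \<pi>(1)] \<nu>'_def)
  qed
  have "(\<lambda>n. emeasure \<nu>' (U n)) \<longlonglongrightarrow> emeasure \<nu>' (\<Inter>n. U n)"
  proof (rule Lim_emeasure_decseq)
    have "\<delta> n \<le> \<delta> m" if "m \<le> n" for m n using that by (auto simp: \<delta>_def intro!: divide_left_mono)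
    then show "decseq U" by (fastforce simp: decseq_def U_def)
    show "range U \<subseteq> sets \<nu>'" by (auto simp: \<nu>'_def)
    show "emeasure \<nu>' (U n) \<noteq> \<infinity>" for n by simp
  qed
  also have "(\<Inter>n. U n) = C"
  proof
    show "C \<subseteq> (\<Inter>n. U n)" using pos by (auto simp: U_def)
    show "(\<Inter>n. U n) \<subseteq> C"
    proof
      fix y assume y: "y \<in> (\<Inter>n. U n)"
      have "(\<lambda>n. \<delta> n) \<longlonglongrightarrow> 0" unfolding \<delta>_def by (rule LIMSEQ_Suc[OF lim_1_over_n])
      moreover have "infdist y C \<le> \<delta> n" for n using y by (auto simp: U_def intro: less_imp_le)
      ultimately have "infdist y C \<le> 0" by (intro LIMSEQ_le_const) auto
      then show "y \<in> C"
        using in_closed_iff_infdist_zero[OF C False] infdist_nonneg[of y C] by auto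
    qed
  qed
  finally have "(\<lambda>n. emeasure \<nu>' (U n) + ennreal (\<delta> n)) \<longlonglongrightarrow> emeasure \<nu>' C + ennreal 0"
    unfolding \<delta>_def
    by (intro tendsto_add tendsto_ennrealI LIMSEQ_Suc[OF lim_1_over_n])
  then have "emeasure (distr \<mu> borel (\<lambda>x. x)) C \<le> emeasure \<nu>' C + ennreal 0"
    using bound by (intro LIMSEQ_le_const) auto
  then show ?thesis by (simp add: \<nu>'_def)
qed simp

lemma W2_zero_imp_eq:
  fixes \<mu> \<nu> :: "'a::euclidean_space measure"
  assumes "\<mu> \<in> P2 E" "\<nu> \<in> P2 E" and zero: "W2 \<mu> \<nu> = 0"
  shows "\<mu> = \<nu>"
proof -
  have id [measurable]: "(\<lambda>x. x) \<in> measurable \<mu> borel" "(\<lambda>x. x) \<in> measurable \<nu> borel"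
    using measurable_P2[OF assms(1) measurable_ident] measurable_P2[OF assms(2) measurable_ident]
    by (auto simp: id_def)
  interpret \<mu>: prob_space \<mu> using assms(1) by (rule P2_prob)
  interpret \<nu>: prob_space \<nu> using assms(2) by (rule P2_prob)
  interpret \<mu>': prob_space "distr \<mu> borel (\<lambda>x. x)" by (rule \<mu>.prob_space_distr) simp
  have zero': "W2 \<nu> \<mu> = 0" using zero by (simp add: W2_commute)
  have eq: "distr \<mu> borel (\<lambda>x. x) = distr \<nu> borel (\<lambda>x. x)"
  proof (rule measure_eqI_generator_eq[where E="Collect closed" and \<Omega>=UNIV and A="\<lambda>_. UNIV"])
    show "Int_stable (Collect (closed :: 'a set \<Rightarrow> bool))" by (auto simp: Int_stable_def)
    show "sets (distr \<mu> borel (\<lambda>x. x)) = sigma_sets UNIV (Collect closed)"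
      "sets (distr \<nu> borel (\<lambda>x. x)) = sigma_sets UNIV (Collect closed)"
      by (simp_all add: borel_eq_closed)
    show "emeasure (distr \<mu> borel (\<lambda>x. x)) X = emeasure (distr \<nu> borel (\<lambda>x. x)) X"
      if "X \<in> Collect closed" for X
      using that W2_zero_closed_le[OF assms(1,2) zero, of X] W2_zero_closed_le[OF assms(2,1) zero', of X]
      by (intro antisym) auto
  qed auto
  have sets: "sets \<mu> = sets (restrict_space borel E)" "sets \<nu> = sets (restrict_space borel E)"
    using assms by (auto simp: P2_def)
  have sp: "space \<mu> = E" "space \<nu> = E"
    using sets_eq_imp_space_eq[OF sets(1)] sets_eq_imp_space_eq[OF sets(2)] by (auto simp: space_restrict_space)
  show ?thesis
  proof (rule measure_eqI)
    show "sets \<mu> = sets \<nu>" using sets by simp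
    fix A assume "A \<in> sets \<mu>"
    then obtain B where B: "B \<in> sets borel" "A = E \<inter> B" by (auto simp: sets sets_restrict_space)
    have "emeasure (distr \<mu> borel (\<lambda>x. x)) B = emeasure (distr \<nu> borel (\<lambda>x. x)) B"
      by (simp add: eq)
    then show "emeasure \<mu> A = emeasure \<nu> A"
      using B by (simp add: emeasure_distr sp Int_commute)
  qed
qed


lemma Metric_space_W2: "Metric_space (P2 E) W2"
proof
  show "W2 \<mu> \<nu> = 0 \<longleftrightarrow> \<mu> = \<nu>" if "\<mu> \<in> P2 E" "\<nu> \<in> P2 E" for \<mu> \<nu>
    using W2_zero_imp_eq[OF that] W2_self[OF that(1)] by blast
qed (simp, rule W2_commute, rule W2_triangle)

section \<open>Absolutely continuous curves\<close>

lemma integrable_indicator_Icc: "integrable lborel (indicator {a..b} :: real \<Rightarrow> real)"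
  by (rule integrable_real_indicator) (auto simp: emeasure_lborel_Icc_eq)

text \<open>
  The bound \<open>m\<close> of the definition is replaced by \<open>\<bar>m\<bar>\<close>, cut off outside the interval. This
  makes it nonnegative, and integrable together with its square on the whole line.
\<close>

lemma AC2_elim:
  assumes "AC 2 E {a..b} \<gamma>"
  obtains m where "m \<in> borel_measurable borel" "\<And>t. 0 \<le> m t" "integrable lborel m"
    "integrable lborel (\<lambda>t. (m t)\<^sup>2)"
    "\<And>s t. a \<le> s \<Longrightarrow> s \<le> t \<Longrightarrow> t \<le> b \<Longrightarrow> W2 (\<gamma> s) (\<gamma> t) \<le> (LBINT u:{s..t}. m u)"
proof -
  obtain m0 where m0: "set_borel_measurable lborel {a..b} m0"
    "set_integrable lborel {a..b} (\<lambda>t. \<bar>m0 t\<bar> ^ 2)"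
    "\<And>s t. s \<in> {a..b} \<Longrightarrow> t \<in> {a..b} \<Longrightarrow> s \<le> t \<Longrightarrow> W2 (\<gamma> s) (\<gamma> t) \<le> (LBINT u:{s..t}. m0 u)"
    using assms unfolding AC_def by blast
  define m where "m = (\<lambda>t. \<bar>indicator {a..b} t *\<^sub>R m0 t\<bar>)"
  have m [measurable]: "m \<in> borel_measurable borel"
    using m0(1) unfolding m_def set_borel_measurable_def by simp
  have nonneg: "0 \<le> m t" for t by (simp add: m_def)
  have "(\<lambda>t. (m t)\<^sup>2) = (\<lambda>t. indicator {a..b} t *\<^sub>R \<bar>m0 t\<bar> ^ 2)"
    by (auto simp: m_def split: split_indicator)
  then have sq: "integrable lborel (\<lambda>t. (m t)\<^sup>2)"
    using m0(2) unfolding set_integrable_def by simp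
  have int: "integrable lborel m"
  proof (rule Bochner_Integration.integrable_bound)
    show "integrable lborel (\<lambda>t. indicator {a..b} t + (m t)\<^sup>2)"
      by (intro Bochner_Integration.integrable_add sq integrable_indicator_Icc)
    have "m t \<le> indicator {a..b} t + (m t)\<^sup>2" for t
    proof -
      have "x \<le> 1 + x\<^sup>2" for x :: real
      proof (cases "x \<le> 1")
        case True
        then show ?thesis using zero_le_power2[of x] by linarith
      next
        case False
        then show ?thesis using self_le_power[of x 2] by simp
      qed
      from this[of "\<bar>m0 t\<bar>"] show ?thesis by (auto simp: m_def split: split_indicator)
    qed
    then show "AE t in lborel. norm (m t) \<le> norm (indicator {a..b} t + (m t)\<^sup>2)"
      using nonneg by (auto intro!: AE_I2 simp: abs_of_nonneg)
  qed simp
  have "W2 (\<gamma> s) (\<gamma> t) \<le> (LBINT u:{s..t}. m u)" if "a \<le> s" "s \<le> t" "t \<le> b" for s t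
  proof -
    have eq: "indicator {s..t} u *\<^sub>R m0 u = indicator {s..t} u *\<^sub>R (indicator {a..b} u *\<^sub>R m0 u)" for u
      using that by (auto split: split_indicator)
    have "W2 (\<gamma> s) (\<gamma> t) \<le> (LBINT u:{s..t}. m0 u)" using that by (intro m0(3)) auto
    also have "\<dots> \<le> (LBINT u:{s..t}. m u)"
      unfolding set_lebesgue_integral_def
    proof (rule integral_mono)
      show i: "integrable lborel (\<lambda>u. indicator {s..t} u *\<^sub>R m u)"
        using integrable_mult_indicator[OF _ int, of "{s..t}"] by simp
      show "integrable lborel (\<lambda>u. indicator {s..t} u *\<^sub>R m0 u)"
        unfolding eq
        by (rule Bochner_Integration.integrable_bound[OF i])
           (use m0(1) in \<open>auto simp: set_borel_measurable_def m_def abs_mult intro!: AE_I2\<close>)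
      show "indicator {s..t} u *\<^sub>R m0 u \<le> indicator {s..t} u *\<^sub>R m u" for u
        using that by (auto simp: m_def split: split_indicator)
    qed
    finally show ?thesis .
  qed
  then show ?thesis using that[of m] m nonneg int sq by blast
qed

lemma AC_intro:
  assumes "\<And>t. a \<le> t \<Longrightarrow> t \<le> b \<Longrightarrow> \<gamma> t \<in> P2 E"
    and "m \<in> borel_measurable borel" "set_integrable lborel {a..b} (\<lambda>t. \<bar>m t\<bar> ^ p)"
    and "\<And>s t. a \<le> s \<Longrightarrow> s \<le> t \<Longrightarrow> t \<le> b \<Longrightarrow> W2 (\<gamma> s) (\<gamma> t) \<le> (LBINT u:{s..t}. m u)"
  shows "AC p E {a..b} \<gamma>"
  unfolding AC_def
proof (intro conjI exI ballI impI)
  show "set_borel_measurable lborel {a..b} m"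
    using assms(2) by (simp add: set_borel_measurable_def)
qed (use assms in auto)

lemma AC_P2: "AC p E I \<gamma> \<Longrightarrow> t \<in> I \<Longrightarrow> \<gamma> t \<in> P2 E"
  by (simp add: AC_def)

lemma AC2_imp_AC1:
  assumes "AC 2 E {a..b} \<gamma>"
  shows "AC 1 E {a..b} \<gamma>"
proof -
  obtain m where m: "m \<in> borel_measurable borel" "\<And>t. 0 \<le> m t" "integrable lborel m"
    "\<And>s t. a \<le> s \<Longrightarrow> s \<le> t \<Longrightarrow> t \<le> b \<Longrightarrow> W2 (\<gamma> s) (\<gamma> t) \<le> (LBINT u:{s..t}. m u)"
    using AC2_elim[OF assms] by metis
  show ?thesis
  proof (rule AC_intro[OF _ m(1) _ m(4)])
    show "set_integrable lborel {a..b} (\<lambda>t. \<bar>m t\<bar> ^ 1)"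
      using integrable_mult_indicator[OF _ m(3), of "{a..b}"] m(2) by (simp add: set_integrable_def)
  qed (use AC_P2[OF assms] in auto)
qed

lemma AC_cong:
  assumes "\<And>t. t \<in> I \<Longrightarrow> \<gamma> t = \<eta> t"
  shows "AC p E I \<gamma> \<longleftrightarrow> AC p E I \<eta>"
proof -
  have "(\<forall>s\<in>I. \<forall>t\<in>I. s \<le> t \<longrightarrow> W2 (\<gamma> s) (\<gamma> t) \<le> (LBINT u:{s..t}. m u))
    \<longleftrightarrow> (\<forall>s\<in>I. \<forall>t\<in>I. s \<le> t \<longrightarrow> W2 (\<eta> s) (\<eta> t) \<le> (LBINT u:{s..t}. m u))" for m
    using assms by simp
  then show ?thesis using assms unfolding AC_def by simp
qed

text \<open>
  The integral of \<open>(m - c)\<^sup>2\<close> is nonnegative; \<open>c\<close> is chosen as the mean of \<open>m\<close>.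
\<close>

lemma cauchy_schwarz_interval:
  fixes m :: "real \<Rightarrow> real"
  assumes "integrable lborel m" "integrable lborel (\<lambda>t. (m t)\<^sup>2)" "s \<le> t"
  shows "(LBINT u:{s..t}. m u)\<^sup>2 \<le> (t - s) * (LBINT u:{s..t}. (m u)\<^sup>2)"
proof (cases "s = t")
  case True
  have "(LBINT u:{s..t}. m u) = 0"
    unfolding set_lebesgue_integral_def
    using True by (intro integral_eq_zero_AE) (auto intro!: AE_I'[of "{t}"])
  then show ?thesis using True by simp
next
  case False
  define h A M where "h = t - s" and "A = (LBINT u:{s..t}. m u)" and "M = (LBINT u:{s..t}. (m u)\<^sup>2)"
  have h: "h > 0" using False assms(3) by (simp add: h_def)
  define c where "c = A / h"
  have i: "set_integrable lborel {s..t} m" "set_integrable lborel {s..t} (\<lambda>u. (m u)\<^sup>2)"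
    using integrable_mult_indicator[OF _ assms(1), of "{s..t}"]
      integrable_mult_indicator[OF _ assms(2), of "{s..t}"] by (auto simp: set_integrable_def)
  have c: "set_integrable lborel {s..t} (\<lambda>u. c\<^sup>2)"
    by (simp add: set_integrable_def integrable_indicator_Icc)
  have mc: "set_integrable lborel {s..t} (\<lambda>u. 2 * c * m u)" using i(1) by simp
  have "0 \<le> (LBINT u:{s..t}. (m u - c)\<^sup>2)"
    unfolding set_lebesgue_integral_def by (intro integral_nonneg_AE) auto
  also have "(LBINT u:{s..t}. (m u - c)\<^sup>2) = (LBINT u:{s..t}. ((m u)\<^sup>2 - 2 * c * m u) + c\<^sup>2)"
    by (simp add: power2_diff algebra_simps)
  also have "\<dots> = (LBINT u:{s..t}. (m u)\<^sup>2 - 2 * c * m u) + (LBINT u:{s..t}. c\<^sup>2)"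
    by (rule set_integral_add(2)[OF set_integral_diff(1)[OF i(2) mc] c])
  also have "(LBINT u:{s..t}. (m u)\<^sup>2 - 2 * c * m u) = M - 2 * c * A"
    using set_integral_diff(2)[OF i(2) mc] by (simp add: M_def A_def)
  also have "(LBINT u:{s..t}. c\<^sup>2) = h * c\<^sup>2"
    using assms(3) by (simp add: set_lebesgue_integral_def h_def)
  finally have "0 \<le> h * (M - 2 * c * A + h * c\<^sup>2)" using h by simp
  also have "\<dots> = h * M - A\<^sup>2" using h by (simp add: c_def power2_eq_square field_simps)
  finally show ?thesis by (simp add: h_def M_def A_def)
qed

text \<open>
  In this form the modulus of continuity and the difference quotients of the curve are both
  controlled by the one density \<open>f = m\<^sup>2\<close>.
\<close>

lemma AC2_energy_density:
  assumes "AC 2 E {a..b} \<gamma>"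
  obtains f where "f \<in> borel_measurable borel" "\<And>t. 0 \<le> f t" "integrable lborel f"
    "\<And>s t. a \<le> s \<Longrightarrow> s \<le> t \<Longrightarrow> t \<le> b \<Longrightarrow> (W2 (\<gamma> s) (\<gamma> t))\<^sup>2 \<le> (t - s) * (LBINT u:{s..t}. f u)"
proof -
  obtain m where m: "m \<in> borel_measurable borel" "\<And>t. 0 \<le> m t" "integrable lborel m"
    "integrable lborel (\<lambda>t. (m t)\<^sup>2)"
    "\<And>s t. a \<le> s \<Longrightarrow> s \<le> t \<Longrightarrow> t \<le> b \<Longrightarrow> W2 (\<gamma> s) (\<gamma> t) \<le> (LBINT u:{s..t}. m u)"
    using AC2_elim[OF assms] by metis
  show ?thesis
  proof (rule that[of "\<lambda>t. (m t)\<^sup>2"])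
    fix s t assume st: "a \<le> s" "s \<le> t" "t \<le> b"
    have "(W2 (\<gamma> s) (\<gamma> t))\<^sup>2 \<le> (LBINT u:{s..t}. m u)\<^sup>2"
      by (intro power_mono m(5) st) simp
    also have "\<dots> \<le> (t - s) * (LBINT u:{s..t}. (m u)\<^sup>2)"
      by (rule cauchy_schwarz_interval[OF m(3,4) st(2)])
    finally show "(W2 (\<gamma> s) (\<gamma> t))\<^sup>2 \<le> (t - s) * (LBINT u:{s..t}. (m u)\<^sup>2)" .
  qed (use m in auto)
qed

section \<open>The metric derivative\<close>

text \<open>
  The two-sided metric derivative. It depends only on the germ of the curve and agrees with the one
  relative to an interval at all interior points, hence almost everywhere.
\<close>

abbreviation speed :: "(real \<Rightarrow> 'a::euclidean_space measure) \<Rightarrow> real \<Rightarrow> real" where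
  "speed \<equiv> metric_derivative UNIV"

lemma metric_derivative_interior:
  "a < t \<Longrightarrow> t < b \<Longrightarrow> metric_derivative {a..b} \<gamma> t = speed \<gamma> t"
  unfolding metric_derivative_def by (simp only: at_within_Icc_at)

lemma speed_eqI:
  assumes "((\<lambda>s. W2 (\<gamma> s) (\<gamma> t) / \<bar>s - t\<bar>) \<longlongrightarrow> L) (at t)"
  shows "speed \<gamma> t = L"
  using assms tendsto_Lim[OF _ assms] by (auto simp: metric_derivative_def Let_def)

lemma speed_eq_0:
  assumes "\<nexists>L. ((\<lambda>s. W2 (\<gamma> s) (\<gamma> t) / \<bar>s - t\<bar>) \<longlongrightarrow> L) (at t)"
  shows "speed \<gamma> t = 0"
  using assms by (simp add: metric_derivative_def Let_def)

lemma speed_nonneg: "0 \<le> speed \<gamma> t"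
proof (cases "\<exists>L. ((\<lambda>s. W2 (\<gamma> s) (\<gamma> t) / \<bar>s - t\<bar>) \<longlongrightarrow> L) (at t)")
  case True
  then obtain L where L: "((\<lambda>s. W2 (\<gamma> s) (\<gamma> t) / \<bar>s - t\<bar>) \<longlongrightarrow> L) (at t)" by blast
  have "0 \<le> L" by (rule tendsto_lowerbound[OF L]) auto
  then show ?thesis using speed_eqI[OF L] by simp
qed (simp add: speed_eq_0)

lemma speed_cong:
  assumes "open U" "t \<in> U" "\<And>s. s \<in> U \<Longrightarrow> \<gamma> s = \<eta> s"
  shows "speed \<gamma> t = speed \<eta> t"
proof -
  have "eventually (\<lambda>s. W2 (\<gamma> s) (\<gamma> t) / \<bar>s - t\<bar> = W2 (\<eta> s) (\<eta> t) / \<bar>s - t\<bar>) (at t)"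
    using assms by (auto simp: eventually_at_topological)
  note * = tendsto_cong[OF this]
  show ?thesis
  proof (cases "\<exists>L. ((\<lambda>s. W2 (\<gamma> s) (\<gamma> t) / \<bar>s - t\<bar>) \<longlongrightarrow> L) (at t)")
    case True
    then obtain L where L: "((\<lambda>s. W2 (\<gamma> s) (\<gamma> t) / \<bar>s - t\<bar>) \<longlongrightarrow> L) (at t)" by blast
    then show ?thesis using speed_eqI[OF L] speed_eqI[of \<eta> t L] * by simp
  next
    case False
    then show ?thesis using speed_eq_0[OF False] speed_eq_0[of \<eta> t] * by simp
  qed
qed

text \<open>
  The difference quotient factors into that of \<open>\<gamma>\<close> at \<open>\<phi> t\<close> and that of \<open>\<phi>\<close> at \<open>t\<close>. The same argument
  for the inverse \<open>\<psi>\<close> shows that one metric derivative exists only if the other one does, so that the formula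
  also holds where both are \<open>0\<close> by convention. A negative derivative \<open>D\<close> occurs for time reversal.
\<close>

lemma speed_compose:
  fixes \<phi> \<psi> :: "real \<Rightarrow> real"
  assumes inv: "\<And>s. \<psi> (\<phi> s) = s" "\<And>u. \<phi> (\<psi> u) = u"
    and \<phi>: "(\<phi> has_real_derivative D) (at t)" and D: "D \<noteq> 0"
    and \<psi>: "(\<psi> has_real_derivative 1 / D) (at (\<phi> t))"
  shows "speed (\<lambda>s. \<gamma> (\<phi> s)) t = \<bar>D\<bar> * speed \<gamma> (\<phi> t)"
proof -
  have aux: "((\<lambda>s. W2 (\<eta> (f s)) (\<eta> (f x)) / \<bar>s - x\<bar>) \<longlongrightarrow> \<bar>C\<bar> * L) (at x)"
    if f: "(f has_real_derivative C) (at x)" "inj f"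
      and L: "((\<lambda>s. W2 (\<eta> s) (\<eta> (f x)) / \<bar>s - f x\<bar>) \<longlongrightarrow> L) (at (f x))"
    for f :: "real \<Rightarrow> real" and \<eta> C x L
  proof -
    have "filterlim f (at (f x)) (at x)"
      using DERIV_isCont[OF f(1)] f(2)
      by (auto simp: filterlim_at isCont_def eventually_at_filter inj_eq)
    from filterlim_compose[OF L this]
    have "((\<lambda>s. W2 (\<eta> (f s)) (\<eta> (f x)) / \<bar>f s - f x\<bar>) \<longlongrightarrow> L) (at x)" .
    moreover have "((\<lambda>s. \<bar>(f s - f x) / (s - x)\<bar>) \<longlongrightarrow> \<bar>C\<bar>) (at x)"
      using f(1) by (intro tendsto_rabs) (simp add: has_field_derivative_iff)
    ultimately have "((\<lambda>s. \<bar>(f s - f x) / (s - x)\<bar> * (W2 (\<eta> (f s)) (\<eta> (f x)) / \<bar>f s - f x\<bar>)) \<longlongrightarrow> \<bar>C\<bar> * L) (at x)"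
      by (intro tendsto_mult)
    then show ?thesis
      by (rule Lim_transform_eventually)
         (use f(2) in \<open>auto simp: eventually_at_filter inj_eq field_simps\<close>)
  qed
  have inj: "inj \<phi>" "inj \<psi>" using inv by (metis injI)+
  show ?thesis
  proof (cases "\<exists>L. ((\<lambda>s. W2 (\<gamma> s) (\<gamma> (\<phi> t)) / \<bar>s - \<phi> t\<bar>) \<longlongrightarrow> L) (at (\<phi> t))")
    case True
    then obtain L where L: "((\<lambda>s. W2 (\<gamma> s) (\<gamma> (\<phi> t)) / \<bar>s - \<phi> t\<bar>) \<longlongrightarrow> L) (at (\<phi> t))" by blast
    show ?thesis using speed_eqI[OF L] speed_eqI[OF aux[OF \<phi> inj(1) L]] by simp
  next
    case False
    have "\<nexists>L. ((\<lambda>s. W2 (\<gamma> (\<phi> s)) (\<gamma> (\<phi> t)) / \<bar>s - t\<bar>) \<longlongrightarrow> L) (at t)"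
    proof
      assume "\<exists>L. ((\<lambda>s. W2 (\<gamma> (\<phi> s)) (\<gamma> (\<phi> t)) / \<bar>s - t\<bar>) \<longlongrightarrow> L) (at t)"
      then obtain L where "((\<lambda>s. W2 (\<gamma> (\<phi> s)) (\<gamma> (\<phi> t)) / \<bar>s - t\<bar>) \<longlongrightarrow> L) (at t)" by blast
      then have "((\<lambda>s. W2 (\<gamma> (\<phi> s)) (\<gamma> (\<phi> (\<psi> (\<phi> t)))) / \<bar>s - \<psi> (\<phi> t)\<bar>) \<longlongrightarrow> L) (at (\<psi> (\<phi> t)))"
        by (simp add: inv)
      from aux[OF \<psi> inj(2), of "\<lambda>s. \<gamma> (\<phi> s)", OF this] False show False
        by (simp add: inv)
    qed
    then show ?thesis using speed_eq_0[OF False] speed_eq_0[of "\<lambda>s. \<gamma> (\<phi> s)" t] by simp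
  qed
qed

lemma continuous_W2_curve:
  fixes \<gamma> :: "real \<Rightarrow> 'a::euclidean_space measure"
  assumes P2: "\<And>t. \<gamma> t \<in> P2 E" and cont: "\<And>t. ((\<lambda>s. W2 (\<gamma> s) (\<gamma> t)) \<longlongrightarrow> 0) (at t)"
    and uv: "isCont u x" "isCont v x"
  shows "isCont (\<lambda>x::real. W2 (\<gamma> (u x)) (\<gamma> (v x))) x"
proof -
  have c: "isCont (\<lambda>s. W2 (\<gamma> s) (\<gamma> t)) t" for t
    using cont[of t] W2_self[OF P2[of t]] by (simp add: isCont_def)
  have lim: "((\<lambda>y. W2 (\<gamma> (w y)) (\<gamma> (w x))) \<longlongrightarrow> 0) (at x)" if "isCont w x" for w
    using isCont_o2[OF that c] W2_self[OF P2] by (simp add: isCont_def)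
  have tri: "\<bar>W2 (\<gamma> a) (\<gamma> b) - W2 (\<gamma> c) (\<gamma> d)\<bar> \<le> W2 (\<gamma> a) (\<gamma> c) + W2 (\<gamma> b) (\<gamma> d)" for a b c d
    using W2_triangle[OF P2[of a] P2[of c] P2[of b]] W2_triangle[OF P2[of c] P2[of d] P2[of b]]
      W2_triangle[OF P2[of c] P2[of a] P2[of d]] W2_triangle[OF P2[of a] P2[of b] P2[of d]]
      W2_commute[of "\<gamma> c" "\<gamma> a"] W2_commute[of "\<gamma> b" "\<gamma> d"]
    by linarith
  have "((\<lambda>y. W2 (\<gamma> (u y)) (\<gamma> (v y)) - W2 (\<gamma> (u x)) (\<gamma> (v x))) \<longlongrightarrow> 0) (at x)"
    by (rule Lim_null_comparison[OF always_eventually tendsto_add_zero[OF lim[OF uv(1)] lim[OF uv(2)]]])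
       (auto intro: tri)
  then show ?thesis unfolding isCont_def using Lim_null by blast
qed


text \<open>
  The Cauchy criterion, with increments restricted to the rational numbers by continuity. The
  countable form makes the set of points at which a limit exists measurable.
\<close>

lemma tendsto_at_iff_rational_Cauchy:
  fixes Q :: "real \<Rightarrow> real"
  assumes cont: "\<And>h. h \<noteq> 0 \<Longrightarrow> isCont Q h"
  shows "(\<exists>L. (Q \<longlongrightarrow> L) (at 0)) \<longleftrightarrow>
    (\<forall>k::nat. \<exists>n::nat. \<forall>x y::rat. x \<noteq> 0 \<and> y \<noteq> 0 \<and> \<bar>real_of_rat x\<bar> < 1 / (real n + 1) \<and> \<bar>real_of_rat y\<bar> < 1 / (real n + 1)
        \<longrightarrow> \<bar>Q (real_of_rat x) - Q (real_of_rat y)\<bar> \<le> 1 / (real k + 1))"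
    (is "?lim \<longleftrightarrow> ?Cauchy")
proof
  assume ?lim
  then obtain L where L: "(Q \<longlongrightarrow> L) (at 0)" by blast
  show ?Cauchy
  proof
    fix k :: nat
    define e where "e = 1 / (2 * (real k + 1))"
    have "e > 0" by (simp add: e_def)
    with L obtain d where d: "d > 0" "\<And>h. h \<noteq> 0 \<Longrightarrow> \<bar>h\<bar> < d \<Longrightarrow> \<bar>Q h - L\<bar> < e"
      unfolding LIM_eq by auto
    obtain n where n: "1 / (real n + 1) < d"
      using reals_Archimedean[OF d(1)] by (auto simp: field_simps)
    have "\<bar>Q (real_of_rat x) - Q (real_of_rat y)\<bar> \<le> 1 / (real k + 1)"
      if "x \<noteq> 0" "y \<noteq> 0" "\<bar>real_of_rat x\<bar> < 1 / (real n + 1)" "\<bar>real_of_rat y\<bar> < 1 / (real n + 1)" for x y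
    proof -
      have "\<bar>Q (real_of_rat x) - L\<bar> < e" "\<bar>Q (real_of_rat y) - L\<bar> < e"
        using that n by (auto intro!: d(2))
      moreover have "2 * e = 1 / (real k + 1)" by (simp add: e_def field_simps)
      ultimately show ?thesis by linarith
    qed
    then show "\<exists>n::nat. \<forall>x y::rat. x \<noteq> 0 \<and> y \<noteq> 0 \<and> \<bar>real_of_rat x\<bar> < 1 / (real n + 1) \<and> \<bar>real_of_rat y\<bar> < 1 / (real n + 1)
        \<longrightarrow> \<bar>Q (real_of_rat x) - Q (real_of_rat y)\<bar> \<le> 1 / (real k + 1)" by blast
  qed
next
  assume C: ?Cauchy
  have approx: "\<exists>x::rat. x \<noteq> 0 \<and> \<bar>real_of_rat x\<bar> < r \<and> \<bar>Q (real_of_rat x) - Q h\<bar> < e"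
    if "h \<noteq> 0" "\<bar>h\<bar> < r" "e > 0" for h r e
  proof -
    obtain d where d: "d > 0" "\<And>x. \<bar>x - h\<bar> < d \<Longrightarrow> \<bar>Q x - Q h\<bar> < e"
      using cont[OF \<open>h \<noteq> 0\<close>] \<open>e > 0\<close> unfolding continuous_at_eps_delta by (auto simp: dist_real_def)
    define c where "c = min d (min \<bar>h\<bar> (r - \<bar>h\<bar>))"
    have "c > 0" using d that by (simp add: c_def)
    then obtain x where x: "h < real_of_rat x" "real_of_rat x < h + c"
      using of_rat_dense[of h "h + c"] by auto
    have "\<bar>real_of_rat x - h\<bar> < d" "\<bar>real_of_rat x\<bar> < r" "real_of_rat x \<noteq> 0"
      using x unfolding c_def by linarith+
    then show ?thesis using d(2) by (intro exI[of _ x] conjI) auto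
  qed
  have real: "\<exists>n::nat. \<forall>g h. g \<noteq> 0 \<and> h \<noteq> 0 \<and> \<bar>g\<bar> < 1 / (real n + 1) \<and> \<bar>h\<bar> < 1 / (real n + 1)
        \<longrightarrow> \<bar>Q g - Q h\<bar> \<le> 1 / (real k + 1)" for k :: nat
  proof -
    obtain n :: nat where n: "\<And>x y::rat. x \<noteq> 0 \<Longrightarrow> y \<noteq> 0 \<Longrightarrow> \<bar>real_of_rat x\<bar> < 1 / (real n + 1) \<Longrightarrow> \<bar>real_of_rat y\<bar> < 1 / (real n + 1)
        \<Longrightarrow> \<bar>Q (real_of_rat x) - Q (real_of_rat y)\<bar> \<le> 1 / (real k + 1)"
      using C by blast
    have "\<bar>Q g - Q h\<bar> \<le> 1 / (real k + 1)"
      if gh: "g \<noteq> 0" "h \<noteq> 0" "\<bar>g\<bar> < 1 / (real n + 1)" "\<bar>h\<bar> < 1 / (real n + 1)" for g h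
    proof (rule field_le_epsilon)
      fix e :: real assume "e > 0"
      then have e: "e / 2 > 0" by simp
      obtain x where x: "x \<noteq> 0" "\<bar>real_of_rat x\<bar> < 1 / (real n + 1)" "\<bar>Q (real_of_rat x) - Q g\<bar> < e / 2"
        using approx[OF gh(1) gh(3) e] by blast
      obtain y where y: "y \<noteq> 0" "\<bar>real_of_rat y\<bar> < 1 / (real n + 1)" "\<bar>Q (real_of_rat y) - Q h\<bar> < e / 2"
        using approx[OF gh(2) gh(4) e] by blast
      show "\<bar>Q g - Q h\<bar> \<le> 1 / (real k + 1) + e"
        using n[OF x(1) y(1) x(2) y(2)] x(3) y(3) by linarith
    qed
    then show ?thesis by blast
  qed
  \<comment> \<open>With \<open>i + 2\<close> in place of \<open>i + 1\<close> the strict bound \<open>1 / (real n + 1)\<close> already holds at \<open>i = n\<close>.\<close>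
  define X where "X = (\<lambda>i::nat. Q (1 / (real i + 2)))"
  have "Cauchy X"
    unfolding Cauchy_altdef2
  proof (intro allI impI)
    fix e :: real assume "e > 0"
    then obtain k where k: "1 / (real k + 1) < e"
      using reals_Archimedean[OF \<open>e > 0\<close>] by (auto simp: inverse_eq_divide add.commute)
    obtain n :: nat where n: "\<And>g h. g \<noteq> 0 \<Longrightarrow> h \<noteq> 0 \<Longrightarrow> \<bar>g\<bar> < 1 / (real n + 1) \<Longrightarrow> \<bar>h\<bar> < 1 / (real n + 1)
        \<Longrightarrow> \<bar>Q g - Q h\<bar> \<le> 1 / (real k + 1)" using real[of k] by blast
    have "\<bar>X i - X n\<bar> < e" if "i \<ge> n" for i
    proof -
      have "\<bar>X i - X n\<bar> \<le> 1 / (real k + 1)"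
        unfolding X_def using that by (intro n) (auto simp: field_simps)
      then show ?thesis using k by linarith
    qed
    then show "\<exists>N. \<forall>n\<ge>N. dist (X n) (X N) < e" by (auto simp: dist_real_def)
  qed
  then obtain L where L: "X \<longlonglongrightarrow> L" using Cauchy_convergent convergentD by blast
  have "(Q \<longlongrightarrow> L) (at 0)"
    unfolding LIM_eq
  proof (intro allI impI)
    fix e :: real assume "e > 0"
    then obtain k where k: "1 / (real k + 1) < e"
      using reals_Archimedean[OF \<open>e > 0\<close>] by (auto simp: inverse_eq_divide add.commute)
    obtain n :: nat where n: "\<And>g h. g \<noteq> 0 \<Longrightarrow> h \<noteq> 0 \<Longrightarrow> \<bar>g\<bar> < 1 / (real n + 1) \<Longrightarrow> \<bar>h\<bar> < 1 / (real n + 1)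
        \<Longrightarrow> \<bar>Q g - Q h\<bar> \<le> 1 / (real k + 1)" using real[of k] by blast
    have "\<bar>Q h - L\<bar> \<le> 1 / (real k + 1)" if h: "h \<noteq> 0" "\<bar>h\<bar> < 1 / (real n + 1)" for h
    proof (rule LIMSEQ_le_const2)
      show "(\<lambda>i. \<bar>Q h - X i\<bar>) \<longlonglongrightarrow> \<bar>Q h - L\<bar>" by (intro tendsto_intros L)
      have "\<bar>Q h - X i\<bar> \<le> 1 / (real k + 1)" if "i \<ge> n" for i
        unfolding X_def using that h by (intro n) (auto simp: field_simps)
      then show "\<exists>N. \<forall>i\<ge>N. \<bar>Q h - X i\<bar> \<le> 1 / (real k + 1)" by blast
    qed
    then show "\<exists>s>0. \<forall>x. x \<noteq> 0 \<and> norm (x - 0) < s \<longrightarrow> norm (Q x - L) < e"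
      using k by (intro exI[of _ "1 / (real n + 1)"]) (auto intro: le_less_trans)
  qed
  then show ?lim by blast
qed

lemma speed_measurable:
  fixes \<gamma> :: "real \<Rightarrow> 'a::euclidean_space measure"
  assumes P2: "\<And>t. \<gamma> t \<in> P2 E" and cont: "\<And>t. ((\<lambda>s. W2 (\<gamma> s) (\<gamma> t)) \<longlongrightarrow> 0) (at t)"
  shows "speed \<gamma> \<in> borel_measurable borel"
proof -
  define Q where "Q = (\<lambda>h t. W2 (\<gamma> (t + h)) (\<gamma> t) / \<bar>h\<bar>)"
  have Qh: "isCont (\<lambda>h. Q h t) h" if "h \<noteq> 0" for h t
    unfolding Q_def using that by (intro continuous_intros continuous_W2_curve[OF P2 cont]) auto
  have [measurable]: "(\<lambda>t. Q h t) \<in> borel_measurable borel" for h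
  proof -
    have "isCont (\<lambda>t. W2 (\<gamma> (t + h)) (\<gamma> t)) t" for t
      by (intro continuous_W2_curve[OF P2 cont] continuous_intros)
    then have [measurable]: "(\<lambda>t. W2 (\<gamma> (t + h)) (\<gamma> t)) \<in> borel_measurable borel"
      by (intro borel_measurable_continuous_onI continuous_at_imp_continuous_on) auto
    show ?thesis unfolding Q_def by measurable
  qed
  have shift: "((\<lambda>s. W2 (\<gamma> s) (\<gamma> t) / \<bar>s - t\<bar>) \<longlongrightarrow> L) (at t) \<longleftrightarrow> ((\<lambda>h. Q h t) \<longlongrightarrow> L) (at 0)" for t L
    by (subst filterlim_at_to_0) (simp add: Q_def add.commute)
  define D where "D = (\<lambda>t. \<forall>k::nat. \<exists>n::nat. \<forall>x y::rat. x \<noteq> 0 \<and> y \<noteq> 0 \<and> \<bar>real_of_rat x\<bar> < 1 / (real n + 1)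
      \<and> \<bar>real_of_rat y\<bar> < 1 / (real n + 1) \<longrightarrow> \<bar>Q (real_of_rat x) t - Q (real_of_rat y) t\<bar> \<le> 1 / (real k + 1))"
  have D: "D t \<longleftrightarrow> (\<exists>L. ((\<lambda>h. Q h t) \<longlongrightarrow> L) (at 0))" for t
    unfolding D_def by (rule tendsto_at_iff_rational_Cauchy[symmetric]) (rule Qh)
  have [measurable]: "Measurable.pred borel D" unfolding D_def by measurable
  have eq: "speed \<gamma> t = (if D t then lim (\<lambda>i. Q (1 / real (Suc i)) t) else 0)" for t
  proof (cases "D t")
    case True
    then obtain L where L: "((\<lambda>h. Q h t) \<longlongrightarrow> L) (at 0)" using D by blast
    have "(\<lambda>i. 1 / real (Suc i)) \<longlonglongrightarrow> 0" by (rule LIMSEQ_Suc[OF lim_1_over_n])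
    then have "filterlim (\<lambda>i. 1 / real (Suc i)) (at 0) sequentially" by (simp add: filterlim_at)
    from filterlim_compose[OF L this] have "lim (\<lambda>i. Q (1 / real (Suc i)) t) = L" by (rule limI)
    then show ?thesis using True speed_eqI[of \<gamma> t L] L by (simp add: shift)
  next
    case False
    then show ?thesis using speed_eq_0[of \<gamma> t] by (simp add: D shift)
  qed
  have "(\<lambda>t. if D t then lim (\<lambda>i. Q (1 / real (Suc i)) t) else 0) \<in> borel_measurable borel"
    by measurable
  then show ?thesis by (simp add: eq[abs_def, symmetric] eta_contract_eq)
qed

text \<open>
  By the hypothesis, the square of the difference quotient with step \<open>h\<close> at \<open>t\<close> is at most the mean
  of \<open>f\<close> over \<open>[t, t + h]\<close>. By the theorem of Tonelli and translation invariance the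
  integral over \<open>t\<close> of these means is the integral of \<open>f\<close>. The lemma of Fatou passes to the limit \<open>h \<rightarrow> 0\<close>; where the
  limit does not exist, the speed is \<open>0\<close> and the estimate is trivial.
\<close>

lemma speed_square_integral:
  fixes \<gamma> :: "real \<Rightarrow> 'a::euclidean_space measure"
  assumes P2: "\<And>t. \<gamma> t \<in> P2 E"
    and f [measurable]: "f \<in> borel_measurable borel" and f_nonneg: "\<And>t. 0 \<le> f t" and f_int: "integrable lborel f"
    and le: "\<And>s t. s \<le> t \<Longrightarrow> (W2 (\<gamma> s) (\<gamma> t))\<^sup>2 \<le> (t - s) * (LBINT u:{s..t}. f u)"
  shows "speed \<gamma> \<in> borel_measurable borel" "(\<integral>\<^sup>+t. ennreal ((speed \<gamma> t)\<^sup>2) \<partial>lborel) \<le> (\<integral>\<^sup>+t. ennreal (f t) \<partial>lborel)"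
proof -
  have le_total: "(LBINT u:{s..t}. f u) \<le> (LBINT u. f u)" for s t
    unfolding set_lebesgue_integral_def
    using integrable_mult_indicator[OF _ f_int, of "{s..t}"] f_nonneg
    by (intro integral_mono f_int) (auto split: split_indicator)
  have hoelder: "W2 (\<gamma> s) (\<gamma> t) \<le> sqrt (\<bar>s - t\<bar> * (LBINT u. f u))" for s t
  proof (rule real_le_rsqrt)
    have *: "(W2 (\<gamma> s) (\<gamma> t))\<^sup>2 \<le> (t - s) * (LBINT u. f u)" if "s \<le> t" for s t
      using le[OF that] mult_left_mono[OF le_total[of s t], of "t - s"] that by linarith
    show "(W2 (\<gamma> s) (\<gamma> t))\<^sup>2 \<le> \<bar>s - t\<bar> * (LBINT u. f u)"
    proof (cases "s \<le> t")
      case True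
      then have "\<bar>s - t\<bar> = t - s" by simp
      then show ?thesis using *[OF True] by (simp only:)
    next
      case False
      then show ?thesis using *[of t s] W2_commute[of "\<gamma> s" "\<gamma> t"] by simp
    qed
  qed
  have cont: "((\<lambda>s. W2 (\<gamma> s) (\<gamma> t)) \<longlongrightarrow> 0) (at t)" for t
  proof (rule Lim_null_comparison[OF always_eventually])
    show "\<forall>s. norm (W2 (\<gamma> s) (\<gamma> t)) \<le> sqrt (\<bar>s - t\<bar> * (LBINT u. f u))" using hoelder by simp
    have "((\<lambda>s. sqrt (\<bar>s - t\<bar> * (LBINT u. f u))) \<longlongrightarrow> sqrt (\<bar>t - t\<bar> * (LBINT u. f u))) (at t)"
      by (intro tendsto_intros)
    then show "((\<lambda>s. sqrt (\<bar>s - t\<bar> * (LBINT u. f u))) \<longlongrightarrow> 0) (at t)" by simp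
  qed
  show "speed \<gamma> \<in> borel_measurable borel" by (rule speed_measurable[OF P2 cont])
  define h where "h = (\<lambda>i. 1 / real (Suc i))"
  have h: "h i > 0" for i by (simp add: h_def)
  define q where "q = (\<lambda>i t. W2 (\<gamma> (t + h i)) (\<gamma> t) / h i)"
  have [measurable]: "q i \<in> borel_measurable borel" for i
  proof -
    have "isCont (\<lambda>t. W2 (\<gamma> (t + h i)) (\<gamma> t)) t" for t
      by (intro continuous_W2_curve[OF P2 cont] continuous_intros)
    then have [measurable]: "(\<lambda>t. W2 (\<gamma> (t + h i)) (\<gamma> t)) \<in> borel_measurable borel"
      by (intro borel_measurable_continuous_onI continuous_at_imp_continuous_on) auto
    show ?thesis unfolding q_def by measurable
  qed
  have bound: "(\<integral>\<^sup>+t. ennreal ((q i t)\<^sup>2) \<partial>lborel) \<le> (\<integral>\<^sup>+t. ennreal (f t) \<partial>lborel)" for i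
  proof -
    have "(\<integral>\<^sup>+t. ennreal ((q i t)\<^sup>2) \<partial>lborel)
        \<le> (\<integral>\<^sup>+t. \<integral>\<^sup>+u. ennreal (f (t + u)) * (ennreal (1 / h i) * indicator {0..h i} u) \<partial>lborel \<partial>lborel)"
    proof (rule nn_integral_mono)
      fix t
      have "(q i t)\<^sup>2 = (W2 (\<gamma> t) (\<gamma> (t + h i)))\<^sup>2 / (h i)\<^sup>2"
        by (simp add: q_def power_divide W2_commute)
      also have "\<dots> \<le> h i * (LBINT u:{t..t + h i}. f u) / (h i)\<^sup>2"
        using le[of t "t + h i"] h[of i] by (intro divide_right_mono) auto
      also have "\<dots> = 1 / h i * (LBINT u:{t..t + h i}. f u)"
        using h[of i] by (simp add: power2_eq_square)
      finally have "ennreal ((q i t)\<^sup>2) \<le> ennreal (1 / h i * (LBINT u:{t..t + h i}. f u))"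
        by (rule ennreal_leI)
      also have "\<dots> = ennreal (1 / h i) * ennreal (LBINT u:{t..t + h i}. f u)"
        using h[of i] by (subst ennreal_mult') auto
      also have "ennreal (LBINT u:{t..t + h i}. f u) = (\<integral>\<^sup>+u. ennreal (indicator {t..t + h i} u * f u) \<partial>lborel)"
        unfolding set_lebesgue_integral_def
        using integrable_mult_indicator[OF _ f_int, of "{t..t + h i}"] f_nonneg
        by (subst nn_integral_eq_integral) auto
      also have "\<dots> = (\<integral>\<^sup>+u. ennreal (indicator {t..t + h i} (t + 1 * u) * f (t + 1 * u)) \<partial>lborel)"
        by (subst nn_integral_real_affine[where c=1 and t=t]) auto
      also have "\<dots> = (\<integral>\<^sup>+u. ennreal (f (t + u)) * indicator {0..h i} u \<partial>lborel)"
        by (intro nn_integral_cong) (auto split: split_indicator)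
      also have "ennreal (1 / h i) * \<dots> = (\<integral>\<^sup>+u. ennreal (f (t + u)) * (ennreal (1 / h i) * indicator {0..h i} u) \<partial>lborel)"
        by (subst nn_integral_cmult[symmetric]) (auto simp: ac_simps)
      finally show "ennreal ((q i t)\<^sup>2) \<le> (\<integral>\<^sup>+u. ennreal (f (t + u)) * (ennreal (1 / h i) * indicator {0..h i} u) \<partial>lborel)" .
    qed
    also have "\<dots> = (\<integral>\<^sup>+u. \<integral>\<^sup>+t. ennreal (f (t + u)) * (ennreal (1 / h i) * indicator {0..h i} u) \<partial>lborel \<partial>lborel)"
      by (rule lborel_pair.Fubini') measurable
    also have "\<dots> = (\<integral>\<^sup>+u. (\<integral>\<^sup>+t. ennreal (f t) \<partial>lborel) * (ennreal (1 / h i) * indicator {0..h i} u) \<partial>lborel)"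
    proof (rule nn_integral_cong)
      fix u :: real
      have "(\<integral>\<^sup>+t. ennreal (f (t + u)) \<partial>lborel) = (\<integral>\<^sup>+t. ennreal (f t) \<partial>lborel)"
        using nn_integral_real_affine[of "\<lambda>t. ennreal (f t)" 1 u] by (simp add: add.commute)
      then show "(\<integral>\<^sup>+t. ennreal (f (t + u)) * (ennreal (1 / h i) * indicator {0..h i} u) \<partial>lborel)
          = (\<integral>\<^sup>+t. ennreal (f t) \<partial>lborel) * (ennreal (1 / h i) * indicator {0..h i} u)"
        by (subst nn_integral_multc) auto
    qed
    also have "\<dots> = (\<integral>\<^sup>+t. ennreal (f t) \<partial>lborel) * (ennreal (1 / h i) * ennreal (h i))"
      using h[of i] by (subst nn_integral_cmult, simp, subst nn_integral_cmult_indicator) auto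
    also have "ennreal (1 / h i) * ennreal (h i) = 1"
      using h[of i] by (subst ennreal_mult[symmetric]) auto
    finally show ?thesis by simp
  qed
  have "(\<integral>\<^sup>+t. ennreal ((speed \<gamma> t)\<^sup>2) \<partial>lborel) \<le> (\<integral>\<^sup>+t. liminf (\<lambda>i. ennreal ((q i t)\<^sup>2)) \<partial>lborel)"
  proof (rule nn_integral_mono)
    fix t
    show "ennreal ((speed \<gamma> t)\<^sup>2) \<le> liminf (\<lambda>i. ennreal ((q i t)\<^sup>2))"
    proof (cases "\<exists>L. ((\<lambda>s. W2 (\<gamma> s) (\<gamma> t) / \<bar>s - t\<bar>) \<longlongrightarrow> L) (at t)")
      case True
      then obtain L where L: "((\<lambda>s. W2 (\<gamma> s) (\<gamma> t) / \<bar>s - t\<bar>) \<longlongrightarrow> L) (at t)" by blast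
      have "(\<lambda>i. t + h i) \<longlonglongrightarrow> t + 0"
        unfolding h_def by (intro tendsto_intros LIMSEQ_Suc[OF lim_1_over_n])
      then have "filterlim (\<lambda>i. t + h i) (at t) sequentially"
        using h by (auto simp: filterlim_at less_imp_neq[THEN not_sym])
      from filterlim_compose[OF L this] have "(\<lambda>i. q i t) \<longlonglongrightarrow> L"
        using h by (simp add: q_def abs_of_pos)
      then have "(\<lambda>i. ennreal ((q i t)\<^sup>2)) \<longlonglongrightarrow> ennreal (L\<^sup>2)" by (intro tendsto_ennrealI tendsto_power)
      then have "liminf (\<lambda>i. ennreal ((q i t)\<^sup>2)) = ennreal (L\<^sup>2)"
        by (intro lim_imp_Liminf) auto
      then show ?thesis using speed_eqI[OF L] by simp
    qed (simp add: speed_eq_0)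
  qed
  also have "\<dots> \<le> liminf (\<lambda>i. \<integral>\<^sup>+t. ennreal ((q i t)\<^sup>2) \<partial>lborel)"
    by (rule nn_integral_liminf) measurable
  also have "\<dots> \<le> (\<integral>\<^sup>+t. ennreal (f t) \<partial>lborel)"
    using Liminf_mono[of "\<lambda>i. \<integral>\<^sup>+t. ennreal ((q i t)\<^sup>2) \<partial>lborel" "\<lambda>_. \<integral>\<^sup>+t. ennreal (f t) \<partial>lborel" sequentially] bound
    by (simp add: Liminf_const)
  finally show "(\<integral>\<^sup>+t. ennreal ((speed \<gamma> t)\<^sup>2) \<partial>lborel) \<le> (\<integral>\<^sup>+t. ennreal (f t) \<partial>lborel)" .
qed

lemma AE_interior: "AE t in lborel. t \<in> {a..b} \<longrightarrow> a < t \<and> t < (b::real)"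
  using AE_lborel_singleton[of a] AE_lborel_singleton[of b] by eventually_elim auto

lemma nn_integral_interior_cong:
  fixes a b :: real
  assumes "\<And>t. a < t \<Longrightarrow> t < b \<Longrightarrow> f t = h t"
  shows "(\<integral>\<^sup>+t\<in>{a..b}. f t \<partial>lborel) = (\<integral>\<^sup>+t\<in>{a..b}. h t \<partial>lborel)"
  using AE_interior[of a b] assms
  by (intro nn_integral_cong_AE) (auto elim!: eventually_mono split: split_indicator)

text \<open>
  The curve is extended to the whole line by its end points, so that the estimates on the line apply.
\<close>

lemma AC2_speed_L2:
  assumes AC: "AC 2 E {a..b} \<gamma>" and ab: "a < b"
  obtains p where "p \<in> borel_measurable borel" "\<And>t. 0 \<le> p t" "integrable lborel (\<lambda>t. (p t)\<^sup>2)"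
    "\<And>t. a < t \<Longrightarrow> t < b \<Longrightarrow> speed \<gamma> t = p t"
proof -
  obtain f where f: "f \<in> borel_measurable borel" "\<And>t. 0 \<le> f t" "integrable lborel f"
    and le: "\<And>s t. a \<le> s \<Longrightarrow> s \<le> t \<Longrightarrow> t \<le> b \<Longrightarrow> (W2 (\<gamma> s) (\<gamma> t))\<^sup>2 \<le> (t - s) * (LBINT u:{s..t}. f u)"
    using AC2_energy_density[OF AC] by metis
  \<comment> \<open>The nearest point of \<open>[a, b]\<close>; this map does not increase distances.\<close>
  define c where "c = (\<lambda>t. max a (min b t))"
  define \<eta> where "\<eta> = (\<lambda>t. \<gamma> (c t))"
  have P2: "\<eta> t \<in> P2 E" for t
    using ab by (auto simp: \<eta>_def c_def intro!: AC_P2[OF AC])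
  have le': "(W2 (\<eta> s) (\<eta> t))\<^sup>2 \<le> (t - s) * (LBINT u:{s..t}. f u)" if st: "s \<le> t" for s t
  proof (cases "c s < c t")
    case True
    then have cc: "s \<le> c s" "c s \<le> c t" "c t \<le> t" "a \<le> c s" "c t \<le> b"
      using ab st by (auto simp: c_def)
    have "(W2 (\<eta> s) (\<eta> t))\<^sup>2 \<le> (c t - c s) * (LBINT u:{c s..c t}. f u)"
      unfolding \<eta>_def using cc by (intro le) auto
    also have "\<dots> \<le> (t - s) * (LBINT u:{s..t}. f u)"
    proof (rule mult_mono)
      show "(LBINT u:{c s..c t}. f u) \<le> (LBINT u:{s..t}. f u)"
        unfolding set_lebesgue_integral_def
        using integrable_mult_indicator[OF _ f(3), of "{c s..c t}"] integrable_mult_indicator[OF _ f(3), of "{s..t}"] cc f(2)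
        by (intro integral_mono) (auto split: split_indicator)
      show "0 \<le> (LBINT u:{c s..c t}. f u)"
        unfolding set_lebesgue_integral_def using f(2) by (intro integral_nonneg_AE) auto
    qed (use cc in auto)
    finally show ?thesis .
  next
    case False
    then have "c s = c t" using st by (auto simp: c_def)
    then have "W2 (\<eta> s) (\<eta> t) = 0" using W2_self[OF P2] by (simp add: \<eta>_def)
    moreover have "0 \<le> (LBINT u:{s..t}. f u)"
      unfolding set_lebesgue_integral_def using f(2) by (intro integral_nonneg_AE) auto
    ultimately show ?thesis using st by simp
  qed
  note * = speed_square_integral[OF P2 f le']
  show ?thesis
  proof (rule that[of "speed \<eta>"])
    show "integrable lborel (\<lambda>t. (speed \<eta> t)\<^sup>2)"
    proof (rule integrableI_nonneg)
      have "(\<integral>\<^sup>+t. ennreal (f t) \<partial>lborel) < \<infinity>"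
        using f(2,3) by (simp add: nn_integral_eq_integral)
      then show "(\<integral>\<^sup>+t. ennreal ((speed \<eta> t)\<^sup>2) \<partial>lborel) < \<infinity>"
        using *(2) by (rule le_less_trans[rotated])
    qed (use *(1) in auto)
    show "speed \<gamma> t = speed \<eta> t" if "a < t" "t < b" for t
      by (rule speed_cong[of "{a<..<b}"]) (use that in \<open>auto simp: \<eta>_def c_def\<close>)
  qed (use * speed_nonneg in auto)
qed

section \<open>Reversal, concatenation and time changes\<close>

lemma AC2_reverse:
  assumes "AC 2 E {0..1} \<gamma>"
  shows "AC 2 E {0..1} (\<lambda>t. \<gamma> (1 - t))"
proof -
  obtain m where m: "m \<in> borel_measurable borel" "\<And>t. 0 \<le> m t" "integrable lborel m"
    "integrable lborel (\<lambda>t. (m t)\<^sup>2)"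
    "\<And>s t. 0 \<le> s \<Longrightarrow> s \<le> t \<Longrightarrow> t \<le> 1 \<Longrightarrow> W2 (\<gamma> s) (\<gamma> t) \<le> (LBINT u:{s..t}. m u)"
    using AC2_elim[OF assms] by metis
  show ?thesis
  proof (rule AC_intro)
    show "\<gamma> (1 - t) \<in> P2 E" if "0 \<le> t" "t \<le> 1" for t using that by (intro AC_P2[OF assms]) auto
    show "(\<lambda>t. m (1 - t)) \<in> borel_measurable borel" using m(1) by measurable
    have "integrable lborel (\<lambda>t. (m (1 + (-1) * t))\<^sup>2)"
      by (rule lborel_integrable_real_affine[OF m(4)]) simp
    then have "integrable lborel (\<lambda>t. (m (1 - t))\<^sup>2)" by simp
    from integrable_mult_indicator[OF _ this, of "{0..1}"]
    show "set_integrable lborel {0..1} (\<lambda>t. \<bar>m (1 - t)\<bar>\<^sup>2)"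
      by (simp add: set_integrable_def)
    fix s t :: real assume st: "0 \<le> s" "s \<le> t" "t \<le> 1"
    have "W2 (\<gamma> (1 - s)) (\<gamma> (1 - t)) = W2 (\<gamma> (1 - t)) (\<gamma> (1 - s))" by (rule W2_commute)
    also have "\<dots> \<le> (LBINT u:{1 - t..1 - s}. m u)" using st by (intro m(5)) auto
    also have "\<dots> = (LBINT u. indicator {1 - t..1 - s} (1 + (-1) * u) *\<^sub>R m (1 + (-1) * u))"
      unfolding set_lebesgue_integral_def
      using lborel_integral_real_affine[of "-1" "\<lambda>u. indicator {1 - t..1 - s} u *\<^sub>R m u" 1] by simp
    also have "\<dots> = (LBINT u:{s..t}. m (1 - u))"
      unfolding set_lebesgue_integral_def
      by (intro Bochner_Integration.integral_cong) (auto split: split_indicator)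
    finally show "W2 (\<gamma> (1 - s)) (\<gamma> (1 - t)) \<le> (LBINT u:{s..t}. m (1 - u))" .
  qed
qed

text \<open>
  The sum of the two bounds works on the whole interval, since both of them are nonnegative. Only at
  the common point \<open>b\<close> is the triangle inequality for \<open>W2\<close> used.
\<close>

lemma AC2_concat:
  assumes 1: "AC 2 E {a..b} \<gamma>" and 2: "AC 2 E {b..c} \<gamma>" and abc: "a \<le> b" "b \<le> c"
  shows "AC 2 E {a..c} \<gamma>"
proof -
  obtain m where m: "m \<in> borel_measurable borel" "\<And>t. 0 \<le> m t" "integrable lborel m"
    "integrable lborel (\<lambda>t. (m t)\<^sup>2)"
    "\<And>s t. a \<le> s \<Longrightarrow> s \<le> t \<Longrightarrow> t \<le> b \<Longrightarrow> W2 (\<gamma> s) (\<gamma> t) \<le> (LBINT u:{s..t}. m u)"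
    using AC2_elim[OF 1] by metis
  obtain n where n: "n \<in> borel_measurable borel" "\<And>t. 0 \<le> n t" "integrable lborel n"
    "integrable lborel (\<lambda>t. (n t)\<^sup>2)"
    "\<And>s t. b \<le> s \<Longrightarrow> s \<le> t \<Longrightarrow> t \<le> c \<Longrightarrow> W2 (\<gamma> s) (\<gamma> t) \<le> (LBINT u:{s..t}. n u)"
    using AC2_elim[OF 2] by metis
  note [measurable] = m(1) n(1)
  have mi: "set_integrable lborel {s..t} m" and ni: "set_integrable lborel {s..t} n" for s t :: real
    using integrable_mult_indicator[OF _ m(3), of "{s..t}"] integrable_mult_indicator[OF _ n(3), of "{s..t}"]
    by (auto simp: set_integrable_def)
  have mono: "(LBINT u:{s..t}. f u) \<le> (LBINT u:{s'..t'}. f u)"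
    if "s' \<le> s" "t \<le> t'" "\<And>u. 0 \<le> f u" "\<And>s t. set_integrable lborel {s..t} f" for s t s' t' :: real and f :: "real \<Rightarrow> real"
    unfolding set_lebesgue_integral_def
    using that(1-3) by (intro integral_mono that(4)[unfolded set_integrable_def]) (auto split: split_indicator)
  have pos: "0 \<le> (LBINT u:{s..t}. f u)" if "\<And>u. 0 \<le> f u" for s t :: real and f :: "real \<Rightarrow> real"
    unfolding set_lebesgue_integral_def using that by (intro integral_nonneg_AE) auto
  show ?thesis
  proof (rule AC_intro)
    show P2: "\<gamma> t \<in> P2 E" if "a \<le> t" "t \<le> c" for t
      using that AC_P2[OF 1, of t] AC_P2[OF 2, of t] by (cases "t \<le> b") auto
    show "(\<lambda>u. m u + n u) \<in> borel_measurable borel" by measurable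
    have "integrable lborel (\<lambda>t. (m t + n t)\<^sup>2)"
    proof (rule Bochner_Integration.integrable_bound)
      show "integrable lborel (\<lambda>t. 2 * (m t)\<^sup>2 + 2 * (n t)\<^sup>2)" using m(4) n(4) by simp
      have "(x + y)\<^sup>2 \<le> 2 * x\<^sup>2 + 2 * y\<^sup>2" for x y :: real
        using sum_squares_bound[of x y] by (simp add: power2_sum)
      then show "AE t in lborel. norm ((m t + n t)\<^sup>2) \<le> norm (2 * (m t)\<^sup>2 + 2 * (n t)\<^sup>2)"
        by (intro AE_I2) simp
    qed measurable
    from integrable_mult_indicator[OF _ this, of "{a..c}"]
    show "set_integrable lborel {a..c} (\<lambda>t. \<bar>m t + n t\<bar>\<^sup>2)" by (simp add: set_integrable_def)
    fix s t :: real assume st: "a \<le> s" "s \<le> t" "t \<le> c"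
    have sum: "(LBINT u:{s..t}. m u + n u) = (LBINT u:{s..t}. m u) + (LBINT u:{s..t}. n u)"
      by (rule set_integral_add(2)[OF mi ni])
    consider "t \<le> b" | "b \<le> s" | "s \<le> b" "b \<le> t" by linarith
    then show "W2 (\<gamma> s) (\<gamma> t) \<le> (LBINT u:{s..t}. m u + n u)"
    proof cases
      case 1
      then show ?thesis using m(5)[of s t] pos[of n s t] n(2) st sum by simp
    next
      case 2
      then show ?thesis using n(5)[of s t] pos[of m s t] m(2) st sum by simp
    next
      case 3
      have "W2 (\<gamma> s) (\<gamma> t) \<le> W2 (\<gamma> s) (\<gamma> b) + W2 (\<gamma> b) (\<gamma> t)"
        using st abc by (intro W2_triangle[where E=E] P2) auto
      also have "\<dots> \<le> (LBINT u:{s..b}. m u) + (LBINT u:{b..t}. n u)"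
        using 3 st by (intro add_mono m(5) n(5)) auto
      also have "\<dots> \<le> (LBINT u:{s..t}. m u) + (LBINT u:{s..t}. n u)"
        using 3 by (intro add_mono mono m(2) n(2) mi ni) auto
      finally show ?thesis by (simp add: sum)
    qed
  qed
qed

text \<open>
  An increasing diffeomorphism \<open>\<phi>\<close> of the line, of class \<open>C\<^sup>1\<close>, with inverse \<open>\<psi>\<close>.
\<close>

locale time_change =
  fixes \<phi> \<psi> :: "real \<Rightarrow> real" and \<phi>' :: "real \<Rightarrow> real"
  assumes deriv: "\<And>t. (\<phi> has_real_derivative \<phi>' t) (at t)"
    and deriv_pos: "\<And>t. 0 < \<phi>' t"
    and deriv_cont: "continuous_on UNIV \<phi>'"
    and inv: "\<And>t. \<psi> (\<phi> t) = t" "\<And>u. \<phi> (\<psi> u) = u"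
    and deriv_inv: "\<And>t. (\<psi> has_real_derivative 1 / \<phi>' t) (at (\<phi> t))"
begin

lemma continuous: "continuous_on UNIV \<phi>"
  using deriv by (intro continuous_at_imp_continuous_on ballI DERIV_isCont[OF deriv])

lemma mono: "s \<le> t \<Longrightarrow> \<phi> s \<le> \<phi> t"
  by (rule DERIV_nonneg_imp_nondecreasing) (auto intro!: exI deriv less_imp_le[OF deriv_pos])

lemma strict_mono: "s < t \<Longrightarrow> \<phi> s < \<phi> t"
  by (rule DERIV_pos_imp_increasing) (auto intro!: exI deriv deriv_pos)

lemma measurable [measurable]: "\<phi> \<in> borel_measurable borel" "\<phi>' \<in> borel_measurable borel"
  using borel_measurable_continuous_onI[OF continuous] borel_measurable_continuous_onI[OF deriv_cont]
  by simp_all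

lemma speed_time_change: "speed (\<lambda>s. \<gamma> (\<phi> s)) t = \<phi>' t * speed \<gamma> (\<phi> t)"
  using speed_compose[OF inv deriv _ deriv_inv, of t \<gamma>] deriv_pos[of t] by simp

lemma nn_integral_time_change:
  fixes f :: "real \<Rightarrow> real"
  assumes [measurable]: "f \<in> borel_measurable borel" and "\<And>t. 0 \<le> f t" "a \<le> b"
  shows "(\<integral>\<^sup>+t\<in>{a..b}. ennreal (f (\<phi> t) * \<phi>' t) \<partial>lborel) = (\<integral>\<^sup>+s\<in>{\<phi> a..\<phi> b}. ennreal (f s) \<partial>lborel)"
proof -
  have "(\<integral>\<^sup>+s\<in>{\<phi> a..\<phi> b}. ennreal (f s) \<partial>lborel) = (\<integral>\<^sup>+s. ennreal (f s * indicator {\<phi> a..\<phi> b} s) \<partial>lborel)"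
    by (intro nn_integral_cong) (auto split: split_indicator)
  also have "\<dots> = (\<integral>\<^sup>+t. ennreal (f (\<phi> t) * \<phi>' t * indicator {a..b} t) \<partial>lborel)"
    using deriv deriv_pos assms(3) continuous_on_subset[OF deriv_cont]
    by (intro nn_integral_substitution) (auto simp: set_borel_measurable_def less_imp_le)
  also have "\<dots> = (\<integral>\<^sup>+t\<in>{a..b}. ennreal (f (\<phi> t) * \<phi>' t) \<partial>lborel)"
    by (intro nn_integral_cong) (auto split: split_indicator)
  finally show ?thesis ..
qed

text \<open>
  The natural bound for the new curve is \<open>m (\<phi> t) \<phi>' t\<close>. Its square is \<open>m\<^sup>2 (\<phi> t) \<phi>' t\<close> times the factor
  \<open>\<phi>' t\<close>, which is bounded on a compact interval.
\<close>

lemma AC2_time_change: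
  assumes AC: "AC 2 E {\<phi> a..\<phi> b} \<gamma>" and ab: "a \<le> b"
  shows "AC 2 E {a..b} (\<lambda>t. \<gamma> (\<phi> t))"
proof -
  obtain m where m: "m \<in> borel_measurable borel" "\<And>t. 0 \<le> m t" "integrable lborel m"
    "integrable lborel (\<lambda>t. (m t)\<^sup>2)"
    "\<And>s t. \<phi> a \<le> s \<Longrightarrow> s \<le> t \<Longrightarrow> t \<le> \<phi> b \<Longrightarrow> W2 (\<gamma> s) (\<gamma> t) \<le> (LBINT u:{s..t}. m u)"
    using AC2_elim[OF AC] by metis
  note [measurable] = m(1)
  have cont: "continuous_on {s..t} \<phi>'" for s t by (rule continuous_on_subset[OF deriv_cont]) simp
  have mi: "set_integrable lborel {s..t} m" and mi2: "set_integrable lborel {s..t} (\<lambda>u. (m u)\<^sup>2)" for s t :: real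
    using integrable_mult_indicator[OF _ m(3), of "{s..t}"] integrable_mult_indicator[OF _ m(4), of "{s..t}"]
    by (auto simp: set_integrable_def)
  obtain B where B: "\<And>t. t \<in> {a..b} \<Longrightarrow> \<phi>' t \<le> B"
    using continuous_attains_sup[OF compact_Icc _ cont[of a b]] ab by force
  show ?thesis
  proof (rule AC_intro)
    show "\<gamma> (\<phi> t) \<in> P2 E" if "a \<le> t" "t \<le> b" for t
      using that mono by (intro AC_P2[OF AC]) auto
    show "(\<lambda>t. m (\<phi> t) * \<phi>' t) \<in> borel_measurable borel" by measurable
    have sub: "set_integrable lborel {a..b} (\<lambda>t. (m (\<phi> t))\<^sup>2 * \<phi>' t)"
      by (rule integral_substitution(1)[OF mi2 deriv cont less_imp_le[OF deriv_pos] ab])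
    show "set_integrable lborel {a..b} (\<lambda>t. \<bar>m (\<phi> t) * \<phi>' t\<bar>\<^sup>2)"
      unfolding set_integrable_def
    proof (rule Bochner_Integration.integrable_bound)
      show "integrable lborel (\<lambda>t. B * (indicator {a..b} t *\<^sub>R ((m (\<phi> t))\<^sup>2 * \<phi>' t)))"
        using sub by (simp add: set_integrable_def)
      have "(m (\<phi> t) * \<phi>' t)\<^sup>2 \<le> B * ((m (\<phi> t))\<^sup>2 * \<phi>' t)" if "t \<in> {a..b}" for t
      proof -
        have "(m (\<phi> t) * \<phi>' t)\<^sup>2 = \<phi>' t * ((m (\<phi> t))\<^sup>2 * \<phi>' t)" by (simp add: power2_eq_square)
        also have "\<dots> \<le> B * ((m (\<phi> t))\<^sup>2 * \<phi>' t)"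
          using deriv_pos[of t] by (intro mult_right_mono B that) auto
        finally show ?thesis .
      qed
      then show "AE t in lborel. norm (indicator {a..b} t *\<^sub>R \<bar>m (\<phi> t) * \<phi>' t\<bar>\<^sup>2)
          \<le> norm (B * (indicator {a..b} t *\<^sub>R ((m (\<phi> t))\<^sup>2 * \<phi>' t)))"
        by (intro AE_I2) (auto split: split_indicator intro: order_trans[OF _ abs_ge_self])
    qed measurable
    fix s t assume st: "a \<le> s" "s \<le> t" "t \<le> b"
    have "W2 (\<gamma> (\<phi> s)) (\<gamma> (\<phi> t)) \<le> (LBINT u:{\<phi> s..\<phi> t}. m u)"
      using st by (intro m(5) mono)
    also have "\<dots> = (LBINT u. m u * indicator {\<phi> s..\<phi> t} u)"
      by (simp add: set_lebesgue_integral_def mult.commute)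
    also have "\<dots> = (LBINT u. m (\<phi> u) * \<phi>' u * indicator {s..t} u)"
      by (rule integral_substitution(2)[OF mi deriv cont less_imp_le[OF deriv_pos] st(2)])
    also have "\<dots> = (LBINT u:{s..t}. m (\<phi> u) * \<phi>' u)"
      by (simp add: set_lebesgue_integral_def mult.commute)
    finally show "W2 (\<gamma> (\<phi> s)) (\<gamma> (\<phi> t)) \<le> (LBINT u:{s..t}. m (\<phi> u) * \<phi>' u)" .
  qed
qed

end

lemma time_change_affine:
  assumes "0 < \<alpha>"
  shows "time_change (\<lambda>t. \<alpha> * t + \<beta>) (\<lambda>u. (u - \<beta>) / \<alpha>) (\<lambda>_. \<alpha>)"
proof
  show "((\<lambda>u. (u - \<beta>) / \<alpha>) has_real_derivative 1 / \<alpha>) (at (\<alpha> * t + \<beta>))" for t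
    using assms by (auto intro!: derivative_eq_intros)
qed (use assms in \<open>auto intro!: derivative_eq_intros\<close>)

text \<open>
  The clock \<open>\<theta>\<close> advances at the rate \<open>w\<close>. The lower bound on \<open>w\<close> makes \<open>\<theta>\<close> surjective, and the continuity of \<open>w\<close>
  makes its inverse \<open>\<phi>\<close> continuously differentiable.
\<close>

lemma time_change_antiderivative:
  fixes w :: "real \<Rightarrow> real"
  assumes cont: "continuous_on UNIV w" and c: "0 < c" "\<And>s. c \<le> w s"
  obtains \<theta> \<phi> where "time_change \<phi> \<theta> (\<lambda>t. 1 / w (\<phi> t))" "\<theta> 0 = 0"
proof -
  define \<theta> where "\<theta> = (\<lambda>s::real. LBINT y=ereal 0..ereal s. w y)"
  have isc: "isCont w s" for s using cont by (simp add: continuous_on_eq_continuous_at)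
  have d: "(\<theta> has_real_derivative w s) (at s)" for s
  proof -
    define r where "r = \<bar>s\<bar> + 1"
    have "(\<theta> has_vector_derivative w s) (at s within {-r..r})"
      unfolding \<theta>_def
      by (rule interval_integral_FTC2) (auto simp: r_def intro: continuous_on_subset[OF cont])
    moreover have "at s within {-r..r} = at s" by (rule at_within_Icc_at) (auto simp: r_def)
    ultimately show ?thesis by (simp add: has_real_derivative_iff_has_vector_derivative)
  qed
  have w_pos: "w s > 0" for s using c(1) c(2)[of s] by linarith
  have inc: "\<theta> s < \<theta> t" if "s < t" for s t
    using DERIV_pos_imp_increasing[OF that] d w_pos by blast
  have inj: "inj \<theta>" by (rule linorder_injI) (use inc in force)
  have zero: "\<theta> 0 = 0" by (simp add: \<theta>_def)
  have cts: "isCont \<theta> s" for s using d by (rule DERIV_isCont)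
  have growth: "c * (t - s) \<le> \<theta> t - \<theta> s" if "s \<le> t" for s t
  proof -
    have "\<theta> s - c * s \<le> \<theta> t - c * t"
    proof (rule DERIV_nonneg_imp_nondecreasing[OF that])
      fix x
      have "((\<lambda>s. \<theta> s - c * s) has_real_derivative w x - c) (at x)"
        by (auto intro!: derivative_eq_intros d)
      then show "\<exists>y. ((\<lambda>s. \<theta> s - c * s) has_real_derivative y) (at x) \<and> 0 \<le> y"
        using c(2)[of x] by (intro exI[of _ "w x - c"]) simp
    qed
    then show ?thesis by (simp add: algebra_simps)
  qed
  have surj: "\<exists>s. \<theta> s = u" for u
  proof -
    define r where "r = \<bar>u\<bar> / c"
    have r: "r \<ge> 0" "c * r = \<bar>u\<bar>" using c(1) by (auto simp: r_def)
    have "\<theta> (-r) \<le> u" "u \<le> \<theta> r"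
      using growth[of "-r" 0] growth[of 0 r] r zero by auto
    then show ?thesis using IVT[of \<theta> "-r" u r] r cts by auto
  qed
  define \<phi> where "\<phi> = inv \<theta>"
  have inv1: "\<phi> (\<theta> s) = s" and inv2: "\<theta> (\<phi> u) = u" for s u
    using inv_f_f[OF inj] surj_f_inv_f[of \<theta> u] surj by (auto simp: \<phi>_def surj_def) metis
  have \<phi>_cts: "isCont \<phi> u" for u
    using isCont_inverse_function[of 1 "\<phi> u" \<phi> \<theta>] inv1 inv2 cts by simp
  have \<phi>_d: "(\<phi> has_real_derivative 1 / w (\<phi> u)) (at u)" for u
    using DERIV_inverse_function[where f=\<theta> and g=\<phi> and x=u and D="w (\<phi> u)" and a="u - 1" and b="u + 1"]
      d[of "\<phi> u"] w_pos[of "\<phi> u"] inv2 \<phi>_cts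
    by (auto simp: inverse_eq_divide)
  have "time_change \<phi> \<theta> (\<lambda>t. 1 / w (\<phi> t))"
  proof
    have "isCont (\<lambda>t. 1 / w (\<phi> t)) t" for t
      using w_pos[of "\<phi> t"] by (intro continuous_intros isCont_o2[OF \<phi>_cts isc]) simp
    then show "continuous_on UNIV (\<lambda>t. 1 / w (\<phi> t))" by (intro continuous_at_imp_continuous_on) auto
    show "(\<theta> has_real_derivative 1 / (1 / w (\<phi> t))) (at (\<phi> t))" for t using d by simp
  qed (use inv1 inv2 w_pos \<phi>_d in auto)
  then show ?thesis using zero by (rule that)
qed

section \<open>Nearly optimal weights\<close>

text \<open>
  A measurable function is almost everywhere the limit of continuous ones. After these are clipped to
  \<open>[c, M]\<close>, the integrands are dominated by \<open>p\<^sup>2 / c + K\<^sup>2 M\<close>.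
\<close>

lemma continuous_weight_approx:
  fixes p k w0 :: "real \<Rightarrow> real"
  assumes [measurable]: "p \<in> borel_measurable borel" "k \<in> borel_measurable borel" "w0 \<in> borel_measurable borel"
    and p: "integrable lborel (\<lambda>t. (p t)\<^sup>2)" and k: "\<And>t. \<bar>k t\<bar> \<le> K"
    and w0: "0 < c" "\<And>t. c \<le> w0 t" "\<And>t. w0 t \<le> M" and e: "0 < (e::real)"
  obtains w where "continuous_on UNIV w" "\<And>t. c \<le> w t"
    "set_integrable lborel {0..1} (\<lambda>t. (p t)\<^sup>2 / w t + (k t)\<^sup>2 * w t)"
    "(LBINT t:{0..1}. (p t)\<^sup>2 / w t + (k t)\<^sup>2 * w t) < (LBINT t:{0..1}. (p t)\<^sup>2 / w0 t + (k t)\<^sup>2 * w0 t) + e"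
proof -
  have "w0 \<in> borel_measurable lebesgue" by (rule measurable_completion) simp
  then have "w0 measurable_on UNIV" by (rule lebesgue_measurable_imp_measurable_on) simp
  then obtain N u where N: "negligible N" and u: "\<And>n. continuous_on UNIV (u n)"
    and lim: "\<And>x. x \<notin> N \<Longrightarrow> (\<lambda>n. u n x) \<longlonglongrightarrow> w0 x"
    unfolding measurable_on_def by auto
  have "AE x in lebesgue. x \<notin> N"
    using N by (simp add: negligible_iff_null_sets AE_not_in)
  then have AEN: "AE x in lborel. x \<notin> N" by (simp add: AE_completion_iff)
  define w where "w = (\<lambda>n t. max c (min M (u n t)))"
  have w_cont: "continuous_on UNIV (w n)" for n
    unfolding w_def by (intro continuous_intros u)
  then have [measurable]: "w n \<in> borel_measurable borel" for n by (rule borel_measurable_continuous_onI)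
  have cM: "c \<le> M" using w0(2,3) order_trans by blast
  have w: "c \<le> w n t" "w n t \<le> M" for n t using cM by (auto simp: w_def)
  have w_lim: "(\<lambda>n. w n t) \<longlonglongrightarrow> w0 t" if "t \<notin> N" for t
  proof -
    have "(\<lambda>n. w n t) \<longlonglongrightarrow> max c (min M (w0 t))"
      unfolding w_def by (intro tendsto_intros lim that)
    then show ?thesis using w0(2,3)[of t] by simp
  qed
  define F where "F = (\<lambda>w t. indicator {0..1} t * ((p t)\<^sup>2 / w t + (k t)\<^sup>2 * w t) :: real)"
  define B where "B = (\<lambda>t. (p t)\<^sup>2 / c + K\<^sup>2 * M * indicator {0..1} t :: real)"
  have B: "integrable lborel B"
    unfolding B_def using p by (intro Bochner_Integration.integrable_add) (auto intro!: integrable_indicator_Icc)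
  have bound: "norm (F v t) \<le> B t" if "\<And>t. c \<le> v t" "\<And>t. v t \<le> M" for v t
  proof (cases "t \<in> {0..1}")
    case True
    have v: "0 < v t" using that(1)[of t] w0(1) by linarith
    have "(p t)\<^sup>2 / v t \<le> (p t)\<^sup>2 / c" using that(1)[of t] w0(1) v by (intro divide_left_mono) auto
    moreover have "(k t)\<^sup>2 * v t \<le> K\<^sup>2 * M"
    proof (rule mult_mono)
      have "\<bar>k t\<bar>\<^sup>2 \<le> K\<^sup>2" using k[of t] by (intro power_mono) auto
      then show "(k t)\<^sup>2 \<le> K\<^sup>2" by simp
    qed (use that(2) v in auto)
    ultimately show ?thesis using True v by (simp add: F_def B_def)
  next
    case False
    then show ?thesis using w0(1) by (simp add: F_def B_def)
  qed
  have [measurable]: "F v \<in> borel_measurable borel" if [measurable]: "v \<in> borel_measurable borel" for v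
    unfolding F_def by measurable
  have int: "integrable lborel (F (w n))" for n
    by (rule Bochner_Integration.integrable_bound[OF B])
       (use bound[OF w(1,2)] in \<open>auto intro!: AE_I2 intro: order_trans[OF _ abs_ge_self]\<close>)
  have "(\<lambda>n. LBINT t. F (w n) t) \<longlonglongrightarrow> (LBINT t. F w0 t)"
  proof (rule integral_dominated_convergence[OF _ _ B])
    show "AE t in lborel. (\<lambda>n. F (w n) t) \<longlonglongrightarrow> F w0 t"
      using AEN
    proof eventually_elim
      case (elim t)
      have "w0 t \<noteq> 0" using w0(1) w0(2)[of t] by linarith
      then show ?case unfolding F_def by (intro tendsto_intros w_lim elim)
    qed
    show "AE t in lborel. norm (F (w n) t) \<le> B t" for n
      by (intro AE_I2 bound w)
  qed simp_all
  then have "eventually (\<lambda>n. (LBINT t. F (w n) t) < (LBINT t. F w0 t) + e) sequentially"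
    using e by (intro order_tendstoD(2)) auto
  then obtain n where n: "(LBINT t. F (w n) t) < (LBINT t. F w0 t) + e"
    by (auto simp: eventually_sequentially)
  show ?thesis
    by (rule that[of "w n"])
       (use w_cont w int[of n] n in \<open>auto simp: F_def set_integrable_def set_lebesgue_integral_def\<close>)
qed

text \<open>
  The exact minimiser of \<open>p\<^sup>2 / w + k\<^sup>2 w\<close> is \<open>w = p / k\<close>, with minimum \<open>2 p k\<close>. It is replaced by
  \<open>(min p N + \<delta>) / (k + \<delta>)\<close> with \<open>\<delta> = 1 / N\<close>, which lies between two positive constants. The excess over
  \<open>2 p k\<close> is at most \<open>\<delta> R\<close> with an integrable function \<open>R\<close>: this is a direct computation where
  \<open>p \<le> N\<close>, and where \<open>p > N\<close> it holds because \<open>p\<^sup>2 / w\<close> is at most \<open>p\<^sup>2 (K + 1) / N\<close>.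
\<close>

lemma near_optimal_weight:
  fixes p k :: "real \<Rightarrow> real"
  assumes [measurable]: "p \<in> borel_measurable borel" "k \<in> borel_measurable borel"
    and p: "\<And>t. 0 \<le> p t" "integrable lborel (\<lambda>t. (p t)\<^sup>2)"
    and k: "\<And>t. 0 \<le> k t" "\<And>t. k t \<le> K" and e: "0 < (e::real)"
  obtains w c where "continuous_on UNIV w" "0 < c" "\<And>t. c \<le> w t"
    "(\<integral>\<^sup>+t\<in>{0..1}. ennreal (1 / 2 * ((p t)\<^sup>2 / w t) + 1 / 2 * ((k t)\<^sup>2 * w t)) \<partial>lborel)
       \<le> (\<integral>\<^sup>+t\<in>{0..1}. ennreal (p t * k t) \<partial>lborel) + ennreal e"
proof -
  have K: "0 \<le> K" using k[of 0] by linarith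
  define R where "R = (\<lambda>t. 1 + (p t)\<^sup>2 + K + (p t)\<^sup>2 * (K + 1))"
  have p1: "p t \<le> 1 + (p t)\<^sup>2" for t
  proof (cases "p t \<le> 1")
    case True
    then show ?thesis using zero_le_power2[of "p t"] by linarith
  next
    case False
    then show ?thesis using self_le_power[of "p t" 2] by simp
  qed
  have p2: "set_integrable lborel {0..1} (\<lambda>t. (p t)\<^sup>2)"
    using integrable_mult_indicator[OF _ p(2), of "{0..1}"] by (simp add: set_integrable_def)
  have const: "set_integrable lborel {0..1} (\<lambda>t::real. x)" for x :: real
    by (simp add: set_integrable_def integrable_indicator_Icc)
  have R: "set_integrable lborel {0..1} R"
    unfolding R_def by (intro set_integral_add(1) const p2 set_integrable_mult_left)
  define C where "C = (LBINT t:{0..1}. R t)"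
  have pk: "set_integrable lborel {0..1} (\<lambda>t. p t * k t)"
  proof (rule set_integrable_bound)
    show "set_integrable lborel {0..1} (\<lambda>t. K * (1 + (p t)\<^sup>2))"
      by (intro set_integrable_mult_right set_integral_add(1) const p2)
    show "set_borel_measurable lborel {0..1} (\<lambda>t. p t * k t)"
      by (simp add: set_borel_measurable_def)
    have "p t * k t \<le> K * (1 + (p t)\<^sup>2)" for t
      using mult_mono[OF p1[of t] k(2)[of t]] k p by (simp add: mult.commute)
    then show "AE t in lborel. t \<in> {0..1} \<longrightarrow> norm (p t * k t) \<le> norm (K * (1 + (p t)\<^sup>2))"
      using p k by (intro AE_I2) (auto intro: order_trans[OF _ abs_ge_self])
  qed
  obtain n :: nat where n: "C / e < real n" using reals_Archimedean2 by blast
  define N where "N = real n + 1"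
  have N: "N \<ge> 1" "C \<le> e * N"
    using n e by (auto simp: N_def field_simps)
  define \<delta> where "\<delta> = 1 / N"
  have \<delta>: "0 < \<delta>" "\<delta> \<le> 1" using N by (auto simp: \<delta>_def)
  define w0 where "w0 = (\<lambda>t. (min (p t) N + \<delta>) / (k t + \<delta>))"
  have [measurable]: "w0 \<in> borel_measurable borel" unfolding w0_def by measurable
  define c where "c = \<delta> / (K + \<delta>)"
  have c: "0 < c" using \<delta> K by (auto simp: c_def)
  have w0: "c \<le> w0 t" "w0 t \<le> (N + \<delta>) / \<delta>" for t
  proof -
    show "c \<le> w0 t" unfolding c_def w0_def
      using \<delta> k[of t] p(1)[of t] N(1) by (intro frac_le) auto
    show "w0 t \<le> (N + \<delta>) / \<delta>" unfolding w0_def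
      using \<delta> k[of t] p(1)[of t] N(1) by (intro frac_le) auto
  qed
  have pw: "(p t)\<^sup>2 / w0 t + (k t)\<^sup>2 * w0 t \<le> 2 * (p t * k t) + \<delta> * R t" for t
  proof -
    have kd: "0 < k t + \<delta>" and md: "0 < min (p t) N + \<delta>" using k p \<delta> N by (auto intro: add_nonneg_pos simp: less_imp_le)
    have 1: "(p t)\<^sup>2 / w0 t \<le> p t * (k t + \<delta>) + \<delta> * ((p t)\<^sup>2 * (K + 1))"
    proof (cases "p t \<le> N")
      case True
      have "(p t)\<^sup>2 / w0 t = (p t)\<^sup>2 / (p t + \<delta>) * (k t + \<delta>)" using True by (simp add: w0_def min_absorb1)
      also have "(p t)\<^sup>2 / (p t + \<delta>) \<le> p t"
        using p(1)[of t] \<delta> by (simp add: field_simps power2_eq_square)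
      finally have "(p t)\<^sup>2 / w0 t \<le> p t * (k t + \<delta>)" using kd by (simp add: mult_right_mono)
      moreover have "0 \<le> \<delta> * ((p t)\<^sup>2 * (K + 1))" using \<delta> K by simp
      ultimately show ?thesis by linarith
    next
      case False
      then have "(p t)\<^sup>2 / w0 t = (p t)\<^sup>2 * (k t + \<delta>) / (N + \<delta>)" by (simp add: w0_def min_absorb2)
      also have "\<dots> \<le> (p t)\<^sup>2 * (K + 1) / N"
        using \<delta> k[of t] N(1) K by (intro frac_le mult_left_mono) auto
      also have "\<dots> = \<delta> * ((p t)\<^sup>2 * (K + 1))" by (simp add: \<delta>_def)
      finally have "(p t)\<^sup>2 / w0 t \<le> \<delta> * ((p t)\<^sup>2 * (K + 1))" .
      moreover have "0 \<le> p t * (k t + \<delta>)" using p(1)[of t] kd by simp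
      ultimately show ?thesis by linarith
    qed
    have "(k t)\<^sup>2 * w0 t = (k t)\<^sup>2 / (k t + \<delta>) * (min (p t) N + \<delta>)" by (simp add: w0_def)
    also have "\<dots> \<le> k t * (p t + \<delta>)"
    proof (rule mult_mono)
      show "(k t)\<^sup>2 / (k t + \<delta>) \<le> k t" using k(1)[of t] \<delta> by (simp add: field_simps power2_eq_square)
    qed (use k p \<delta> md in auto)
    finally have 2: "(k t)\<^sup>2 * w0 t \<le> k t * (p t + \<delta>)" .
    have "p t * (k t + \<delta>) + k t * (p t + \<delta>) \<le> 2 * (p t * k t) + \<delta> * (1 + (p t)\<^sup>2 + K)"
    proof -
      have "\<delta> * (p t + k t) \<le> \<delta> * (1 + (p t)\<^sup>2 + K)"
        using p1[of t] k(2)[of t] \<delta> by (intro mult_left_mono) auto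
      then show ?thesis by (simp add: algebra_simps)
    qed
    then show ?thesis using 1 2 by (simp add: R_def algebra_simps)
  qed
  have int0: "set_integrable lborel {0..1} (\<lambda>t. 2 * (p t * k t) + \<delta> * R t)"
    by (intro set_integral_add(1) set_integrable_mult_right pk R)
  have w0_int: "set_integrable lborel {0..1} (\<lambda>t. (p t)\<^sup>2 / w0 t + (k t)\<^sup>2 * w0 t)"
  proof (rule set_integrable_bound[OF int0])
    show "set_borel_measurable lborel {0..1} (\<lambda>t. (p t)\<^sup>2 / w0 t + (k t)\<^sup>2 * w0 t)"
      by (simp add: set_borel_measurable_def)
    have "0 \<le> (p t)\<^sup>2 / w0 t + (k t)\<^sup>2 * w0 t" for t
      using c w0(1)[of t] by (intro add_nonneg_nonneg) auto
    then show "AE t in lborel. t \<in> {0..1} \<longrightarrow> norm ((p t)\<^sup>2 / w0 t + (k t)\<^sup>2 * w0 t) \<le> norm (2 * (p t * k t) + \<delta> * R t)"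
      using pw by (intro AE_I2) (auto intro: order_trans[OF _ abs_ge_self])
  qed
  have "(LBINT t:{0..1}. (p t)\<^sup>2 / w0 t + (k t)\<^sup>2 * w0 t) \<le> (LBINT t:{0..1}. 2 * (p t * k t) + \<delta> * R t)"
    by (rule set_integral_mono[OF w0_int int0 pw])
  also have "\<dots> = 2 * (LBINT t:{0..1}. p t * k t) + \<delta> * C"
    by (subst set_integral_add(2)[OF set_integrable_mult_right set_integrable_mult_right]) (auto simp: pk R C_def)
  also have "\<delta> * C \<le> e" using N by (simp add: \<delta>_def field_simps)
  finally have J0: "(LBINT t:{0..1}. (p t)\<^sup>2 / w0 t + (k t)\<^sup>2 * w0 t) \<le> 2 * (LBINT t:{0..1}. p t * k t) + e"
    by simp
  have k_abs: "\<bar>k t\<bar> \<le> K" for t using k[of t] by simp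
  obtain w where w: "continuous_on UNIV w" "\<And>t. c \<le> w t"
    "set_integrable lborel {0..1} (\<lambda>t. (p t)\<^sup>2 / w t + (k t)\<^sup>2 * w t)"
    and J: "(LBINT t:{0..1}. (p t)\<^sup>2 / w t + (k t)\<^sup>2 * w t) < (LBINT t:{0..1}. (p t)\<^sup>2 / w0 t + (k t)\<^sup>2 * w0 t) + e"
    using continuous_weight_approx[of p k w0 K c "(N + \<delta>) / \<delta>" e] p(2) k_abs c w0 e by (auto simp: assms(1,2))
  have set_nn: "(\<integral>\<^sup>+t\<in>{0..1}. ennreal (f t) \<partial>lborel) = ennreal (LBINT t:{0..1}. f t)"
    if "set_integrable lborel {0..1} f" "\<And>t. 0 \<le> f t" for f :: "real \<Rightarrow> real"
  proof -
    have "(\<integral>\<^sup>+t\<in>{0..1}. ennreal (f t) \<partial>lborel) = (\<integral>\<^sup>+t. ennreal (indicator {0..1} t *\<^sub>R f t) \<partial>lborel)"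
      by (intro nn_integral_cong) (auto split: split_indicator)
    also have "\<dots> = ennreal (LBINT t:{0..1}. f t)"
      using that unfolding set_integrable_def set_lebesgue_integral_def
      by (intro nn_integral_eq_integral) auto
    finally show ?thesis .
  qed
  have w_pos: "0 < w t" for t using c w(2)[of t] by linarith
  have nonneg: "0 \<le> 1 / 2 * ((p t)\<^sup>2 / w t + (k t)\<^sup>2 * w t)" for t
    using less_imp_le[OF w_pos[of t]] by (intro mult_nonneg_nonneg add_nonneg_nonneg) auto
  have "(\<integral>\<^sup>+t\<in>{0..1}. ennreal (1 / 2 * ((p t)\<^sup>2 / w t) + 1 / 2 * ((k t)\<^sup>2 * w t)) \<partial>lborel)
      = (\<integral>\<^sup>+t\<in>{0..1}. ennreal (1 / 2 * ((p t)\<^sup>2 / w t + (k t)\<^sup>2 * w t)) \<partial>lborel)"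
    by (simp add: algebra_simps)
  also have "\<dots> = ennreal (LBINT t:{0..1}. 1 / 2 * ((p t)\<^sup>2 / w t + (k t)\<^sup>2 * w t))"
    by (intro set_nn set_integrable_mult_right w(3) nonneg)
  also have "\<dots> \<le> ennreal ((LBINT t:{0..1}. p t * k t) + e)"
    using J J0 by (intro ennreal_leI) simp
  also have "\<dots> = (\<integral>\<^sup>+t\<in>{0..1}. ennreal (p t * k t) \<partial>lborel) + ennreal e"
    using p(1) k(1) e
    by (subst set_nn[OF pk]) (auto intro!: ennreal_plus integral_nonneg_AE simp: set_lebesgue_integral_def)
  finally show ?thesis using that[OF w(1) c w(2)] by blast
qed

section \<open>Weighted length and action\<close>

text \<open>
  The properties of \<open>G\<close> on which the comparison of \<open>d\<^sub>G\<close> with the energies rests.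
\<close>

locale path_cost =
  fixes E :: "'a::euclidean_space set" and g :: "'a measure \<Rightarrow> real"
  assumes nonneg: "\<mu> \<in> P2 E \<Longrightarrow> 0 \<le> g \<mu>"
    and measurable_along: "AC 2 E {a..b} \<gamma> \<Longrightarrow> (\<lambda>t. g (\<gamma> t)) \<in> borel_measurable (restrict_space borel {a..b})"
    and bounded_along: "AC 2 E {a..b} \<gamma> \<Longrightarrow> \<exists>K. \<forall>t\<in>{a..b}. g (\<gamma> t) \<le> K"
begin

definition weighted_length :: "(real \<Rightarrow> 'a measure) \<Rightarrow> real \<Rightarrow> real \<Rightarrow> ennreal" where
  "weighted_length \<gamma> a b = (\<integral>\<^sup>+t\<in>{a..b}. ennreal (speed \<gamma> t * g (\<gamma> t)) \<partial>lborel)"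

definition action :: "(real \<Rightarrow> 'a measure) \<Rightarrow> real \<Rightarrow> real \<Rightarrow> ennreal" where
  "action \<gamma> a b = (\<integral>\<^sup>+t\<in>{a..b}. ennreal (1 / 2 * (speed \<gamma> t)\<^sup>2 + 1 / 2 * (g (\<gamma> t))\<^sup>2) \<partial>lborel)"

text \<open>
  Along a curve, the speed and the cost coincide on the open interval with functions that are measurable
  on the line and satisfy their bounds everywhere. The end points have measure \<open>0\<close>.
\<close>

lemma profile:
  assumes AC: "AC 2 E {a..b} \<gamma>" and ab: "a < b"
  obtains p k K where "p \<in> borel_measurable borel" "k \<in> borel_measurable borel"
    "\<And>t. 0 \<le> p t" "\<And>t. 0 \<le> k t" "\<And>t. k t \<le> K" "integrable lborel (\<lambda>t. (p t)\<^sup>2)"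
    "\<And>t. a < t \<Longrightarrow> t < b \<Longrightarrow> speed \<gamma> t = p t" "\<And>t. a < t \<Longrightarrow> t < b \<Longrightarrow> g (\<gamma> t) = k t"
proof -
  obtain p where p: "p \<in> borel_measurable borel" "\<And>t. 0 \<le> p t" "integrable lborel (\<lambda>t. (p t)\<^sup>2)"
    "\<And>t. a < t \<Longrightarrow> t < b \<Longrightarrow> speed \<gamma> t = p t"
    using AC2_speed_L2[OF AC ab] by metis
  obtain K where K: "\<And>t. t \<in> {a..b} \<Longrightarrow> g (\<gamma> t) \<le> K" using bounded_along[OF AC] by blast
  define k where "k = (\<lambda>t. g (\<gamma> t) * indicator {a..b} t)"
  have k: "k \<in> borel_measurable borel"
    using measurable_along[OF AC] by (simp add: k_def borel_measurable_restrict_space_iff mult.commute)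
  have k0: "0 \<le> k t" for t
    using nonneg[OF AC_P2[OF AC, of t]] by (auto simp: k_def split: split_indicator)
  have "k t \<le> max 0 K" for t using K[of t] by (auto simp: k_def split: split_indicator)
  then show ?thesis using that[OF p(1) k p(2) k0 _ p(3,4)] by (auto simp: k_def)
qed

lemma weighted_length_cong:
  assumes "\<And>t. a < t \<Longrightarrow> t < b \<Longrightarrow> \<gamma> t = \<eta> t"
  shows "weighted_length \<gamma> a b = weighted_length \<eta> a b"
  unfolding weighted_length_def
proof (rule nn_integral_interior_cong)
  fix t assume t: "a < t" "t < b"
  have "speed \<gamma> t = speed \<eta> t" by (rule speed_cong[of "{a<..<b}"]) (use t assms in auto)
  then show "ennreal (speed \<gamma> t * g (\<gamma> t)) = ennreal (speed \<eta> t * g (\<eta> t))"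
    using assms[OF t] by simp
qed

lemma weighted_length_le_action: "weighted_length \<gamma> a b \<le> action \<gamma> a b"
  unfolding weighted_length_def action_def
proof (intro nn_integral_mono mult_right_mono ennreal_leI)
  fix t
  show "speed \<gamma> t * g (\<gamma> t) \<le> 1 / 2 * (speed \<gamma> t)\<^sup>2 + 1 / 2 * (g (\<gamma> t))\<^sup>2"
    using sum_squares_bound[of "speed \<gamma> t" "g (\<gamma> t)"] by simp
qed simp

text \<open>
  The speed picks up exactly the factor \<open>\<phi>'\<close> of the substitution rule.
\<close>

lemma weighted_length_time_change:
  assumes "time_change \<phi> \<psi> \<phi>'" and AC: "AC 2 E {\<phi> a..\<phi> b} \<gamma>" and ab: "a < b"
  shows "weighted_length (\<lambda>t. \<gamma> (\<phi> t)) a b = weighted_length \<gamma> (\<phi> a) (\<phi> b)"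
proof -
  interpret time_change \<phi> \<psi> \<phi>' by fact
  obtain p k K where pk [measurable]: "p \<in> borel_measurable borel" "k \<in> borel_measurable borel"
    and p: "\<And>t. 0 \<le> p t" and k: "\<And>t. 0 \<le> k t" "\<And>t. k t \<le> K" and p2: "integrable lborel (\<lambda>t. (p t)\<^sup>2)"
    and eq: "\<And>t. \<phi> a < t \<Longrightarrow> t < \<phi> b \<Longrightarrow> speed \<gamma> t = p t" "\<And>t. \<phi> a < t \<Longrightarrow> t < \<phi> b \<Longrightarrow> g (\<gamma> t) = k t"
    by (rule profile[OF AC strict_mono[OF ab]]) (rule that)
  have "weighted_length (\<lambda>t. \<gamma> (\<phi> t)) a b = (\<integral>\<^sup>+t\<in>{a..b}. ennreal (p (\<phi> t) * k (\<phi> t) * \<phi>' t) \<partial>lborel)"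
    unfolding weighted_length_def
    by (rule nn_integral_interior_cong) (simp add: speed_time_change eq strict_mono ac_simps)
  also have "\<dots> = (\<integral>\<^sup>+s\<in>{\<phi> a..\<phi> b}. ennreal (p s * k s) \<partial>lborel)"
    by (rule nn_integral_time_change) (use p k ab in auto)
  also have "\<dots> = weighted_length \<gamma> (\<phi> a) (\<phi> b)"
    unfolding weighted_length_def by (rule nn_integral_interior_cong) (simp add: eq)
  finally show ?thesis .
qed

lemma weighted_length_reverse:
  assumes AC: "AC 2 E {0..1} \<gamma>"
  shows "weighted_length (\<lambda>t. \<gamma> (1 - t)) 0 1 = weighted_length \<gamma> 0 1"
proof -
  obtain p k K where pk [measurable]: "p \<in> borel_measurable borel" "k \<in> borel_measurable borel"
    and p: "\<And>t. 0 \<le> p t" and k: "\<And>t. 0 \<le> k t" "\<And>t. k t \<le> K" and p2: "integrable lborel (\<lambda>t. (p t)\<^sup>2)"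
    and eq: "\<And>t. 0 < t \<Longrightarrow> t < 1 \<Longrightarrow> speed \<gamma> t = p t" "\<And>t. 0 < t \<Longrightarrow> t < 1 \<Longrightarrow> g (\<gamma> t) = k t"
    by (rule profile[OF AC zero_less_one]) (rule that)
  have speed: "speed (\<lambda>t. \<gamma> (1 - t)) t = speed \<gamma> (1 - t)" for t
  proof -
    have "speed (\<lambda>s. \<gamma> (1 - s)) t = \<bar>-1\<bar> * speed \<gamma> (1 - t)"
      by (rule speed_compose[where \<psi>="\<lambda>s. 1 - s"]) (auto intro!: derivative_eq_intros)
    then show ?thesis by simp
  qed
  have "weighted_length (\<lambda>t. \<gamma> (1 - t)) 0 1 = (\<integral>\<^sup>+t\<in>{0..1}. ennreal (p (1 - t) * k (1 - t)) \<partial>lborel)"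
    unfolding weighted_length_def by (rule nn_integral_interior_cong) (simp add: speed eq)
  also have "\<dots> = (\<integral>\<^sup>+t. ennreal (p (1 + (-1) * t) * k (1 + (-1) * t)) * indicator {0..1} (1 + (-1) * t) \<partial>lborel)"
    by (intro nn_integral_cong) (auto split: split_indicator)
  also have "\<dots> = (\<integral>\<^sup>+s\<in>{0..1}. ennreal (p s * k s) \<partial>lborel)"
    using nn_integral_real_affine[of "\<lambda>s. ennreal (p s * k s) * indicator {0..1} s" "-1" 1] by simp
  also have "\<dots> = weighted_length \<gamma> 0 1"
    unfolding weighted_length_def by (rule nn_integral_interior_cong) (simp add: eq)
  finally show ?thesis .
qed

lemma weighted_length_split:
  assumes AC: "AC 2 E {a..c} \<gamma>" and abc: "a < b" "b < c"
  shows "weighted_length \<gamma> a c = weighted_length \<gamma> a b + weighted_length \<gamma> b c"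
proof -
  have ac: "a < c" using abc by simp
  obtain p k K where pk [measurable]: "p \<in> borel_measurable borel" "k \<in> borel_measurable borel"
    and p: "\<And>t. 0 \<le> p t" and k: "\<And>t. 0 \<le> k t" "\<And>t. k t \<le> K" and p2: "integrable lborel (\<lambda>t. (p t)\<^sup>2)"
    and eq: "\<And>t. a < t \<Longrightarrow> t < c \<Longrightarrow> speed \<gamma> t = p t" "\<And>t. a < t \<Longrightarrow> t < c \<Longrightarrow> g (\<gamma> t) = k t"
    by (rule profile[OF AC ac]) (rule that)
  have L: "weighted_length \<gamma> s t = (\<integral>\<^sup>+u\<in>{s..t}. ennreal (p u * k u) \<partial>lborel)" if "a \<le> s" "t \<le> c" for s t
    unfolding weighted_length_def by (rule nn_integral_interior_cong) (use that in \<open>simp add: eq\<close>)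
  have "(\<integral>\<^sup>+u\<in>{a..c}. ennreal (p u * k u) \<partial>lborel)
      = (\<integral>\<^sup>+u. ennreal (p u * k u) * indicator {a..b} u + ennreal (p u * k u) * indicator {b..c} u \<partial>lborel)"
    using AE_lborel_singleton[of b] abc
    by (intro nn_integral_cong_AE) (auto elim!: eventually_mono split: split_indicator)
  also have "\<dots> = (\<integral>\<^sup>+u\<in>{a..b}. ennreal (p u * k u) \<partial>lborel) + (\<integral>\<^sup>+u\<in>{b..c}. ennreal (p u * k u) \<partial>lborel)"
    by (rule nn_integral_add) measurable
  finally show ?thesis using abc by (simp add: L)
qed

lemma concatenation:
  assumes 1: "AC 2 E {0..1} \<gamma>" and 2: "AC 2 E {0..1} \<eta>" and eq: "\<gamma> 1 = \<eta> 0"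
  obtains \<zeta> where "AC 2 E {0..1} \<zeta>" "\<zeta> 0 = \<gamma> 0" "\<zeta> 1 = \<eta> 1"
    "weighted_length \<zeta> 0 1 = weighted_length \<gamma> 0 1 + weighted_length \<eta> 0 1"
proof -
  interpret L: time_change "\<lambda>t. 2 * t + 0" "\<lambda>u. (u - 0) / 2" "\<lambda>_. 2" by (rule time_change_affine) simp
  interpret R: time_change "\<lambda>t. 2 * t + (-1)" "\<lambda>u. (u - (-1)) / 2" "\<lambda>_. 2" by (rule time_change_affine) simp
  define \<zeta> where "\<zeta> = (\<lambda>t. if t \<le> 1 / 2 then \<gamma> (2 * t + 0) else \<eta> (2 * t + (-1)))"
  have left: "\<zeta> t = \<gamma> (2 * t + 0)" if "t \<le> 1 / 2" for t using that by (simp add: \<zeta>_def)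
  have right: "\<zeta> t = \<eta> (2 * t + (-1))" if "1 / 2 \<le> t" for t
  proof (cases "t = 1 / 2")
    case True
    show ?thesis unfolding \<zeta>_def True using eq by simp
  next
    case False
    then show ?thesis using that by (simp add: \<zeta>_def)
  qed
  have AC1: "AC 2 E {0..1 / 2} \<zeta>"
    using L.AC2_time_change[of E 0 "1 / 2" \<gamma>] 1 AC_cong[of "{0..1 / 2}" \<zeta> "\<lambda>t. \<gamma> (2 * t + 0)"] left by simp
  have AC2: "AC 2 E {1 / 2..1} \<zeta>"
    using R.AC2_time_change[of E "1 / 2" 1 \<eta>] 2 AC_cong[of "{1 / 2..1}" \<zeta> "\<lambda>t. \<eta> (2 * t + (-1))"] right by simp
  have AC: "AC 2 E {0..1} \<zeta>" by (rule AC2_concat[OF AC1 AC2]) auto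
  have "weighted_length \<zeta> 0 (1 / 2) = weighted_length (\<lambda>t. \<gamma> (2 * t + 0)) 0 (1 / 2)"
    by (rule weighted_length_cong) (simp add: left)
  also have "\<dots> = weighted_length \<gamma> 0 1"
    using weighted_length_time_change[OF L.time_change_axioms, of 0 "1 / 2" \<gamma>] 1 by simp
  finally have W1: "weighted_length \<zeta> 0 (1 / 2) = weighted_length \<gamma> 0 1" .
  have "weighted_length \<zeta> (1 / 2) 1 = weighted_length (\<lambda>t. \<eta> (2 * t + (-1))) (1 / 2) 1"
    by (rule weighted_length_cong) (simp add: right)
  also have "\<dots> = weighted_length \<eta> 0 1"
    using weighted_length_time_change[OF R.time_change_axioms, of "1 / 2" 1 \<eta>] 2 by simp
  finally have W2: "weighted_length \<zeta> (1 / 2) 1 = weighted_length \<eta> 0 1" .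
  show ?thesis
    using that[OF AC] weighted_length_split[OF AC, of "1 / 2"] W1 W2 left[of 0] right[of 1] by simp
qed

text \<open>
  The curve is run with the clock of a nearly optimal weight \<open>w\<close>. At the time \<open>t\<close> with \<open>\<phi> t = s\<close> the speed is
  \<open>p s / w s\<close> and \<open>ds = dt / w s\<close>, so that the action becomes \<open>\<integral>(p\<^sup>2 / w + k\<^sup>2 w) / 2\<close> over \<open>[0,1]\<close>.
\<close>

lemma near_optimal_reparametrization:
  assumes AC: "AC 2 E {0..1} \<gamma>" and e: "0 < (e::real)"
  obtains T \<eta> where "0 < T" "AC 2 E {0..T} \<eta>" "\<eta> 0 = \<gamma> 0" "\<eta> T = \<gamma> 1"
    "action \<eta> 0 T \<le> weighted_length \<gamma> 0 1 + ennreal e"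
proof -
  obtain p k K where pk [measurable]: "p \<in> borel_measurable borel" "k \<in> borel_measurable borel"
    and p: "\<And>t. 0 \<le> p t" and k: "\<And>t. 0 \<le> k t" "\<And>t. k t \<le> K" and p2: "integrable lborel (\<lambda>t. (p t)\<^sup>2)"
    and eq: "\<And>t. 0 < t \<Longrightarrow> t < 1 \<Longrightarrow> speed \<gamma> t = p t" "\<And>t. 0 < t \<Longrightarrow> t < 1 \<Longrightarrow> g (\<gamma> t) = k t"
    by (rule profile[OF AC zero_less_one]) (rule that)
  obtain w c where w: "continuous_on UNIV w" "0 < c" "\<And>t. c \<le> w t"
    and w_le: "(\<integral>\<^sup>+t\<in>{0..1}. ennreal (1 / 2 * ((p t)\<^sup>2 / w t) + 1 / 2 * ((k t)\<^sup>2 * w t)) \<partial>lborel)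
       \<le> (\<integral>\<^sup>+t\<in>{0..1}. ennreal (p t * k t) \<partial>lborel) + ennreal e"
    by (rule near_optimal_weight[OF pk p p2 k e]) (rule that)
  have w_pos: "0 < w t" for t using w(2) w(3)[of t] by linarith
  have [measurable]: "w \<in> borel_measurable borel" using w(1) by (rule borel_measurable_continuous_onI)
  obtain \<theta> \<phi> where tc: "time_change \<phi> \<theta> (\<lambda>t. 1 / w (\<phi> t))" and \<theta>0: "\<theta> 0 = 0"
    by (rule time_change_antiderivative[OF w]) (rule that)
  interpret time_change \<phi> \<theta> "\<lambda>t. 1 / w (\<phi> t)" by (rule tc)
  define T where "T = \<theta> 1"
  have \<phi>0: "\<phi> 0 = 0" using inv(2)[of 0] \<theta>0 by simp
  have \<phi>T: "\<phi> T = 1" using inv(2)[of 1] by (simp add: T_def)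
  have T: "0 < T"
  proof (rule ccontr)
    assume "\<not> 0 < T"
    then have "\<phi> T \<le> \<phi> 0" by (intro mono) simp
    then show False by (simp add: \<phi>0 \<phi>T)
  qed
  have "action (\<lambda>t. \<gamma> (\<phi> t)) 0 T
      = (\<integral>\<^sup>+t\<in>{0..T}. ennreal ((1 / 2 * ((p (\<phi> t))\<^sup>2 / w (\<phi> t)) + 1 / 2 * ((k (\<phi> t))\<^sup>2 * w (\<phi> t))) * (1 / w (\<phi> t))) \<partial>lborel)"
    unfolding action_def
  proof (rule nn_integral_interior_cong)
    fix t assume t: "0 < t" "t < T"
    then have "0 < \<phi> t" "\<phi> t < 1" using strict_mono[of 0 t] strict_mono[of t T] by (auto simp: \<phi>0 \<phi>T)
    then show "ennreal (1 / 2 * (speed (\<lambda>t. \<gamma> (\<phi> t)) t)\<^sup>2 + 1 / 2 * (g (\<gamma> (\<phi> t)))\<^sup>2)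
        = ennreal ((1 / 2 * ((p (\<phi> t))\<^sup>2 / w (\<phi> t)) + 1 / 2 * ((k (\<phi> t))\<^sup>2 * w (\<phi> t))) * (1 / w (\<phi> t)))"
      using w_pos[of "\<phi> t"]
      by (simp add: speed_time_change eq power_divide power2_eq_square field_simps)
  qed
  also have "\<dots> = (\<integral>\<^sup>+s\<in>{\<phi> 0..\<phi> T}. ennreal (1 / 2 * ((p s)\<^sup>2 / w s) + 1 / 2 * ((k s)\<^sup>2 * w s)) \<partial>lborel)"
  proof (rule nn_integral_time_change)
    show "0 \<le> 1 / 2 * ((p t)\<^sup>2 / w t) + 1 / 2 * ((k t)\<^sup>2 * w t)" for t
      using less_imp_le[OF w_pos[of t]] by (intro add_nonneg_nonneg mult_nonneg_nonneg) auto
  qed (use T in auto)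
  also have "\<dots> \<le> (\<integral>\<^sup>+t\<in>{0..1}. ennreal (p t * k t) \<partial>lborel) + ennreal e"
    using w_le by (simp add: \<phi>0 \<phi>T)
  also have "(\<integral>\<^sup>+t\<in>{0..1}. ennreal (p t * k t) \<partial>lborel) = weighted_length \<gamma> 0 1"
    unfolding weighted_length_def by (rule nn_integral_interior_cong) (simp add: eq)
  finally have A: "action (\<lambda>t. \<gamma> (\<phi> t)) 0 T \<le> weighted_length \<gamma> 0 1 + ennreal e" .
  have "AC 2 E {0..T} (\<lambda>t. \<gamma> (\<phi> t))"
    using AC T by (intro AC2_time_change) (simp_all add: \<phi>0 \<phi>T)
  then show ?thesis using that[OF T _ _ _ A] by (simp add: \<phi>0 \<phi>T)
qed

end

section \<open>The pseudo-distance\<close>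

text \<open>
  Only interior points matter: at the end points the metric derivative relative to \<open>{a..b}\<close> is a one-sided limit
  and may differ from the two-sided one.
\<close>

lemma ext_integral_Icc:
  fixes a b :: real
  assumes "\<And>t. a < t \<Longrightarrow> t < b \<Longrightarrow> h t = f t" "\<And>t. a < t \<Longrightarrow> t < b \<Longrightarrow> 0 \<le> f t"
  shows "ext_integral (restrict_space lborel {a..b}) (\<lambda>t. ereal (h t)) = enn2ereal (\<integral>\<^sup>+t\<in>{a..b}. ennreal (f t) \<partial>lborel)"
proof -
  have "(\<integral>\<^sup>+t. e2ennreal (ereal (h t)) \<partial>restrict_space lborel {a..b}) = (\<integral>\<^sup>+t\<in>{a..b}. ennreal (f t) \<partial>lborel)"
    by (subst nn_integral_restrict_space, simp)
       (rule nn_integral_cong_AE, use AE_interior[of a b] assms(1) in \<open>auto elim!: eventually_mono split: split_indicator simp: ennreal.abs_eq\<close>)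
  moreover have "(\<integral>\<^sup>+t. e2ennreal (- ereal (h t)) \<partial>restrict_space lborel {a..b}) = (\<integral>\<^sup>+t. 0 \<partial>(lborel :: real measure))"
    by (subst nn_integral_restrict_space, simp)
       (rule nn_integral_cong_AE, use AE_interior[of a b] assms in \<open>auto elim!: eventually_mono split: split_indicator simp: e2ennreal_neg ennreal_neg\<close>)
  ultimately show ?thesis by (simp add: ext_integral_def zero_ennreal.rep_eq)
qed

text \<open>
  The control cost is nonnegative and the discount \<open>exp (- t)\<close> has total mass \<open>1\<close>, so the value inherits
  the lower bound of the running cost. In terms of \<open>ext_integral\<close>: the negative part of the integrand
  integrates to at most \<open>C\<close>.
\<close>

lemma v0_ge:
  assumes C: "0 \<le> C" "\<And>\<nu>. \<nu> \<in> P2 E \<Longrightarrow> - C \<le> l \<nu>"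
  shows "ereal (- C) \<le> v0 E l \<mu>"
  unfolding v0_def
proof (rule INF_greatest, clarify)
  fix \<gamma> \<alpha> assume "(\<gamma>, \<alpha>) \<in> A0 E \<mu>"
  then have "continuous_map (top_of_set {0..}) (P2_topology E) \<gamma>" by (simp add: A0_def)
  then have P2: "\<gamma> t \<in> P2 E" if "0 \<le> t" for t
    using that by (auto simp: continuous_map_def Pi_iff Metric_space.topspace_mtopology[OF Metric_space_W2])
  define f where "f = (\<lambda>t. ereal (exp (- t)) * (ereal (1 / 2) * enn2ereal (\<integral>\<^sup>+x. ennreal ((norm (\<alpha> t x))\<^sup>2) \<partial>\<gamma> t) + ereal (l (\<gamma> t))))"
  have "(\<integral>\<^sup>+t. e2ennreal (- f t) \<partial>restrict_space lborel {0..})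
      = (\<integral>\<^sup>+t. e2ennreal (- f t) * indicator {0..} t \<partial>lborel)"
    by (rule nn_integral_restrict_space) simp
  also have "\<dots> \<le> (\<integral>\<^sup>+t. ennreal C * (ennreal (t ^ 0 * exp (- t)) * indicator {0..} t) \<partial>lborel)"
  proof (rule nn_integral_mono)
    fix t :: real
    have "e2ennreal (- f t) \<le> ennreal (C * exp (- t))" if t: "0 \<le> t"
    proof -
      have "0 \<le> ereal (1 / 2) * enn2ereal (\<integral>\<^sup>+x. ennreal ((norm (\<alpha> t x))\<^sup>2) \<partial>\<gamma> t)" by simp
      then have "0 + ereal (- C) \<le> ereal (1 / 2) * enn2ereal (\<integral>\<^sup>+x. ennreal ((norm (\<alpha> t x))\<^sup>2) \<partial>\<gamma> t) + ereal (l (\<gamma> t))"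
        using C(2)[OF P2[OF t]] by (intro add_mono) auto
      then have "ereal (exp (- t)) * (0 + ereal (- C)) \<le> f t"
        unfolding f_def by (intro ereal_mult_left_mono) auto
      then have "- f t \<le> - (ereal (exp (- t)) * (0 + ereal (- C)))" by (simp only: ereal_minus_le_minus)
      also have "\<dots> = ereal (C * exp (- t))" by simp
      finally have "e2ennreal (- f t) \<le> e2ennreal (ereal (C * exp (- t)))" by (rule e2ennreal_mono)
      then show ?thesis by simp
    qed
    then show "e2ennreal (- f t) * indicator {0..} t \<le> ennreal C * (ennreal (t ^ 0 * exp (- t)) * indicator {0..} t)"
      using C(1) by (auto simp: ennreal_mult split: split_indicator)
  qed
  also have "\<dots> = ennreal C"
    by (subst nn_integral_cmult, simp, subst nn_intergal_power_times_exp_Ici) simp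
  finally have "enn2ereal (\<integral>\<^sup>+t. e2ennreal (- f t) \<partial>restrict_space lborel {0..}) \<le> ereal C"
    using C(1) by (metis less_eq_ennreal.rep_eq enn2ereal_ennreal)
  then have "0 - ereal C \<le> ext_integral (restrict_space lborel {0..}) f"
    unfolding ext_integral_def by (intro ereal_minus_mono) auto
  then show "ereal (- C) \<le> ext_integral (restrict_space lborel {0..})
     (\<lambda>t. ereal (exp (- t)) * (ereal (1 / 2) * enn2ereal (\<integral>\<^sup>+x. ennreal ((norm (\<alpha> t x))\<^sup>2) \<partial>\<gamma> t) + ereal (l (\<gamma> t))))"
    by (simp add: f_def)
qed

lemma AC2_continuous_map:
  assumes AC: "AC 2 E {a..b} \<gamma>"
  shows "continuous_map (top_of_set {a..b}) (P2_topology E) \<gamma>"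
  unfolding Metric_space.continuous_map_to_metric[OF Metric_space_W2]
proof (intro ballI allI impI)
  obtain f where f: "\<And>t. 0 \<le> f t" "integrable lborel f"
    and le: "\<And>s t. a \<le> s \<Longrightarrow> s \<le> t \<Longrightarrow> t \<le> b \<Longrightarrow> (W2 (\<gamma> s) (\<gamma> t))\<^sup>2 \<le> (t - s) * (LBINT u:{s..t}. f u)"
    using AC2_energy_density[OF AC] by metis
  define M where "M = (LBINT u. f u) + 1"
  have M: "M > 0" using f(1) by (auto simp: M_def intro!: add_nonneg_pos integral_nonneg_AE)
  have le_total: "(LBINT u:{s..t}. f u) \<le> M" for s t
  proof -
    have "(LBINT u:{s..t}. f u) \<le> (LBINT u. f u)"
      unfolding set_lebesgue_integral_def
      using integrable_mult_indicator[OF _ f(2), of "{s..t}"] f(1)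
      by (intro integral_mono f(2)) (auto split: split_indicator)
    then show ?thesis by (simp add: M_def)
  qed
  have le1: "(W2 (\<gamma> s) (\<gamma> t))\<^sup>2 \<le> (t - s) * M" if "a \<le> s" "s \<le> t" "t \<le> b" for s t
    using le[OF that] mult_left_mono[OF le_total[of s t], of "t - s"] that by linarith
  have hoelder: "(W2 (\<gamma> s) (\<gamma> t))\<^sup>2 \<le> \<bar>s - t\<bar> * M" if "s \<in> {a..b}" "t \<in> {a..b}" for s t
    using le1[of s t] le1[of t s] that W2_commute[of "\<gamma> s" "\<gamma> t"] by (cases "s \<le> t") auto
  fix t \<epsilon> :: real assume "t \<in> topspace (top_of_set {a..b})" and \<epsilon>: "0 < \<epsilon>"
  then have t: "t \<in> {a..b}" by simp
  define U where "U = {a..b} \<inter> ball t (\<epsilon>\<^sup>2 / M)"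
  have "\<gamma> s \<in> Metric_space.mball (P2 E) W2 (\<gamma> t) \<epsilon>" if s: "s \<in> U" for s
  proof -
    have "(W2 (\<gamma> t) (\<gamma> s))\<^sup>2 \<le> \<bar>t - s\<bar> * M" using s t by (intro hoelder) (auto simp: U_def)
    also have "\<dots> < \<epsilon>\<^sup>2" using s M by (simp add: U_def dist_real_def field_simps)
    finally have "W2 (\<gamma> t) (\<gamma> s) < \<epsilon>" using \<epsilon> by (intro power2_less_imp_less[of _ \<epsilon>]) auto
    then show ?thesis
      using AC_P2[OF AC] s t by (simp add: Metric_space.in_mball[OF Metric_space_W2] U_def)
  qed
  moreover have "openin (top_of_set {a..b}) U" unfolding U_def by (rule openin_open_Int) simp
  moreover have "t \<in> U" using t M \<epsilon> by (simp add: U_def)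
  ultimately show "\<exists>U. openin (top_of_set {a..b}) U \<and> t \<in> U \<and> (\<forall>y\<in>U. \<gamma> y \<in> Metric_space.mball (P2 E) W2 (\<gamma> t) \<epsilon>)"
    by blast
qed

text \<open>
  For boundedness: \<open>\<ell>\<close> is continuous along the curve, hence bounded above on the compact interval, and \<open>v\<^sub>0\<close> is bounded
  below, so \<open>G\<^sup>2 = 2 (\<ell> - v\<^sub>0)\<close> is bounded above.
\<close>

lemma path_cost_G:
  fixes E :: "'a::euclidean_space set"
  assumes l_continuous: "continuous_map (P2_topology E) euclideanreal l"
    and l_bounded_below: "bdd_below (l ` P2 E)"
    and G_well_defined: "G_well_defined E l"
    and G_upper_gradient: "strong_upper_gradient E (\<lambda>\<mu>. real_of_ereal (v0 E l \<mu>)) (G E l)"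
  shows "path_cost E (G E l)"
proof
  fix \<mu> assume \<mu>: "\<mu> \<in> P2 E"
  then have "real_of_ereal (v0 E l \<mu>) \<le> l \<mu>"
    using G_well_defined unfolding G_well_defined_def by (cases "v0 E l \<mu>") auto
  then show "0 \<le> G E l \<mu>" by (simp add: G_def)
next
  fix a b \<gamma> assume "AC 2 E {a..b} \<gamma>"
  then have "AC 1 E {a..b} \<gamma>" by (rule AC2_imp_AC1)
  then show "(\<lambda>t. G E l (\<gamma> t)) \<in> borel_measurable (restrict_space borel {a..b})"
    using G_upper_gradient is_interval_cc[of a b] unfolding strong_upper_gradient_def by blast
next
  fix a b \<gamma> assume AC: "AC 2 E {a..b} \<gamma>"
  obtain c where c: "\<And>\<nu>. \<nu> \<in> P2 E \<Longrightarrow> c \<le> l \<nu>" using l_bounded_below by (auto simp: bdd_below_def)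
  define C where "C = \<bar>c\<bar>"
  have C: "0 \<le> C" by (simp add: C_def)
  have lC: "- C \<le> l \<nu>" if "\<nu> \<in> P2 E" for \<nu> using c[OF that] by (simp add: C_def)
  have "continuous_map (top_of_set {a..b}) euclideanreal (l \<circ> \<gamma>)"
    by (rule continuous_map_compose[OF AC2_continuous_map[OF AC] l_continuous])
  then have "continuous_on {a..b} (l \<circ> \<gamma>)" by simp
  then have "bounded ((l \<circ> \<gamma>) ` {a..b})" using compact_continuous_image compact_imp_bounded by blast
  then obtain L where "\<forall>x\<in>(l \<circ> \<gamma>) ` {a..b}. norm x \<le> L" unfolding bounded_iff by blast
  then have L: "\<bar>l (\<gamma> t)\<bar> \<le> L" if "t \<in> {a..b}" for t using that by auto
  have "G E l (\<gamma> t) \<le> sqrt (2 * (L + C))" if t: "t \<in> {a..b}" for t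
  proof -
    have "\<bar>v0 E l (\<gamma> t)\<bar> \<noteq> \<infinity>"
      using bspec[OF G_well_defined[unfolded G_well_defined_def] AC_P2[OF AC t]] by (rule conjunct1)
    moreover have "ereal (- C) \<le> v0 E l (\<gamma> t)" by (rule v0_ge[OF C lC])
    ultimately have "- C \<le> real_of_ereal (v0 E l (\<gamma> t))" by (cases "v0 E l (\<gamma> t)") auto
    then show ?thesis using L[OF t] by (simp add: G_def)
  qed
  then show "\<exists>K. \<forall>t\<in>{a..b}. G E l (\<gamma> t) \<le> K" by blast
qed

theorem proposition3p6:
  fixes E :: "'a::euclidean_space set"
    and l :: "'a measure \<Rightarrow> real"
  assumes l_continuous: "continuous_map (P2_topology E) euclideanreal l"
    and l_bounded_below: "bdd_below (l ` P2 E)"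
    and G_well_defined: "G_well_defined E l"
    and G_upper_gradient: "strong_upper_gradient E (\<lambda>\<mu>. real_of_ereal (v0 E l \<mu>)) (G E l)"
  shows "(\<forall>\<mu>\<in>P2 E. \<forall>\<nu>\<in>P2 E. d_G E l \<mu> \<nu> \<ge> 0 \<and> d_G E l \<mu> \<nu> = d_G E l \<nu> \<mu>) \<and>
         (\<forall>\<mu>0\<in>P2 E. \<forall>\<mu>1\<in>P2 E. \<forall>\<mu>2\<in>P2 E. d_G E l \<mu>0 \<mu>1 + d_G E l \<mu>1 \<mu>2 \<ge> d_G E l \<mu>0 \<mu>2) \<and>
         (\<forall>\<mu>\<in>P2 E. \<forall>\<nu>\<in>P2 E. d_G E l \<mu> \<nu> = (INF T\<in>{0<..}. energy_G E l T \<mu> \<nu>)) \<and>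
         pseudo_distance_on (P2 E) (d_G E l)"
proof -
  interpret path_cost E "G E l" by (rule path_cost_G[OF assms])
  let ?\<Gamma> = "\<lambda>\<mu> \<nu>. {\<gamma>. AC 2 E {0..1} \<gamma> \<and> \<gamma> 0 = \<mu> \<and> \<gamma> 1 = \<nu>}"
  have d_G: "d_G E l \<mu> \<nu> = (INF \<gamma>\<in>?\<Gamma> \<mu> \<nu>. enn2ereal (weighted_length \<gamma> 0 1))" for \<mu> \<nu>
    unfolding d_G_def weighted_length_def
    by (intro INF_cong ext_integral_Icc refl)
       (auto simp: metric_derivative_interior intro!: mult_nonneg_nonneg speed_nonneg nonneg elim!: AC_P2)
  have energy: "energy_G E l T \<mu> \<nu>
      = (INF \<eta>\<in>{\<eta>. AC 2 E {0..T} \<eta> \<and> \<eta> 0 = \<mu> \<and> \<eta> T = \<nu>}. enn2ereal (action \<eta> 0 T))" for T \<mu> \<nu>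
    unfolding energy_G_def action_def
    by (intro INF_cong ext_integral_Icc refl) (auto simp: metric_derivative_interior)
  have d_G_le: "d_G E l (\<gamma> 0) (\<gamma> 1) \<le> enn2ereal (weighted_length \<gamma> 0 1)" if "AC 2 E {0..1} \<gamma>" for \<gamma>
    unfolding d_G using that by (intro INF_lower) auto
  have nonneg_d: "0 \<le> d_G E l \<mu> \<nu>" for \<mu> \<nu>
    unfolding d_G by (intro INF_greatest) simp
  have sym_le: "d_G E l \<nu> \<mu> \<le> d_G E l \<mu> \<nu>" for \<mu> \<nu>
    unfolding d_G[of \<mu> \<nu>]
  proof (rule INF_greatest, clarify)
    fix \<gamma> assume \<gamma>: "AC 2 E {0..1} \<gamma>"
    show "d_G E l (\<gamma> 1) (\<gamma> 0) \<le> enn2ereal (weighted_length \<gamma> 0 1)"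
      using d_G_le[OF AC2_reverse[OF \<gamma>]] by (simp add: weighted_length_reverse[OF \<gamma>])
  qed
  have refl: "d_G E l \<mu> \<mu> = 0" if \<mu>: "\<mu> \<in> P2 E" for \<mu>
  proof (rule antisym[OF _ nonneg_d])
    have "AC 2 E {0..1} (\<lambda>_. \<mu>)"
      by (rule AC_intro[where m="\<lambda>_. 0"]) (use \<mu> in \<open>auto simp: W2_self set_integrable_def set_lebesgue_integral_def\<close>)
    moreover have "speed (\<lambda>_. \<mu>) t = 0" for t
      by (rule speed_eqI) (simp add: W2_self[OF \<mu>])
    then have "weighted_length (\<lambda>_. \<mu>) 0 1 = 0" by (simp add: weighted_length_def)
    ultimately show "d_G E l \<mu> \<mu> \<le> 0" using d_G_le[of "\<lambda>_. \<mu>"] by (simp add: zero_ennreal.rep_eq)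
  qed
  have triangle: "d_G E l \<mu> \<rho> \<le> d_G E l \<mu> \<nu> + d_G E l \<nu> \<rho>" for \<mu> \<nu> \<rho>
  proof (cases "?\<Gamma> \<mu> \<nu> = {} \<or> ?\<Gamma> \<nu> \<rho> = {}")
    case True
    moreover have "d_G E l \<mu> \<nu> = \<infinity>" if "?\<Gamma> \<mu> \<nu> = {}" for \<mu> \<nu>
      unfolding d_G that by (simp add: top_ereal_def)
    ultimately have "d_G E l \<mu> \<nu> = \<infinity> \<or> d_G E l \<nu> \<rho> = \<infinity>" by blast
    then show ?thesis using nonneg_d[of \<mu> \<nu>] nonneg_d[of \<nu> \<rho>] by auto
  next
    case False
    have "d_G E l \<mu> \<rho> \<le> (INF \<gamma>\<in>?\<Gamma> \<mu> \<nu>. enn2ereal (weighted_length \<gamma> 0 1) + d_G E l \<nu> \<rho>)"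
    proof (rule INF_greatest)
      fix \<gamma> assume \<gamma>: "\<gamma> \<in> ?\<Gamma> \<mu> \<nu>"
      have "d_G E l \<mu> \<rho> \<le> (INF \<eta>\<in>?\<Gamma> \<nu> \<rho>. enn2ereal (weighted_length \<gamma> 0 1) + enn2ereal (weighted_length \<eta> 0 1))"
      proof (rule INF_greatest)
        fix \<eta> assume \<eta>: "\<eta> \<in> ?\<Gamma> \<nu> \<rho>"
        obtain \<zeta> where "AC 2 E {0..1} \<zeta>" "\<zeta> 0 = \<gamma> 0" "\<zeta> 1 = \<eta> 1"
          "weighted_length \<zeta> 0 1 = weighted_length \<gamma> 0 1 + weighted_length \<eta> 0 1"
          using concatenation[of \<gamma> \<eta>] \<gamma> \<eta> by auto
        then show "d_G E l \<mu> \<rho> \<le> enn2ereal (weighted_length \<gamma> 0 1) + enn2ereal (weighted_length \<eta> 0 1)"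
          using d_G_le[of \<zeta>] \<gamma> \<eta> by (simp add: plus_ennreal.rep_eq)
      qed
      also have "\<dots> = enn2ereal (weighted_length \<gamma> 0 1) + d_G E l \<nu> \<rho>"
        unfolding d_G[of \<nu> \<rho>] using False by (intro INF_ereal_add_right) auto
      finally show "d_G E l \<mu> \<rho> \<le> enn2ereal (weighted_length \<gamma> 0 1) + d_G E l \<nu> \<rho>" .
    qed
    also have "\<dots> = d_G E l \<mu> \<nu> + d_G E l \<nu> \<rho>"
      unfolding d_G[of \<mu> \<nu>] using False nonneg_d[of \<nu> \<rho>] by (intro INF_ereal_add_left) auto
    finally show ?thesis .
  qed
  have energy_eq: "d_G E l \<mu> \<nu> = (INF T\<in>{0<..}. energy_G E l T \<mu> \<nu>)" for \<mu> \<nu>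
  proof (rule antisym)
    show "d_G E l \<mu> \<nu> \<le> (INF T\<in>{0<..}. energy_G E l T \<mu> \<nu>)"
      unfolding energy
    proof (intro INF_greatest)
      fix T :: real and \<eta>
      assume T: "T \<in> {0<..}" and "\<eta> \<in> {\<eta>. AC 2 E {0..T} \<eta> \<and> \<eta> 0 = \<mu> \<and> \<eta> T = \<nu>}"
      then have \<eta>: "AC 2 E {0..T} \<eta>" and ends: "\<eta> 0 = \<mu>" "\<eta> T = \<nu>" by auto
      interpret time_change "\<lambda>t. T * t + 0" "\<lambda>u. (u - 0) / T" "\<lambda>_. T"
        using T by (intro time_change_affine) simp
      have "AC 2 E {0..1} (\<lambda>t. \<eta> (T * t + 0))" using \<eta> by (intro AC2_time_change) simp_all
      from d_G_le[OF this] have "d_G E l \<mu> \<nu> \<le> enn2ereal (weighted_length (\<lambda>t. \<eta> (T * t + 0)) 0 1)"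
        by (simp add: ends)
      also have "weighted_length (\<lambda>t. \<eta> (T * t + 0)) 0 1 = weighted_length \<eta> 0 T"
        using weighted_length_time_change[OF time_change_axioms, of 0 1 \<eta>] \<eta> by simp
      also have "enn2ereal (weighted_length \<eta> 0 T) \<le> enn2ereal (action \<eta> 0 T)"
        using weighted_length_le_action[of \<eta> 0 T] by (simp add: less_eq_ennreal.rep_eq)
      finally show "d_G E l \<mu> \<nu> \<le> enn2ereal (action \<eta> 0 T)" .
    qed
    show "(INF T\<in>{0<..}. energy_G E l T \<mu> \<nu>) \<le> d_G E l \<mu> \<nu>"
      unfolding d_G
    proof (rule INF_greatest)
      fix \<gamma> assume \<gamma>: "\<gamma> \<in> ?\<Gamma> \<mu> \<nu>"
      show "(INF T\<in>{0<..}. energy_G E l T \<mu> \<nu>) \<le> enn2ereal (weighted_length \<gamma> 0 1)"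
      proof (rule ereal_le_epsilon2)
        fix e :: real assume e: "0 < e"
        obtain T \<eta> where T: "0 < T" and \<eta>: "AC 2 E {0..T} \<eta>" "\<eta> 0 = \<gamma> 0" "\<eta> T = \<gamma> 1"
          and le: "action \<eta> 0 T \<le> weighted_length \<gamma> 0 1 + ennreal e"
          using near_optimal_reparametrization[of \<gamma> e] \<gamma> e by auto
        have "(INF T\<in>{0<..}. energy_G E l T \<mu> \<nu>) \<le> energy_G E l T \<mu> \<nu>"
          using T by (intro INF_lower) simp
        also have "\<dots> \<le> enn2ereal (action \<eta> 0 T)"
          unfolding energy using \<eta> \<gamma> by (intro INF_lower) auto
        also have "\<dots> \<le> enn2ereal (weighted_length \<gamma> 0 1 + ennreal e)"
          using le by (simp add: less_eq_ennreal.rep_eq)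
        also have "\<dots> = enn2ereal (weighted_length \<gamma> 0 1) + ereal e"
          using e by (simp add: plus_ennreal.rep_eq enn2ereal_ennreal)
        finally show "(INF T\<in>{0<..}. energy_G E l T \<mu> \<nu>) \<le> enn2ereal (weighted_length \<gamma> 0 1) + ereal e" .
      qed
    qed
  qed
  have sym: "d_G E l \<mu> \<nu> = d_G E l \<nu> \<mu>" for \<mu> \<nu> by (rule antisym) (rule sym_le)+
  show ?thesis
    unfolding pseudo_distance_on_def
    by (intro conjI ballI nonneg_d sym triangle energy_eq refl)
qed

end
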